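(* Let $\Omega\subset\mathbb{R}^2$ be a partially rectangular planar domain as described in the context (boundary $\Gamma=\partial\Omega$ of class $C^{1,1}$ and piecewise $C^\infty$). Let $\epsilon_0>0$ and let $E(\lambda)=\mathcal{O}(\lambda^{-\epsilon_0})$ as $\lambda\to\infty$. Suppose that, for $\lambda\to\infty$, $u=u_\lambda$ satisfies $$-\Delta u=\lambda^2 u+E(\lambda)\|u\| \ \text{ in } \Omega,\qquad u|_\Gamma=0,$$ (i.e. $\|(-\Delta-\lambda^2)u\|_{L^2(\Omega)}\le E(\lambda)\|u\|_{L^2(\Omega)}$ with Dirichlet boundary condition). Then for any $\delta>0$ there exists $c_\delta>0$ such that (for $\lambda$ large) at least one of the following three inequalities holds: $$\|u\|_{L^2(\Omega\setminus R)}\ge c_\delta\lambda^{-2-\delta}\|u\|_{L^2(\Omega)},$$ $$\|\lambda^{-1}D_x u\|_{L^2(\Omega\setminus R)}\ge c_\delta\lambda^{-2-\delta}\|u\|_{L^2(\Omega)},$$ $$\|(\lambda^{-1}D_x)^2 u\|_{L^2(\Omega\setminus R)}\ge c_\delta\lambda^{-2-\delta}\|u\|_{L^2(\Omega)}.$$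
   Context: Geometry: $\Omega\subset\mathbb{R}^2$ is a planar domain whose boundary $\Gamma=\partial\Omega$ is $C^{1,1}$ and piecewise $C^\infty$. Let $a>0$ and $R=[-a,a]\times[-\pi,\pi]$, with $\partial R=\Gamma_1\cup\Gamma_2$, where $\Gamma_1=[-a,a]\times\{\pi\}\cup[-a,a]\times\{-\pi\}$ (horizontal sides) and $\Gamma_2$ the two vertical sides. Assume $R\subset\Omega$, $\Gamma_1\subset\partial\Omega$, and the interior of $\Gamma_2$ does not meet $\partial\Omega$. Assume that for $(x,y)$ in a neighbourhood of $R$, $\Gamma$ is symmetric about the line $y=0$. Near $[-a,a]\times\{\pi\}$ the upper boundary is the graph $y=Y(x)=\pi+r(x)$, where $r$ is $C^{1,1}$, piecewise $C^\infty$, $r\equiv0$ on $[-a,a]$, and $r''(x)\neq0$ for $\pm x\ge a$ (i.e. the "wings" outside $R$ open or close away from the rectangular part). Example: the Bunimovich stadium. Notation: $D_x=-i\partial_x$; $\|\cdot\|$ denotes the $L^2(\Omega)$ norm; $\Delta$ is the flat Laplacian on $\Omega$. *)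

theory Defs
  imports "HOL-Analysis.Analysis" "HOL-Library.Landau_Symbols"
begin

definition px :: "(real \<times> real \<Rightarrow> 'a::real_normed_vector) \<Rightarrow> real \<times> real \<Rightarrow> 'a" where
  "px f p = vector_derivative (\<lambda>t. f (t, snd p)) (at (fst p))"

definition py :: "(real \<times> real \<Rightarrow> 'a::real_normed_vector) \<Rightarrow> real \<times> real \<Rightarrow> 'a" where
  "py f p = vector_derivative (\<lambda>t. f (fst p, t)) (at (snd p))"

fun dpart :: "bool list \<Rightarrow> (real \<times> real \<Rightarrow> 'a::real_normed_vector) \<Rightarrow> real \<times> real \<Rightarrow> 'a" where
  "dpart [] f = f"
| "dpart (b # ws) f = (if b then px (dpart ws f) else py (dpart ws f))"

definition smooth2 :: "(real \<times> real \<Rightarrow> 'a::real_normed_vector) \<Rightarrow> bool" where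
  "smooth2 f \<longleftrightarrow> (\<forall>ws. continuous_on UNIV (dpart ws f) \<and>
     (\<forall>p. ((\<lambda>t. dpart ws f (t, snd p)) has_vector_derivative px (dpart ws f) p) (at (fst p)) \<and>
          ((\<lambda>t. dpart ws f (fst p, t)) has_vector_derivative py (dpart ws f) p) (at (snd p))))"

definition test_fun :: "(real \<times> real) set \<Rightarrow> (real \<times> real \<Rightarrow> 'a::real_normed_vector) \<Rightarrow> bool" where
  "test_fun \<Omega> \<phi> \<longleftrightarrow> smooth2 \<phi> \<and> compact (closure {p. \<phi> p \<noteq> 0}) \<and> closure {p. \<phi> p \<noteq> 0} \<subseteq> \<Omega>"

definition L2 :: "(real \<times> real) set \<Rightarrow> (real \<times> real \<Rightarrow> complex) \<Rightarrow> bool" where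
  "L2 \<Omega> f \<longleftrightarrow> f \<in> borel_measurable (lebesgue_on \<Omega>) \<and>
     integrable (lebesgue_on \<Omega>) (\<lambda>p. (norm (f p))\<^sup>2)"

definition L2norm :: "(real \<times> real) set \<Rightarrow> (real \<times> real \<Rightarrow> complex) \<Rightarrow> real" where
  "L2norm \<Omega> f = sqrt (\<integral>p. (norm (f p))\<^sup>2 \<partial>lebesgue_on \<Omega>)"

definition weak_deriv :: "(real \<times> real) set \<Rightarrow> bool list \<Rightarrow> (real \<times> real \<Rightarrow> complex) \<Rightarrow>
    (real \<times> real \<Rightarrow> complex) \<Rightarrow> bool" where
  "weak_deriv \<Omega> ws u v \<longleftrightarrow> (\<forall>\<phi> :: real \<times> real \<Rightarrow> real. test_fun \<Omega> \<phi> \<longrightarrow>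
     (\<integral>p. u p * complex_of_real (dpart ws \<phi> p) \<partial>lebesgue_on \<Omega>)
       = (-1) ^ length ws * (\<integral>p. v p * complex_of_real (\<phi> p) \<partial>lebesgue_on \<Omega>))"

text \<open>The (a.e. unique) L^2 weak derivative.\<close>
definition wd :: "(real \<times> real) set \<Rightarrow> bool list \<Rightarrow> (real \<times> real \<Rightarrow> complex) \<Rightarrow> real \<times> real \<Rightarrow> complex" where
  "wd \<Omega> ws u = (SOME v. L2 \<Omega> v \<and> weak_deriv \<Omega> ws u v)"

definition H2 :: "(real \<times> real) set \<Rightarrow> (real \<times> real \<Rightarrow> complex) \<Rightarrow> bool" where
  "H2 \<Omega> u \<longleftrightarrow> L2 \<Omega> u \<and> (\<forall>ws. length ws \<le> 2 \<longrightarrow> (\<exists>v. L2 \<Omega> v \<and> weak_deriv \<Omega> ws u v))"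

text \<open>H^1_0: limit in the H^1 norm of test functions (Dirichlet condition u|_\<Gamma> = 0).\<close>
definition H10 :: "(real \<times> real) set \<Rightarrow> (real \<times> real \<Rightarrow> complex) \<Rightarrow> bool" where
  "H10 \<Omega> u \<longleftrightarrow> L2 \<Omega> u \<and> (\<forall>ws. length ws \<le> 1 \<longrightarrow> (\<exists>v. L2 \<Omega> v \<and> weak_deriv \<Omega> ws u v)) \<and>
     (\<exists>\<phi>s :: nat \<Rightarrow> real \<times> real \<Rightarrow> complex. (\<forall>n. test_fun \<Omega> (\<phi>s n)) \<and>
        (\<lambda>n. L2norm \<Omega> (\<lambda>p. \<phi>s n p - u p) + L2norm \<Omega> (\<lambda>p. px (\<phi>s n) p - wd \<Omega> [True] u p)
             + L2norm \<Omega> (\<lambda>p. py (\<phi>s n) p - wd \<Omega> [False] u p)) \<longlonglongrightarrow> 0)"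

definition lap :: "(real \<times> real) set \<Rightarrow> (real \<times> real \<Rightarrow> complex) \<Rightarrow> real \<times> real \<Rightarrow> complex" where
  "lap \<Omega> u p = wd \<Omega> [True, True] u p + wd \<Omega> [False, False] u p"

definition Cinf1 :: "real set \<Rightarrow> (real \<Rightarrow> real) \<Rightarrow> bool" where
  "Cinf1 I g \<longleftrightarrow> (\<forall>k. \<forall>x\<in>I. ((deriv ^^ k) g has_real_derivative (deriv ^^ Suc k) g x) (at x))"

definition C11_on :: "real set \<Rightarrow> (real \<Rightarrow> real) \<Rightarrow> bool" where
  "C11_on I g \<longleftrightarrow> (\<exists>g'. (\<forall>x\<in>I. (g has_real_derivative g' x) (at x)) \<and>
                      (\<exists>L. \<forall>x\<in>I. \<forall>y\<in>I. \<bar>g' x - g' y\<bar> \<le> L * \<bar>x - y\<bar>))"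

definition pw_Cinf :: "real set \<Rightarrow> (real \<Rightarrow> real) \<Rightarrow> bool" where
  "pw_Cinf I g \<longleftrightarrow> (\<forall>\<alpha> \<beta>. {\<alpha>..\<beta>} \<subseteq> I \<longrightarrow> (\<exists>F. finite F \<and>
     (\<forall>s t. s < t \<and> {s..t} \<subseteq> {\<alpha>..\<beta>} \<and> {s<..<t} \<inter> F = {} \<longrightarrow>
        (\<exists>h V. open V \<and> {s..t} \<subseteq> V \<and> Cinf1 V h \<and> (\<forall>x\<in>{s..t}. g x = h x)))))"

definition rot :: "real \<Rightarrow> real \<times> real \<Rightarrow> real \<times> real" where
  "rot \<theta> q = (cos \<theta> * fst q + sin \<theta> * snd q, - sin \<theta> * fst q + cos \<theta> * snd q)"

definition C11_pw_boundary :: "(real \<times> real) set \<Rightarrow> bool" where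
  "C11_pw_boundary \<Omega> \<longleftrightarrow> (\<forall>p\<in>frontier \<Omega>. \<exists>\<rho>>0. \<exists>\<theta> (g :: real \<Rightarrow> real).
     C11_on UNIV g \<and> pw_Cinf UNIV g \<and>
     \<Omega> \<inter> ball p \<rho> = {q \<in> ball p \<rho>. snd (rot \<theta> (q - p)) < g (fst (rot \<theta> (q - p)))})"

definition Rect :: "real \<Rightarrow> (real \<times> real) set" where
  "Rect a = {-a..a} \<times> {-pi..pi}"

definition partially_rectangular :: "(real \<times> real) set \<Rightarrow> real \<Rightarrow> bool" where
  "partially_rectangular \<Omega> a \<longleftrightarrow>
     open \<Omega> \<and> connected \<Omega> \<and> C11_pw_boundary \<Omega> \<and> a > 0 \<and>
     {-a..a} \<times> {-pi<..<pi} \<subseteq> \<Omega> \<and>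
     {-a..a} \<times> {pi, -pi} \<subseteq> frontier \<Omega> \<and>
     (\<exists>\<epsilon>>0. \<forall>x y. infdist (x, y) (Rect a) < \<epsilon> \<longrightarrow>
          ((x, y) \<in> frontier \<Omega> \<longleftrightarrow> (x, -y) \<in> frontier \<Omega>)) \<and>
     (\<exists>\<eta>>0. \<exists>r :: real \<Rightarrow> real.
        C11_on {-a-\<eta><..<a+\<eta>} r \<and> pw_Cinf {-a-\<eta><..<a+\<eta>} r \<and>
        (\<forall>x\<in>{-a..a}. r x = 0) \<and>
        (\<exists>h V. open V \<and> {a..<a+\<eta>} \<subseteq> V \<and> Cinf1 V h \<and>
              (\<forall>x\<in>{a..<a+\<eta>}. r x = h x \<and> deriv (deriv h) x \<noteq> 0)) \<and>
        (\<exists>h V. open V \<and> {-a-\<eta><..-a} \<subseteq> V \<and> Cinf1 V h \<and>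
              (\<forall>x\<in>{-a-\<eta><..-a}. r x = h x \<and> deriv (deriv h) x \<noteq> 0)) \<and>
        \<Omega> \<inter> ({-a-\<eta><..<a+\<eta>} \<times> {pi-\<eta><..<pi+\<eta>}) =
          {(x, y). x \<in> {-a-\<eta><..<a+\<eta>} \<and> y \<in> {pi-\<eta><..<pi+\<eta>} \<and> y < pi + r x})"

end

(*
  Extend u by 0, and put R = Rect a, W = Omega - R, f = (- Laplace - l^2) u.  The estimate proved is
    ||u||_R <= C (||f|| + ||u_xx||_W + l ||u_x||_W + l^2 ||u||_W)    for l >= 1,
  and ||f|| = o(1) ||u|| then leaves no room for all three wing norms to be small.

  Since r is C^{1,1} and vanishes on [-a, a], it is O((|x| - a)^2), so Omega contains the cusped region
  |y| < pi, |x| < a + K sqrt (cos (y/2)).  A cutoff chi that equals 1 on R and lives in this region has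
  chi_xx = O(1 / cos (y/2)) and chi_x = O(1 / sqrt (cos (y/2))), singularities which are absorbed by the zeros
  of sin (k (y + pi) / 2) at y = -pi and y = pi.  Pair u with chi e, where e = exp ((1 + i xi) x) sin (k (y + pi) / 2).
  The x-derivatives are moved onto u everywhere, but the y-derivatives of e only on R, where both u and e vanish
  at y = -pi, pi; so only x-derivatives of u enter on W.  The result is
    s(xi, k) <chi u, e> = - <f, e>_R + (terms on W),    s(xi, k) = (1 + i xi)^2 + l^2 - k^2/4.
  The weight exp x makes |s| >= 2 |xi| whatever l and k are, and with half-integral frequencies xi is bounded
  away from 0.  Summing over a trigonometric approximation of exp (-x) conj(u) on R gives the estimate.
*)

theory Submission
  imports Defs
begin

section \<open>Smooth functions of one variable\<close>

definition smooth1 :: "(real \<Rightarrow> real) \<Rightarrow> bool" where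
  "smooth1 f \<longleftrightarrow> (\<exists>F. F 0 = f \<and> (\<forall>n x. (F n has_real_derivative F (Suc n) x) (at x)))"

text \<open>Differentiation can be iterated inside any class that it maps into itself. Each closure
  property below is proved by exhibiting such a class, which avoids formulas for higher
  derivatives.\<close>

lemma smooth1_coinduct:
  assumes "f \<in> S" and step: "\<And>g. g \<in> S \<Longrightarrow> \<exists>g'\<in>S. \<forall>x. (g has_real_derivative g' x) (at x)"
  shows "smooth1 f"
proof -
  obtain D where D: "\<And>g. g \<in> S \<Longrightarrow> D g \<in> S \<and> (\<forall>x. (g has_real_derivative D g x) (at x))"
    using step by metis
  have "(D ^^ n) f \<in> S" for n
    by (induction n) (use \<open>f \<in> S\<close> D in auto)
  with D show ?thesis
    unfolding smooth1_def by (intro exI[of _ "\<lambda>n. (D ^^ n) f"]) auto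
qed

lemma smooth1_derivE:
  assumes "smooth1 f"
  obtains f' where "smooth1 f'" "\<And>x. (f has_real_derivative f' x) (at x)"
proof -
  obtain F where F: "F 0 = f" "\<And>n x. (F n has_real_derivative F (Suc n) x) (at x)"
    using assms unfolding smooth1_def by blast
  have "smooth1 (F (Suc 0))"
    unfolding smooth1_def by (intro exI[of _ "\<lambda>n. F (Suc n)"]) (use F in auto)
  then show ?thesis using that F by metis
qed

lemma smooth1_continuous: "smooth1 f \<Longrightarrow> continuous_on S f"
  by (metis smooth1_derivE DERIV_isCont continuous_at_imp_continuous_on)

lemma smooth1_deriv:
  assumes "smooth1 f" "\<And>x. (f has_real_derivative f' x) (at x)"
  shows "smooth1 f'"
proof -
  obtain g where g: "smooth1 g" "\<And>x. (f has_real_derivative g x) (at x)"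
    using smooth1_derivE[OF assms(1)] by metis
  have "g = f'" using g(2) assms(2) DERIV_unique by blast
  then show ?thesis using g by simp
qed

lemma smooth1_const [simp]: "smooth1 (\<lambda>x. c)"
  by (rule smooth1_coinduct[where S = "range (\<lambda>c x. c)"])
     (auto intro!: bexI[of _ "\<lambda>_. 0"] derivative_eq_intros)

text \<open>The class for compositions: the derivative of f(g) h is f'(g) (g' h) + f(g) h'. The new
  factor g' h must already be known to be smooth, so products have to be settled first, with
  \<open>prod1\<close>.\<close>

inductive_set alg1 :: "(real \<Rightarrow> real) set" where
  alg1_comp: "smooth1 f \<Longrightarrow> smooth1 g \<Longrightarrow> smooth1 h \<Longrightarrow> (\<lambda>x. f (g x) * h x) \<in> alg1"
| alg1_mult: "smooth1 g \<Longrightarrow> smooth1 h \<Longrightarrow> (\<lambda>x. g x * h x) \<in> alg1"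
| alg1_add: "g \<in> alg1 \<Longrightarrow> h \<in> alg1 \<Longrightarrow> (\<lambda>x. g x + h x) \<in> alg1"

inductive_set prod1 :: "(real \<Rightarrow> real) set" where
  prod1_mult: "smooth1 g \<Longrightarrow> smooth1 h \<Longrightarrow> (\<lambda>x. g x * h x) \<in> prod1"
| prod1_add: "g \<in> prod1 \<Longrightarrow> h \<in> prod1 \<Longrightarrow> (\<lambda>x. g x + h x) \<in> prod1"

lemma prod1_smooth1: "g \<in> prod1 \<Longrightarrow> smooth1 g"
proof (erule smooth1_coinduct)
  fix g assume "g \<in> prod1"
  then show "\<exists>g'\<in>prod1. \<forall>x. (g has_real_derivative g' x) (at x)"
  proof induction
    case (prod1_mult g h)
    obtain g' h' where "smooth1 g'" "\<And>x. (g has_real_derivative g' x) (at x)"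
       "smooth1 h'" "\<And>x. (h has_real_derivative h' x) (at x)"
      using prod1_mult smooth1_derivE by metis
    with prod1_mult show ?case
      by (intro bexI[of _ "\<lambda>x. g' x * h x + h' x * g x"])
         (auto intro!: DERIV_mult prod1.intros)
  next
    case (prod1_add g h)
    then obtain g' h' where "g' \<in> prod1" "h' \<in> prod1" "\<forall>x. (g has_real_derivative g' x) (at x)"
       "\<forall>x. (h has_real_derivative h' x) (at x)" by blast
    then show ?case
      by (intro bexI[of _ "\<lambda>x. g' x + h' x"]) (auto intro!: DERIV_add prod1.intros)
  qed
qed

lemma smooth1_mult: "smooth1 g \<Longrightarrow> smooth1 h \<Longrightarrow> smooth1 (\<lambda>x. g x * h x)"
  by (rule prod1_smooth1[OF prod1_mult])

lemma smooth1_add: "smooth1 g \<Longrightarrow> smooth1 h \<Longrightarrow> smooth1 (\<lambda>x. g x + h x)"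
  using prod1_smooth1[OF prod1_add[OF prod1_mult[of g "\<lambda>_. 1"] prod1_mult[of h "\<lambda>_. 1"]]] by simp

lemma smooth1_diff: "smooth1 g \<Longrightarrow> smooth1 h \<Longrightarrow> smooth1 (\<lambda>x. g x - h x)"
  using smooth1_add[OF _ smooth1_mult[of "\<lambda>_. -1" h], of g] by simp

lemma alg1_smooth1: "g \<in> alg1 \<Longrightarrow> smooth1 g"
proof (erule smooth1_coinduct)
  fix g assume "g \<in> alg1"
  then show "\<exists>g'\<in>alg1. \<forall>x. (g has_real_derivative g' x) (at x)"
  proof induction
    case (alg1_comp f g h)
    obtain f' g' h' where d: "smooth1 f'" "\<And>x. (f has_real_derivative f' x) (at x)"
      "smooth1 g'" "\<And>x. (g has_real_derivative g' x) (at x)"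
       "smooth1 h'" "\<And>x. (h has_real_derivative h' x) (at x)"
      using alg1_comp smooth1_derivE by metis
    have "(\<lambda>x. f' (g x) * (g' x * h x) + f (g x) * h' x) \<in> alg1"
      using alg1_comp d by (intro alg1.alg1_add alg1.alg1_comp smooth1_mult)
    moreover have "((\<lambda>x. f (g x) * h x) has_real_derivative f' (g x) * (g' x * h x) + f (g x) * h' x) (at x)" for x
      using DERIV_mult[OF DERIV_chain2[OF d(2) d(4)] d(6)] by (simp add: algebra_simps)
    ultimately show ?case by (intro bexI[of _ "\<lambda>x. f' (g x) * (g' x * h x) + f (g x) * h' x"]) auto
  next
    case (alg1_mult g h)
    obtain g' h' where "smooth1 g'" "\<And>x. (g has_real_derivative g' x) (at x)"
       "smooth1 h'" "\<And>x. (h has_real_derivative h' x) (at x)"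
      using alg1_mult smooth1_derivE by metis
    with alg1_mult show ?case
      by (intro bexI[of _ "\<lambda>x. g' x * h x + h' x * g x"])
         (auto intro!: DERIV_mult alg1.intros)
  next
    case (alg1_add g h)
    then obtain g' h' where "g' \<in> alg1" "h' \<in> alg1" "\<forall>x. (g has_real_derivative g' x) (at x)"
       "\<forall>x. (h has_real_derivative h' x) (at x)" by blast
    then show ?case
      by (intro bexI[of _ "\<lambda>x. g' x + h' x"]) (auto intro!: DERIV_add alg1.intros)
  qed
qed

lemma smooth1_compose: "smooth1 f \<Longrightarrow> smooth1 g \<Longrightarrow> smooth1 (\<lambda>x. f (g x))"
  using alg1_smooth1[OF alg1_comp[of f g "\<lambda>_. 1"]] by simp

lemma smooth1_id: "smooth1 (\<lambda>x. x)"
  unfolding smooth1_def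
  by (intro exI[of _ "\<lambda>n. if n = 0 then (\<lambda>x. x) else if n = 1 then (\<lambda>x. 1) else (\<lambda>x. 0)"])
     (auto intro!: derivative_eq_intros)

lemma smooth1_linear: "smooth1 (\<lambda>x. c * x + d)"
  by (intro smooth1_add smooth1_mult smooth1_id smooth1_const)

lemma smooth1_exp: "smooth1 exp"
  unfolding smooth1_def by (intro exI[of _ "\<lambda>n. exp"]) (auto intro!: derivative_eq_intros)

lemma smooth1_sin: "smooth1 sin" and smooth1_cos: "smooth1 cos"
proof -
  let ?S = "{\<lambda>x::real. c * sin x + d * cos x | c d. True}"
  have step: "\<exists>g'\<in>?S. \<forall>x. (g has_real_derivative g' x) (at x)" if g: "g \<in> ?S" for g
  proof -
    obtain c d where "g = (\<lambda>x. c * sin x + d * cos x)" using g by blast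
    then have "(g has_real_derivative (-d) * sin x + c * cos x) (at x)" for x
      by (auto intro!: derivative_eq_intros)
    then show ?thesis
      by (intro bexI[of _ "\<lambda>x. (-d) * sin x + c * cos x"]) blast+
  qed
  have "sin \<in> ?S" by (rule CollectI, rule exI[of _ 1], rule exI[of _ 0]) simp
  then show "smooth1 sin" using step by (rule smooth1_coinduct)
  have "cos \<in> ?S" by (rule CollectI, rule exI[of _ 0], rule exI[of _ 1]) simp
  then show "smooth1 cos" using step by (rule smooth1_coinduct)
qed

text \<open>The quotients h / w^n with arbitrary n form a class closed under differentiation,
  because (h / w^n)' = (h' w - n h w') / w^(n+1).\<close>

lemma smooth1_divide:
  assumes "smooth1 h" "smooth1 w" and w: "\<And>x. w x \<noteq> 0"
  shows "smooth1 (\<lambda>x. h x / w x)"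
proof -
  let ?S = "{\<lambda>x. h x / w x ^ n | h n. smooth1 h}"
  have "(\<lambda>x. h x / w x) \<in> ?S"
    by (rule CollectI, rule exI[of _ h], rule exI[of _ 1]) (use assms in simp)
  then show ?thesis
  proof (rule smooth1_coinduct)
    fix g assume "g \<in> ?S"
    then obtain h n where g: "g = (\<lambda>x. h x / w x ^ n)" and h: "smooth1 h" by blast
    obtain h' w' where d: "smooth1 h'" "\<And>x. (h has_real_derivative h' x) (at x)"
       "smooth1 w'" "\<And>x. (w has_real_derivative w' x) (at x)"
      using h assms(2) smooth1_derivE by metis
    let ?k = "\<lambda>x. h' x * w x - real n * h x * w' x"
    have "smooth1 ?k" using d h assms by (intro smooth1_diff smooth1_mult) auto
    moreover have "(g has_real_derivative ?k x / w x ^ (Suc n)) (at x)" for x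
    proof -
      have "((\<lambda>x. w x ^ n) has_real_derivative real n * w' x * w x ^ (n - 1)) (at x)"
        using DERIV_power[OF d(4), of n x] by (simp add: mult_ac)
      from DERIV_divide[OF d(2) this]
      have "(g has_real_derivative (h' x * w x ^ n - h x * (real n * w' x * w x ^ (n - 1))) / (w x ^ n * w x ^ n)) (at x)"
        unfolding g using w[of x] by simp
      moreover have "(h' x * w x ^ n - h x * (real n * w' x * w x ^ (n - 1))) / (w x ^ n * w x ^ n) = ?k x / w x ^ Suc n"
        using w[of x] by (cases n) (auto simp: field_simps)
      ultimately show ?thesis by simp
    qed
    ultimately show "\<exists>g'\<in>?S. \<forall>x. (g has_real_derivative g' x) (at x)"
      by (intro bexI[of _ "\<lambda>x. ?k x / w x ^ (Suc n)"] CollectI exI[of _ ?k] exI[of _ "Suc n"] conjI refl) auto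
  qed
qed

section \<open>A smooth step built from exp (-1/x)\<close>

text \<open>Every derivative of this function has the form $p(1/x)e^{-1/x}$ for $x>0$.\<close>

definition flat :: "real \<Rightarrow> real" where "flat x = (if x > 0 then exp (- (1/x)) else 0)"

lemma poly_exp_tendsto_0: "((\<lambda>x. poly p (1/x) * exp (-(1/x))) \<longlongrightarrow> 0) (at_right (0::real))"
proof -
  have "((\<lambda>x. poly p x * exp (- x)) \<longlongrightarrow> 0) at_top" for p :: "real poly"
  proof (induction p)
    case 0 then show ?case by simp
  next
    case (pCons a p)
    have e: "((\<lambda>x::real. exp (- x)) \<longlongrightarrow> 0) at_top"
      by (intro filterlim_compose[OF exp_at_bot] filterlim_uminus_at_bot_at_top)
    have "((\<lambda>x. x * poly p x * exp (- x)) \<longlongrightarrow> 0) at_top"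
    proof -
      have p: "poly p = (\<lambda>x. \<Sum>i\<le>degree p. coeff p i * x ^ i)" by (auto simp: poly_altdef)
      have "((\<lambda>x. \<Sum>i\<le>degree p. coeff p i * (x ^ Suc i / exp x)) \<longlongrightarrow> (\<Sum>i\<le>degree p. coeff p i * 0)) at_top"
        by (intro tendsto_sum tendsto_mult tendsto_const tendsto_power_div_exp_0)
      then show ?thesis unfolding p
        by (simp add: sum_distrib_left sum_distrib_right exp_minus field_simps)
    qed
    from tendsto_add[OF tendsto_mult[OF tendsto_const e, of a] this]
    show ?case by (simp add: algebra_simps)
  qed
  from filterlim_compose[OF this[of p] filterlim_inverse_at_top_right]
  show ?thesis by (simp add: inverse_eq_divide)
qed

lemma smooth1_flat: "smooth1 flat"
proof -
  let ?f = "\<lambda>p x. if x > 0 then poly p (1/x) * exp (- (1/x)) else (0::real)"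
  let ?S = "range ?f"
  have "flat \<in> ?S" by (auto simp: flat_def fun_eq_iff intro!: image_eqI[of _ _ "[:1:]"])
  then show ?thesis
  proof (rule smooth1_coinduct)
    fix g assume "g \<in> ?S"
    then obtain p where g: "g = ?f p" by blast
    \<comment> \<open>For x > 0 the derivative of p(1/x) exp (-1/x) is (1/x)^2 (p - p')(1/x) exp
      (-1/x); \<open>[:0,0,1:]\<close> is the square of the variable.\<close>
    define q where "q = [:0,0,1:] * (p - pderiv p)"
    have "(g has_real_derivative ?f q x) (at x)" for x
    proof -
      consider "x < 0" | "x = 0" | "x > 0" by linarith
      then show ?thesis
      proof cases
        case 1
        have "((\<lambda>_. 0) has_real_derivative 0) (at x)" by simp
        then have "(g has_real_derivative 0) (at x)"
          by (rule has_field_derivative_transform_within_open[of _ _ _ "{..<0}"]) (use 1 g in auto)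
        then show ?thesis using 1 by simp
      next
        case 3
        have "((\<lambda>x. poly p (1/x) * exp (- (1/x))) has_real_derivative ?f q x) (at x)"
          using 3 by (auto intro!: derivative_eq_intros DERIV_chain2[OF poly_DERIV] simp: q_def field_simps power2_eq_square)
        then show ?thesis
          by (rule has_field_derivative_transform_within_open[of _ _ _ "{0<..}"]) (use 3 g in auto)
      next
        case 2
        have "((\<lambda>y. (g y - g 0) / (y - 0)) \<longlongrightarrow> 0) (at 0)"
        proof (rule filterlim_split_at_real)
          show "((\<lambda>y. (g y - g 0) / (y - 0)) \<longlongrightarrow> 0) (at_left 0)"
            by (rule tendsto_eventually) (auto simp: g eventually_at_filter)
          show "((\<lambda>y. (g y - g 0) / (y - 0)) \<longlongrightarrow> 0) (at_right 0)"
            \<comment> \<open>The difference quotient at 0 from the right is (1/x) p(1/x) exp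
              (-1/x), which is again of the required form with \<open>pCons 0 p\<close> in place of
              p.\<close>
            by (rule Lim_transform_eventually[OF poly_exp_tendsto_0[of "pCons 0 p"]])
               (auto simp: g eventually_at_filter)
        qed
        then show ?thesis using 2 by (simp add: has_field_derivative_iff)
      qed
    qed
    then show "\<exists>g'\<in>?S. \<forall>x. (g has_real_derivative g' x) (at x)"
      by (intro bexI[of _ "?f q"]) auto
  qed
qed

text \<open>A smooth step from 0 to 1. The transition takes place in [1, 2], not in [0, 1], so that
  after scaling by n there is a margin 1/n in which the function still vanishes; this margin gives
  compact supports in open sets.\<close>

definition ustep :: "real \<Rightarrow> real" where
  "ustep t = flat (t - 1) / (flat (t - 1) + flat (2 - t))"

lemma flat_nonneg: "flat x \<ge> 0" and flat_pos: "x > 0 \<Longrightarrow> flat x > 0" and flat_zero: "x \<le> 0 \<Longrightarrow> flat x = 0"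
  by (auto simp: flat_def)

lemma ustep_denom_pos: "flat (t - 1) + flat (2 - t) > 0"
  using flat_pos[of "t - 1"] flat_pos[of "2 - t"] flat_nonneg[of "t - 1"] flat_nonneg[of "2 - t"]
  by (cases "t > 1") (auto intro: add_pos_nonneg add_nonneg_pos)

lemma smooth1_ustep: "smooth1 ustep"
proof -
  have 1: "smooth1 (\<lambda>t. flat (t - 1))" 
    using smooth1_compose[OF smooth1_flat smooth1_linear[of 1 "-1"]] by simp
  have 2: "smooth1 (\<lambda>t. flat (2 - t))" 
    using smooth1_compose[OF smooth1_flat smooth1_linear[of "-1" 2]] by simp
  show ?thesis unfolding ustep_def[abs_def]
    by (rule smooth1_divide[OF 1 smooth1_add[OF 1 2]]) (use ustep_denom_pos in \<open>auto simp: less_le\<close>)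
qed

lemma ustep_eq_0: "t \<le> 1 \<Longrightarrow> ustep t = 0"
  by (simp add: ustep_def flat_zero)

lemma ustep_eq_1: "t \<ge> 2 \<Longrightarrow> ustep t = 1"
  using ustep_denom_pos[of t] by (simp add: ustep_def flat_zero)

lemma ustep_nonneg: "0 \<le> ustep t" and ustep_le_1: "ustep t \<le> 1"
  using ustep_denom_pos[of t] flat_nonneg[of "t - 1"] flat_nonneg[of "2 - t"]
  by (auto simp: ustep_def)

section \<open>Smooth functions of two variables\<close>

lemma px_eqI:
  assumes "\<And>p. ((\<lambda>t. f (t, snd p)) has_vector_derivative f' p) (at (fst p))"
  shows "px f = f'"
  by (rule ext) (simp add: px_def vector_derivative_at[OF assms])

lemma py_eqI:
  assumes "\<And>p. ((\<lambda>t. f (fst p, t)) has_vector_derivative f' p) (at (snd p))"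
  shows "py f = f'"
  by (rule ext) (simp add: py_def vector_derivative_at[OF assms])

lemma smooth2_coinduct:
  assumes "f \<in> S" and step: "\<And>g. g \<in> S \<Longrightarrow> continuous_on UNIV g \<and> 
     (\<exists>g'\<in>S. \<forall>p. ((\<lambda>t. g (t, snd p)) has_vector_derivative g' p) (at (fst p))) \<and>
     (\<exists>g'\<in>S. \<forall>p. ((\<lambda>t. g (fst p, t)) has_vector_derivative g' p) (at (snd p)))"
  shows "smooth2 f"
proof -
  have px: "px g \<in> S \<and> ((\<lambda>t. g (t, snd p)) has_vector_derivative px g p) (at (fst p))" if "g \<in> S" for g p
    using step[OF that] px_eqI by metis
  have py: "py g \<in> S \<and> ((\<lambda>t. g (fst p, t)) has_vector_derivative py g p) (at (snd p))" if "g \<in> S" for g p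
    using step[OF that] py_eqI by metis
  have "dpart ws f \<in> S" for ws
    by (induction ws) (use \<open>f \<in> S\<close> px py in auto)
  then show ?thesis unfolding smooth2_def using px py step by blast
qed

text \<open>The cutoffs are functions of a product (x - a) w(y), so this shape contains all test
  functions that occur. Each partial derivative of a generator is a sum of two generators, which
  makes the class fit \<open>smooth2_coinduct\<close>.\<close>

inductive_set mono2 :: "(real \<times> real \<Rightarrow> real) set" where
  mono2_base: "smooth1 g \<Longrightarrow> smooth1 \<theta> \<Longrightarrow> smooth1 S \<Longrightarrow> smooth1 \<sigma> \<Longrightarrow> smooth1 \<tau> \<Longrightarrow>
     (\<lambda>p. g (fst p) * \<theta> (snd p) * S (\<sigma> (fst p) * \<tau> (snd p))) \<in> mono2"
| mono2_add: "f \<in> mono2 \<Longrightarrow> g \<in> mono2 \<Longrightarrow> (\<lambda>p. f p + g p) \<in> mono2"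

lemma mono2_smooth2: "f \<in> mono2 \<Longrightarrow> smooth2 f"
proof (erule smooth2_coinduct)
  fix f assume "f \<in> mono2"
  then show "continuous_on UNIV f \<and> 
     (\<exists>g'\<in>mono2. \<forall>p. ((\<lambda>t. f (t, snd p)) has_vector_derivative g' p) (at (fst p))) \<and>
     (\<exists>g'\<in>mono2. \<forall>p. ((\<lambda>t. f (fst p, t)) has_vector_derivative g' p) (at (snd p)))"
  proof induction
    case (mono2_base g \<theta> S \<sigma> \<tau>)
    obtain g' \<theta>' S' where d: "smooth1 g'" "\<And>x. (g has_real_derivative g' x) (at x)"
      "smooth1 \<theta>'" "\<And>x. (\<theta> has_real_derivative \<theta>' x) (at x)"
      "smooth1 S'" "\<And>x. (S has_real_derivative S' x) (at x)"
      using mono2_base smooth1_derivE by metis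
    obtain \<sigma>' \<tau>' where d': "smooth1 \<sigma>'" "\<And>x. (\<sigma> has_real_derivative \<sigma>' x) (at x)"
      "smooth1 \<tau>'" "\<And>x. (\<tau> has_real_derivative \<tau>' x) (at x)"
      using mono2_base smooth1_derivE by metis
    have c: "continuous_on UNIV (\<lambda>p. h (fst p))" "continuous_on UNIV (\<lambda>p. h (snd p))" if "smooth1 h"
      for h :: "real \<Rightarrow> real"
      by (rule continuous_on_compose2[OF smooth1_continuous[OF that, of UNIV]]; 
          auto intro!: continuous_intros)+
    have "continuous_on UNIV (\<lambda>p. g (fst p) * \<theta> (snd p) * S (\<sigma> (fst p) * \<tau> (snd p)))"
      using mono2_base by (intro continuous_intros c continuous_on_compose2[OF smooth1_continuous[of S UNIV]]) auto
    moreover 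
    let ?X = "\<lambda>p. g' (fst p) * \<theta> (snd p) * S (\<sigma> (fst p) * \<tau> (snd p)) + 
                (g (fst p) * \<sigma>' (fst p)) * (\<theta> (snd p) * \<tau> (snd p)) * S' (\<sigma> (fst p) * \<tau> (snd p))"
    have "?X \<in> mono2"
      using mono2_base d d' mono2.mono2_base[of g' \<theta> S \<sigma> \<tau>] 
        mono2.mono2_base[OF smooth1_mult[of g \<sigma>'] smooth1_mult[of \<theta> \<tau>], of S' \<sigma> \<tau>]
      by (intro mono2.mono2_add) auto
    moreover have "((\<lambda>t. g t * \<theta> y * S (\<sigma> t * \<tau> y)) has_vector_derivative ?X (x, y)) (at x)" for x y
      unfolding has_real_derivative_iff_has_vector_derivative[symmetric]
      using DERIV_mult[OF DERIV_cmult_right[OF d(2)[of x], of "\<theta> y"] DERIV_chain2[OF d(6) DERIV_cmult_right[OF d'(2)[of x], of "\<tau> y"]]]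
      by (simp add: algebra_simps)
    moreover 
    let ?Y = "\<lambda>p. g (fst p) * \<theta>' (snd p) * S (\<sigma> (fst p) * \<tau> (snd p)) + 
                (g (fst p) * \<sigma> (fst p)) * (\<theta> (snd p) * \<tau>' (snd p)) * S' (\<sigma> (fst p) * \<tau> (snd p))"
    have "?Y \<in> mono2"
      using mono2_base d d' mono2.mono2_base[of g \<theta>' S \<sigma> \<tau>] 
        mono2.mono2_base[OF smooth1_mult[of g \<sigma>] smooth1_mult[of \<theta> \<tau>'], of S' \<sigma> \<tau>]
      by (intro mono2.mono2_add) auto
    moreover have "((\<lambda>t. g x * \<theta> t * S (\<sigma> x * \<tau> t)) has_vector_derivative ?Y (x, y)) (at y)" for x y
      unfolding has_real_derivative_iff_has_vector_derivative[symmetric]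
      using DERIV_mult[OF DERIV_cmult[OF d(4)[of y], of "g x"] DERIV_chain2[OF d(6) DERIV_cmult[OF d'(4)[of y], of "\<sigma> x"]]]
      by (simp add: algebra_simps)
    ultimately show ?case
      by (intro conjI bexI[of _ ?X] bexI[of _ ?Y]) auto
  next
    case (mono2_add f g)
    then obtain fx gx fy gy where m: "fx \<in> mono2" "gx \<in> mono2" "fy \<in> mono2" "gy \<in> mono2" and
      d: "\<And>p. ((\<lambda>t. f (t, snd p)) has_vector_derivative fx p) (at (fst p))"
      "\<And>p. ((\<lambda>t. g (t, snd p)) has_vector_derivative gx p) (at (fst p))"
      "\<And>p. ((\<lambda>t. f (fst p, t)) has_vector_derivative fy p) (at (snd p))"
      "\<And>p. ((\<lambda>t. g (fst p, t)) has_vector_derivative gy p) (at (snd p))"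
      by blast
    show ?case using mono2_add
      by (intro conjI bexI[of _ "\<lambda>p. fx p + gx p"] bexI[of _ "\<lambda>p. fy p + gy p"] 
         mono2.mono2_add m allI has_vector_derivative_add d continuous_on_add) auto
  qed
qed

text \<open>On the support of h the cosine is positive, so the power is harmless there. The class
  lets h and the exponent vary together: the derivative is (h' cos (y/2) - h p sin (y/2) / 2) cos
  (y/2)^(p-1), with a new h and exponent p - 1.\<close>

lemma smooth1_mult_cos_powr:
  assumes h: "smooth1 h" and e: "\<epsilon> > 0" and supp: "\<And>y. \<bar>y\<bar> \<ge> pi - \<epsilon> \<Longrightarrow> h y = 0"
  shows "smooth1 (\<lambda>y. h y * cos (y/2) powr p)"
proof -
  let ?S = "{\<lambda>y. h y * cos (y/2) powr p | h p. smooth1 h \<and> (\<forall>y. \<bar>y\<bar> \<ge> pi - \<epsilon> \<longrightarrow> h y = 0)}"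
  have "(\<lambda>y. h y * cos (y/2) powr p) \<in> ?S" using h supp by blast
  then show ?thesis
  proof (rule smooth1_coinduct)
    fix g assume "g \<in> ?S"
    then obtain h p where g: "g = (\<lambda>y. h y * cos (y/2) powr p)" and h: "smooth1 h" 
      and supp: "\<And>y. \<bar>y\<bar> \<ge> pi - \<epsilon> \<Longrightarrow> h y = 0" by blast
    obtain h' where h': "smooth1 h'" "\<And>x. (h has_real_derivative h' x) (at x)"
      using h smooth1_derivE by metis
    have supp': "h' y = 0" if "\<bar>y\<bar> \<ge> pi - \<epsilon>" for y
    proof -
      \<comment> \<open>The derivative vanishes on the open set where h is locally 0. A point with
        \<bar>y\<bar> = pi - \<epsilon> is reached by continuity along a sequence moving outwards,
        and s is the outward direction.\<close>
      define s :: real where "s = (if y \<ge> 0 then 1 else -1)"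
      have "continuous_on UNIV h'" using h' smooth1_continuous by blast
      have *: "h' z = 0" if "\<bar>z\<bar> > pi - \<epsilon>" for z
      proof -
        have "((\<lambda>_. 0) has_real_derivative 0) (at z)" by simp
        then have "(h has_real_derivative 0) (at z)"
          by (rule has_field_derivative_transform_within_open[of _ _ _ "{z. \<bar>z\<bar> > pi - \<epsilon>}"])
             (use that supp in \<open>auto intro!: open_Collect_less continuous_intros\<close>)
        then show ?thesis using h'(2) DERIV_unique by blast
      qed
      have "(\<lambda>n. y + s / real (Suc n)) \<longlonglongrightarrow> y"
        using tendsto_add[OF tendsto_const[of y] tendsto_mult[OF tendsto_const[of s] LIMSEQ_inverse_real_of_nat]]
        by (simp add: divide_inverse)
      then have "(\<lambda>n. h' (y + s / real (Suc n))) \<longlonglongrightarrow> h' y"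
        using \<open>continuous_on UNIV h'\<close>
        by (intro isCont_tendsto_compose[of _ h']) (auto simp: continuous_on_eq_continuous_at)
      moreover have "h' (y + s / real (Suc n)) = 0" for n
      proof (rule *)
        define t where "t = 1 / real (Suc n)"
        have t: "t > 0" "s / real (Suc n) = s * t" unfolding t_def by simp_all
        have "\<bar>y + s / real (Suc n)\<bar> > \<bar>y\<bar>"
          using t(1) unfolding t(2) by (cases "y \<ge> 0") (auto simp: s_def simp del: of_nat_Suc)
        then show "\<bar>y + s / real (Suc n)\<bar> > pi - \<epsilon>" using that by linarith
      qed
      ultimately show ?thesis using LIMSEQ_unique[OF _ tendsto_const] by force
    qed
    let ?k = "\<lambda>y. h' y * cos (y/2) - h y * (p * (sin (y/2) / 2))"
    have cos2: "smooth1 (\<lambda>y. cos (y/2))" "smooth1 (\<lambda>y. sin (y/2))"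
      using smooth1_compose[OF smooth1_cos smooth1_linear[of "1/2" 0]]
       smooth1_compose[OF smooth1_sin smooth1_linear[of "1/2" 0]] by simp_all
    have "smooth1 ?k" 
      using smooth1_diff[OF smooth1_mult[OF h'(1) cos2(1)] smooth1_mult[OF h smooth1_mult[OF cos2(2) smooth1_const[of "p/2"]]]]
      by (simp add: mult_ac)
    moreover have "?k y = 0" if "\<bar>y\<bar> \<ge> pi - \<epsilon>" for y
      using supp supp' that by simp
    moreover have "(g has_real_derivative ?k y * cos (y/2) powr (p - 1)) (at y)" for y
    proof (cases "\<bar>y\<bar> < pi")
      case True
      then have c: "cos (y/2) > 0" by (intro cos_gt_zero_pi) auto
      have "((\<lambda>y. cos (y/2) powr p) has_real_derivative p * cos (y/2) powr (p - 1) * (- sin (y/2) / 2)) (at y)"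
        using c by (auto intro!: derivative_eq_intros DERIV_fun_powr simp: field_simps powr_diff)
      from DERIV_mult[OF h'(2)[of y] this] c
      show ?thesis unfolding g by (simp add: algebra_simps powr_diff)
    next
      case False
      have "((\<lambda>_. 0) has_real_derivative 0) (at y)" by simp
      then have "(g has_real_derivative 0) (at y)"
        by (rule has_field_derivative_transform_within_open[of _ _ _ "{z. \<bar>z\<bar> > pi - \<epsilon>}"])
           (use False e supp in \<open>auto simp: g intro!: open_Collect_less continuous_intros\<close>)
      moreover have "?k y = 0" using False e supp[of y] supp'[of y] by simp
      ultimately show ?thesis by (simp only: mult_zero_left)
    qed
    ultimately show "\<exists>g'\<in>?S. \<forall>x. (g has_real_derivative g' x) (at x)"
      by (intro bexI[of _ "\<lambda>y. ?k y * cos (y/2) powr (p - 1)"] CollectI exI[of _ ?k] exI[of _ "p - 1"] conjI refl) auto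
  qed
qed

section \<open>Square-integrable functions\<close>

text \<open>Everything is transported to the whole plane by extension by zero. Restrictions then
  become multiplications by indicators, and one measure serves for \<Omega>, the rectangle and the
  wings.\<close>

definition sqi :: "(real \<times> real \<Rightarrow> complex) \<Rightarrow> bool" where
  "sqi f \<longleftrightarrow> f \<in> borel_measurable lebesgue \<and> integrable lebesgue (\<lambda>p. (norm (f p))\<^sup>2)"

definition nrm :: "(real \<times> real \<Rightarrow> complex) \<Rightarrow> real" where
  "nrm f = sqrt (\<integral>p. (norm (f p))\<^sup>2 \<partial>lebesgue)"

lemma sqiD: "sqi f \<Longrightarrow> f \<in> borel_measurable lebesgue" "sqi f \<Longrightarrow> integrable lebesgue (\<lambda>p. (norm (f p))\<^sup>2)"
  by (auto simp: sqi_def)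

lemma nrm_nonneg [simp]: "nrm f \<ge> 0"
  by (simp add: nrm_def)

lemma nrm_sq: "(nrm f)\<^sup>2 = (\<integral>p. (norm (f p))\<^sup>2 \<partial>lebesgue)"
  by (simp add: nrm_def)

lemma sqi_dominated:
  assumes "sqi g" "f \<in> borel_measurable lebesgue" "AE p in lebesgue. norm (f p) \<le> C * norm (g p)"
  shows "sqi f"
proof -
  have "integrable lebesgue (\<lambda>p. C\<^sup>2 * (norm (g p))\<^sup>2)"
    using assms by (simp add: sqi_def)
  then have "integrable lebesgue (\<lambda>p. (norm (f p))\<^sup>2)"
  proof (rule Bochner_Integration.integrable_bound)
    show "AE p in lebesgue. norm ((norm (f p))\<^sup>2) \<le> norm (C\<^sup>2 * (norm (g p))\<^sup>2)"
      using assms(3)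
    proof eventually_elim
      case (elim p)
      then have "(norm (f p))\<^sup>2 \<le> (C * norm (g p))\<^sup>2" by (rule power_mono) simp
      then show ?case by (simp add: power_mult_distrib)
    qed
  qed (use assms in auto)
  then show ?thesis using assms by (simp add: sqi_def)
qed

lemma nrm_le:
  assumes "sqi g" "f \<in> borel_measurable lebesgue" "AE p in lebesgue. norm (f p) \<le> C * norm (g p)" "C \<ge> 0"
  shows "nrm f \<le> C * nrm g"
proof -
  have f: "sqi f" using sqi_dominated assms by blast
  have "(\<integral>p. (norm (f p))\<^sup>2 \<partial>lebesgue) \<le> (\<integral>p. C\<^sup>2 * (norm (g p))\<^sup>2 \<partial>lebesgue)"
  proof (rule integral_mono_AE)
    show "AE p in lebesgue. (norm (f p))\<^sup>2 \<le> C\<^sup>2 * (norm (g p))\<^sup>2"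
      using assms(3)
    proof eventually_elim
      case (elim p)
      then have "(norm (f p))\<^sup>2 \<le> (C * norm (g p))\<^sup>2" by (rule power_mono) simp
      then show ?case by (simp add: power_mult_distrib)
    qed
  qed (use f assms in \<open>auto simp: sqi_def\<close>)
  also have "\<dots> = C\<^sup>2 * (nrm g)\<^sup>2" by (simp add: nrm_sq)
  finally have "(nrm f)\<^sup>2 \<le> (C * nrm g)\<^sup>2" by (simp add: nrm_sq power_mult_distrib)
  then show ?thesis by (rule power2_le_imp_le) (use \<open>C \<ge> 0\<close> in simp)
qed

lemma sqi_mult_bounded:
  assumes "sqi f" "h \<in> borel_measurable lebesgue" "\<And>p. norm (h p) \<le> C"
  shows "sqi (\<lambda>p. h p * f p)"
  using assms by (intro sqi_dominated[OF assms(1), of _ C]) (auto simp: sqi_def norm_mult intro!: mult_right_mono)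

lemma nrm_mult_bounded:
  assumes "sqi f" "h \<in> borel_measurable lebesgue" "\<And>p. norm (h p) \<le> C"
  shows "nrm (\<lambda>p. h p * f p) \<le> C * nrm f"
  using assms order_trans[OF norm_ge_zero assms(3)]
  by (intro nrm_le) (auto simp: sqi_def norm_mult intro!: mult_right_mono)

lemma sqi_cmult: "sqi f \<Longrightarrow> sqi (\<lambda>p. c * f p)"
  by (rule sqi_mult_bounded[of _ "\<lambda>_. c" "norm c"]) auto

lemma sqi_add: assumes "sqi f" "sqi g" shows "sqi (\<lambda>p. f p + g p)"
proof -
  have "integrable lebesgue (\<lambda>p. 2 * (norm (f p))\<^sup>2 + 2 * (norm (g p))\<^sup>2)"
    using assms by (auto simp: sqi_def)
  then have "integrable lebesgue (\<lambda>p. (norm (f p + g p))\<^sup>2)"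
  proof (rule Bochner_Integration.integrable_bound)
    show "AE p in lebesgue. norm ((norm (f p + g p))\<^sup>2) \<le> norm (2 * (norm (f p))\<^sup>2 + 2 * (norm (g p))\<^sup>2)"
    proof (rule AE_I2)
      fix p
      have "(norm (f p + g p))\<^sup>2 \<le> (norm (f p) + norm (g p))\<^sup>2"
        by (intro power_mono norm_triangle_ineq) simp
      also have "\<dots> \<le> 2 * (norm (f p))\<^sup>2 + 2 * (norm (g p))\<^sup>2"
        using zero_le_power2[of "norm (f p) - norm (g p)"] by (simp add: power2_eq_square algebra_simps)
      finally show "norm ((norm (f p + g p))\<^sup>2) \<le> norm (2 * (norm (f p))\<^sup>2 + 2 * (norm (g p))\<^sup>2)" by simp
    qed
  qed (use assms in \<open>auto simp: sqi_def\<close>)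
  then show ?thesis using assms by (auto simp: sqi_def)
qed

lemma sqi_diff: "sqi f \<Longrightarrow> sqi g \<Longrightarrow> sqi (\<lambda>p. f p - g p)"
  using sqi_add[OF _ sqi_cmult[of g "-1"]] by simp

lemma sqi_integrable_norm_mult:
  assumes "sqi f" "sqi g" shows "integrable lebesgue (\<lambda>p. norm (f p) * norm (g p))"
proof -
  have "integrable lebesgue (\<lambda>p. (norm (f p))\<^sup>2 + (norm (g p))\<^sup>2)"
    using assms by (auto simp: sqi_def)
  then show ?thesis
  proof (rule Bochner_Integration.integrable_bound)
    have "norm (f p) * norm (g p) \<le> (norm (f p))\<^sup>2 + (norm (g p))\<^sup>2" for p
    proof -
      have "2 * (norm (f p) * norm (g p)) \<le> (norm (f p))\<^sup>2 + (norm (g p))\<^sup>2"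
        using zero_le_power2[of "norm (f p) - norm (g p)"] 
        by (simp add: power2_eq_square algebra_simps)
      moreover have "0 \<le> norm (f p) * norm (g p)" by simp
      ultimately show ?thesis by linarith
    qed
    then show "AE p in lebesgue. norm (norm (f p) * norm (g p)) \<le> norm ((norm (f p))\<^sup>2 + (norm (g p))\<^sup>2)"
      by (intro AE_I2) (simp add: abs_mult)
  qed (use assms in \<open>auto simp: sqi_def\<close>)
qed

lemma sqi_integrable_mult:
  assumes "sqi f" "sqi g" shows "integrable lebesgue (\<lambda>p. f p * g p)"
  using sqi_integrable_norm_mult[OF assms] assms
  by (subst integrable_norm_iff[symmetric]) (auto simp: sqi_def norm_mult)

lemma Cauchy_Schwarz_nrm:
  assumes f: "sqi f" and g: "sqi g"
  shows "(\<integral>p. norm (f p) * norm (g p) \<partial>lebesgue) \<le> nrm f * nrm g"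
proof -
  let ?I = "\<integral>p. norm (f p) * norm (g p) \<partial>lebesgue"
  have *: "?I \<le> (nrm f + e) * (nrm g + e)" if e: "e > 0" for e
  proof -
    \<comment> \<open>In 2 x y \<le> t x^2 + y^2 / t the optimal weight is the quotient of the
      norms; adding e keeps it defined when a norm is 0, and e tends to 0 at the end.\<close>
    define t where "t = (nrm g + e) / (nrm f + e)"
    have pos: "nrm f + e > 0" "nrm g + e > 0" using e by (auto intro: add_nonneg_pos)
    have t: "t > 0" using pos by (simp add: t_def)
    have "?I \<le> (\<integral>p. (t * (norm (f p))\<^sup>2 + (norm (g p))\<^sup>2 / t) / 2 \<partial>lebesgue)"
    proof (rule integral_mono)
      show "norm (f p) * norm (g p) \<le> (t * (norm (f p))\<^sup>2 + (norm (g p))\<^sup>2 / t) / 2" for p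
      proof -
        have "0 \<le> (t * norm (f p) - norm (g p))\<^sup>2 / t" using t by simp
        also have "\<dots> = t * (norm (f p))\<^sup>2 + (norm (g p))\<^sup>2 / t - 2 * (norm (f p) * norm (g p))"
          using t by (simp add: power2_eq_square field_simps)
        finally show ?thesis by simp
      qed
    qed (use f g sqi_integrable_norm_mult in \<open>auto simp: sqi_def\<close>)
    also have "\<dots> = (t * (nrm f)\<^sup>2 + (nrm g)\<^sup>2 / t) / 2"
      using f g by (simp add: sqi_def nrm_sq)
    also have "\<dots> \<le> (t * (nrm f + e)\<^sup>2 + (nrm g + e)\<^sup>2 / t) / 2"
      using t e by (intro divide_right_mono add_mono mult_left_mono power_mono) auto
    also have "\<dots> = (nrm f + e) * (nrm g + e)"
      using pos by (simp add: t_def power2_eq_square)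
    finally show ?thesis .
  qed
  have "((\<lambda>e. (nrm f + e) * (nrm g + e)) \<longlongrightarrow> (nrm f + 0) * (nrm g + 0)) (at_right 0)"
    by (intro tendsto_intros)
  then show ?thesis
    by (intro tendsto_lowerbound[of _ _ "at_right (0::real)"]) (auto simp: eventually_at_filter *)
qed

lemma norm_integral_mult_le:
  assumes "sqi f" "sqi g" shows "norm (\<integral>p. f p * g p \<partial>lebesgue) \<le> nrm f * nrm g"
proof -
  have "norm (\<integral>p. f p * g p \<partial>lebesgue) \<le> (\<integral>p. norm (f p * g p) \<partial>lebesgue)"
    by (rule integral_norm_bound)
  also have "\<dots> \<le> nrm f * nrm g" using Cauchy_Schwarz_nrm[OF assms] by (simp add: norm_mult)
  finally show ?thesis .
qed

lemma nrm_triangle: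
  assumes f: "sqi f" and g: "sqi g"
  shows "nrm (\<lambda>p. f p + g p) \<le> nrm f + nrm g"
proof -
  have "(nrm (\<lambda>p. f p + g p))\<^sup>2 = (\<integral>p. (norm (f p + g p))\<^sup>2 \<partial>lebesgue)" by (rule nrm_sq)
  also have "\<dots> \<le> (\<integral>p. (norm (f p))\<^sup>2 + (norm (g p))\<^sup>2 + 2 * (norm (f p) * norm (g p)) \<partial>lebesgue)"
  proof (rule integral_mono)
    show "(norm (f p + g p))\<^sup>2 \<le> (norm (f p))\<^sup>2 + (norm (g p))\<^sup>2 + 2 * (norm (f p) * norm (g p))" for p
    proof -
      have "(norm (f p + g p))\<^sup>2 \<le> (norm (f p) + norm (g p))\<^sup>2"
        by (intro power_mono norm_triangle_ineq) simp
      then show ?thesis by (simp add: power2_eq_square algebra_simps)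
    qed
  qed (use f g sqi_add[OF f g] sqi_integrable_norm_mult[OF f g] in \<open>auto simp: sqi_def\<close>)
  also have "\<dots> = (nrm f)\<^sup>2 + (nrm g)\<^sup>2 + 2 * (\<integral>p. norm (f p) * norm (g p) \<partial>lebesgue)"
    using f g sqi_integrable_norm_mult[OF f g] by (simp add: sqi_def nrm_sq)
  also have "\<dots> \<le> (nrm f)\<^sup>2 + (nrm g)\<^sup>2 + 2 * (nrm f * nrm g)"
    using Cauchy_Schwarz_nrm[OF f g] by simp
  also have "\<dots> = (nrm f + nrm g)\<^sup>2" by (simp add: power2_eq_square algebra_simps)
  finally show ?thesis by (rule power2_le_imp_le) simp
qed

lemma nrm_cmult: "nrm (\<lambda>p. c * f p) = norm c * nrm f"
  by (simp add: nrm_def norm_mult power_mult_distrib real_sqrt_mult)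

lemma nrm_cong_AE: "AE p in lebesgue. norm (f p) = norm (g p) \<Longrightarrow> f \<in> borel_measurable lebesgue \<Longrightarrow>
   g \<in> borel_measurable lebesgue \<Longrightarrow> nrm f = nrm g"
  unfolding nrm_def by (intro arg_cong[of _ _ sqrt] integral_cong_AE) auto

lemma sqi_bounded_support:
  assumes "f \<in> borel_measurable lebesgue" "S \<in> lmeasurable" "\<And>p. norm (f p) \<le> C * indicator S p"
  shows "sqi f"
proof (rule sqi_dominated[of "\<lambda>p. indicator S p"])
  have "integrable lebesgue (\<lambda>p. indicator S p :: real)" using assms(2) by (intro integrable_real_indicator) (auto simp: fmeasurable_def)
  moreover have "(norm (indicator S p :: complex))\<^sup>2 = indicator S p" for p by (auto simp: indicator_def)
  ultimately show "sqi (\<lambda>p. indicator S p)"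
    using assms(2) by (auto simp: sqi_def fmeasurable_def)
  show "AE p in lebesgue. norm (f p) \<le> C * norm (indicator S p :: complex)"
  proof (rule AE_I2)
    fix p
    have "norm (indicator S p :: complex) = indicator S p" by (simp add: indicator_def)
    then show "norm (f p) \<le> C * norm (indicator S p :: complex)" using assms(3)[of p] by (simp only:)
  qed
qed (use assms in auto)

lemma sqi_dominated_convergence:
  fixes g :: "nat \<Rightarrow> real \<times> real \<Rightarrow> complex"
  assumes f: "sqi f" and g: "\<And>n. g n \<in> borel_measurable lebesgue" and S: "S \<in> lmeasurable" 
    and bd: "\<And>n p. norm (g n p) \<le> C * indicator S p"
    and lim: "\<And>p. (\<lambda>n. g n p) \<longlonglongrightarrow> g' p"
  shows "(\<lambda>n. \<integral>p. f p * g n p \<partial>lebesgue) \<longlonglongrightarrow> (\<integral>p. f p * g' p \<partial>lebesgue)"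
proof (rule integral_dominated_convergence)
  show "integrable lebesgue (\<lambda>p. norm (f p) * norm (of_real C * indicator S p :: complex))"
    using S by (intro sqi_integrable_norm_mult f sqi_bounded_support[of _ S "norm C"])
      (auto simp: norm_mult indicator_def fmeasurable_def)
  show "(\<lambda>p. f p * g' p) \<in> borel_measurable lebesgue"
    using f borel_measurable_LIMSEQ_metric[OF g lim] by (auto simp: sqi_def)
  show "(\<lambda>p. f p * g n p) \<in> borel_measurable lebesgue" for n using f g by (auto simp: sqi_def)
  show "AE p in lebesgue. (\<lambda>n. f p * g n p) \<longlonglongrightarrow> f p * g' p"
    by (intro AE_I2 tendsto_intros lim)
  show "AE p in lebesgue. norm (f p * g n p) \<le> norm (f p) * norm (of_real C * indicator S p :: complex)" for n
  proof (rule AE_I2)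
    fix p
    have "norm (g n p) \<le> norm (of_real C * indicator S p :: complex)"
      using bd[of n p] by (cases "p \<in> S") (auto intro: order_trans[OF _ abs_ge_self])
    then show "norm (f p * g n p) \<le> norm (f p) * norm (of_real C * indicator S p :: complex)"
      by (simp add: norm_mult mult_left_mono)
  qed
qed

lemma nrm_tendsto_integral:
  assumes "\<And>n. sqi (f n)" "sqi F" "sqi h" "(\<lambda>n. nrm (\<lambda>p. f n p - F p)) \<longlonglongrightarrow> 0"
  shows "(\<lambda>n. \<integral>p. f n p * h p \<partial>lebesgue) \<longlonglongrightarrow> (\<integral>p. F p * h p \<partial>lebesgue)"
proof (rule LIM_zero_cancel, rule Lim_null_comparison)
  show "(\<lambda>n. nrm (\<lambda>p. f n p - F p) * nrm h) \<longlonglongrightarrow> 0"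
    using tendsto_mult_right[OF assms(4)] by simp
  show "\<forall>\<^sub>F n in sequentially. norm ((\<integral>p. f n p * h p \<partial>lebesgue) - (\<integral>p. F p * h p \<partial>lebesgue)) \<le> nrm (\<lambda>p. f n p - F p) * nrm h"
  proof (rule always_eventually, rule allI)
    fix n
    have "(\<integral>p. f n p * h p \<partial>lebesgue) - (\<integral>p. F p * h p \<partial>lebesgue) = (\<integral>p. (f n p - F p) * h p \<partial>lebesgue)"
      using assms by (simp add: sqi_integrable_mult algebra_simps)
    then show "norm ((\<integral>p. f n p * h p \<partial>lebesgue) - (\<integral>p. F p * h p \<partial>lebesgue)) \<le> nrm (\<lambda>p. f n p - F p) * nrm h"
      using norm_integral_mult_le[OF sqi_diff[OF assms(1)[of n] assms(2)] assms(3)] by simp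
  qed
qed

section \<open>Geometry near the rectangle\<close>

text \<open>The derivative r' vanishes to the left of a and is Lipschitz, so it is at most L (x - a)
  between a and x; the mean value theorem supplies the second factor x - a.\<close>

lemma C11_right_quadratic:
  fixes r r' :: "real \<Rightarrow> real"
  assumes a: "a > 0"
    and d: "\<And>x. \<bar>x\<bar> < a + \<eta> \<Longrightarrow> (r has_real_derivative r' x) (at x)"
    and L: "\<And>x y. \<bar>x\<bar> < a + \<eta> \<Longrightarrow> \<bar>y\<bar> < a + \<eta> \<Longrightarrow> \<bar>r' x - r' y\<bar> \<le> L * \<bar>x - y\<bar>" and "L > 0"
    and r0: "\<And>x. \<bar>x\<bar> \<le> a \<Longrightarrow> r x = 0" and x: "a < x" "x < a + \<eta>"
  shows "\<bar>r x\<bar> \<le> L * (x - a)\<^sup>2"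
proof -
  have z: "r' t = 0" if "0 \<le> t" "t < a" for t
  proof -
    have "((\<lambda>_. 0) has_real_derivative 0) (at t)" by simp
    then have "(r has_real_derivative 0) (at t)"
      by (rule has_field_derivative_transform_within_open[of _ _ _ "{-a<..<a}"]) (use that r0 in auto)
    then show ?thesis using d[of t] that x DERIV_unique by fastforce
  qed
  have b: "\<bar>r' z\<bar> \<le> L * (x - a)" if "a < z" "z < x" for z
  proof (rule field_le_epsilon)
    fix e :: real assume "e > 0"
    \<comment> \<open>Since r' = 0 is known only strictly to the left of a, the comparison point t
      is taken slightly below a; the Lipschitz bound then loses at most e.\<close>
    define t where "t = max 0 (a - e / L)"
    have t: "0 \<le> t" "t < a" "a - t \<le> e / L" using a \<open>e > 0\<close> \<open>L > 0\<close> by (auto simp: t_def)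
    have "\<bar>r' z\<bar> \<le> L * \<bar>z - t\<bar>" using L[of z t] z[of t] t that x by auto
    also have "\<dots> \<le> L * (x - a + e / L)" using t that \<open>L > 0\<close> by (intro mult_left_mono) auto
    also have "\<dots> = L * (x - a) + e" using \<open>L > 0\<close> by (simp add: field_simps)
    finally show "\<bar>r' z\<bar> \<le> L * (x - a) + e" .
  qed
  obtain z where z: "a < z" "z < x" "r x - r a = (x - a) * r' z"
    using MVT2[of a x r r'] d x a by auto
  have "\<bar>r x\<bar> = (x - a) * \<bar>r' z\<bar>" using z r0[of a] a x by (simp add: abs_mult)
  also have "\<dots> \<le> (x - a) * (L * (x - a))" using b[OF z(1,2)] x by (intro mult_left_mono) auto
  finally show ?thesis by (simp add: power2_eq_square mult_ac)
qed

lemma C11_quadratic: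
  assumes a: "a > 0" and c: "C11_on {-a-\<eta><..<a+\<eta>} r" and r0: "\<And>x. \<bar>x\<bar> \<le> a \<Longrightarrow> r x = 0"
  obtains L where "L > 0" "\<And>x. a < \<bar>x\<bar> \<Longrightarrow> \<bar>x\<bar> < a + \<eta> \<Longrightarrow> \<bar>r x\<bar> \<le> L * (\<bar>x\<bar> - a)\<^sup>2"
proof -
  obtain r' L0 where d: "\<And>x. x \<in> {-a-\<eta><..<a+\<eta>} \<Longrightarrow> (r has_real_derivative r' x) (at x)" and
     L0: "\<And>x y. x\<in>{-a-\<eta><..<a+\<eta>} \<Longrightarrow> y\<in>{-a-\<eta><..<a+\<eta>} \<Longrightarrow> \<bar>r' x - r' y\<bar> \<le> L0 * \<bar>x - y\<bar>"
    using c unfolding C11_on_def by metis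
  define L where "L = max L0 1"
  have d1: "(r has_real_derivative r' x) (at x)" if "\<bar>x\<bar> < a + \<eta>" for x using d[of x] that by (auto simp: abs_less_iff)
  have L1: "\<bar>r' x - r' y\<bar> \<le> L * \<bar>x - y\<bar>" if "\<bar>x\<bar> < a + \<eta>" "\<bar>y\<bar> < a + \<eta>" for x y
  proof -
    have "\<bar>r' x - r' y\<bar> \<le> L0 * \<bar>x - y\<bar>" using L0[of x y] that by (auto simp: abs_less_iff)
    also have "\<dots> \<le> L * \<bar>x - y\<bar>" by (intro mult_right_mono) (auto simp: L_def)
    finally show ?thesis .
  qed
  have L: "L > 0" by (simp add: L_def)
  have 1: "\<bar>r x\<bar> \<le> L * (x - a)\<^sup>2" if "a < x" "x < a + \<eta>" for x
    using C11_right_quadratic[OF a d1 L1 L r0 that] by blast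
  have 2: "\<bar>r (- x)\<bar> \<le> L * (x - a)\<^sup>2" if "a < x" "x < a + \<eta>" for x
  proof (rule C11_right_quadratic[where r = "\<lambda>x. r (- x)" and r' = "\<lambda>x. - r' (- x)", OF a _ _ L _ that])
    show "((\<lambda>x. r (- x)) has_real_derivative - r' (- x)) (at x)" if "\<bar>x\<bar> < a + \<eta>" for x
    proof -
      have "((\<lambda>x. - x) has_real_derivative -1) (at x)" by (auto intro!: derivative_eq_intros)
      with DERIV_chain2[where f = r and g = "\<lambda>x. - x" and x = x and s = UNIV] d1[of "-x"] that
      show ?thesis by fastforce
    qed
    show "\<bar>- r' (- x) - - r' (- y)\<bar> \<le> L * \<bar>x - y\<bar>" if "\<bar>x\<bar> < a + \<eta>" "\<bar>y\<bar> < a + \<eta>" for x y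
      using L1[of "-y" "-x"] that by (simp add: abs_minus_commute)
  qed (use r0 in auto)
  show ?thesis
  proof (rule that[OF L])
    fix x assume "a < \<bar>x\<bar>" "\<bar>x\<bar> < a + \<eta>"
    then show "\<bar>r x\<bar> \<le> L * (\<bar>x\<bar> - a)\<^sup>2" using 1[of x] 2[of "-x"] by (cases "x \<ge> 0") auto
  qed
qed

lemma cos_half_pos: "\<bar>y\<bar> < pi \<Longrightarrow> cos (y/2) > 0"
  by (intro cos_gt_zero_pi) auto

lemma cos_half_le: "\<bar>y\<bar> \<le> pi \<Longrightarrow> cos (y/2) \<le> (pi - \<bar>y\<bar>) / 2"
proof -
  assume "\<bar>y\<bar> \<le> pi"
  have "cos (y/2) = sin (pi/2 - \<bar>y\<bar>/2)" by (simp add: sin_cos_eq abs_if)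
  also have "\<dots> \<le> pi/2 - \<bar>y\<bar>/2" using \<open>\<bar>y\<bar> \<le> pi\<close> by (intro sin_x_le_x) auto
  finally show ?thesis by (simp add: field_simps)
qed

text \<open>Near the top, |r| \<le> L (|x| - a)^2 \<le> L K^2 cos (y/2) < pi - y places (x, y) below
  the graph; the middle is covered by compactness. Near the bottom only the symmetry of the frontier
  is given, not that of \<Omega>, and membership is carried down along vertical segments.\<close>

lemma partially_rectangular_cusp:
  assumes pr: "partially_rectangular \<Omega> a"
  obtains K where "0 < K" "K \<le> 1"
    "\<And>x y. \<bar>y\<bar> < pi \<Longrightarrow> \<bar>x\<bar> < a + K * sqrt (cos (y/2)) \<Longrightarrow> (x, y) \<in> \<Omega>"
proof -
  have op: "open \<Omega>" and a: "a > 0" and R: "{-a..a} \<times> {-pi<..<pi} \<subseteq> \<Omega>"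
    using pr unfolding partially_rectangular_def by auto
  obtain \<epsilon> where \<epsilon>: "\<epsilon> > 0" and sym: "\<And>x y. infdist (x, y) (Rect a) < \<epsilon> \<Longrightarrow>
          (x, y) \<in> frontier \<Omega> \<longleftrightarrow> (x, -y) \<in> frontier \<Omega>"
    using pr unfolding partially_rectangular_def by blast
  obtain \<eta> r where \<eta>: "\<eta> > 0" and C: "C11_on {-a-\<eta><..<a+\<eta>} r" and r0: "\<forall>x\<in>{-a..a}. r x = 0"
    and top: "\<Omega> \<inter> ({-a-\<eta><..<a+\<eta>} \<times> {pi-\<eta><..<pi+\<eta>}) =
          {(x, y). x \<in> {-a-\<eta><..<a+\<eta>} \<and> y \<in> {pi-\<eta><..<pi+\<eta>} \<and> y < pi + r x}"
    using pr unfolding partially_rectangular_def by blast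
  obtain L where L: "L > 0" and rL: "\<And>x. a < \<bar>x\<bar> \<Longrightarrow> \<bar>x\<bar> < a + \<eta> \<Longrightarrow> \<bar>r x\<bar> \<le> L * (\<bar>x\<bar> - a)\<^sup>2"
    using C11_quadratic[OF a C] r0 by (metis abs_le_iff atLeastAtMost_iff minus_le_iff)
  define \<kappa> where "\<kappa> = min (\<eta>/2) 1"
  have \<kappa>: "\<kappa> > 0" "\<kappa> < \<eta>" "\<kappa> \<le> 1" using \<eta> by (auto simp: \<kappa>_def)
  have pi1: "pi > 1" using pi_gt3 by simp
  have "compact ({-a..a} \<times> {-pi+\<kappa>..pi-\<kappa>})" by (intro compact_Times) auto
  moreover have "{-a..a} \<times> {-pi+\<kappa>..pi-\<kappa>} \<subseteq> \<Omega>" using R \<kappa> by force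
  ultimately obtain e where e: "e > 0" and eb: "(\<Union>p\<in>{-a..a} \<times> {-pi+\<kappa>..pi-\<kappa>}. ball p e) \<subseteq> \<Omega>"
    using compact_subset_open_imp_ball_epsilon_subset[OF _ op] by metis
  \<comment> \<open>One bound per use: \<eta> is the range of the graph description, e the distance
    from the compact core to the complement, \<epsilon> the width of the symmetric neighbourhood, 1
    / sqrt L makes L K^2 \<le> 1, and 1 confines the region to |x| < a + 1.\<close>
  define K where "K = Min {1, \<eta>, e, \<epsilon>, 1 / sqrt L}"
  have K: "K > 0" "K \<le> 1" "K \<le> \<eta>" "K \<le> e" "K \<le> \<epsilon>" "K \<le> 1 / sqrt L" using \<eta> e \<epsilon> L by (auto simp: K_def)
  have KL: "L * K\<^sup>2 \<le> 1"
  proof -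
    have "K\<^sup>2 \<le> (1 / sqrt L)\<^sup>2" using K by (intro power_mono) auto
    then show ?thesis using L by (simp add: power_divide field_simps)
  qed
  have sq1: "K * sqrt (cos (y/2)) \<le> K" for y using K by simp
  have mid: "(x, y) \<in> \<Omega>" if y: "\<bar>y\<bar> \<le> pi - \<kappa>" and x: "\<bar>x\<bar> < a + K * sqrt (cos (y/2))" for x y
  proof -
    define x0 where "x0 = max (-a) (min a x)"
    have "\<bar>x - x0\<bar> < e" using x K(4) sq1[of y] a e by (auto simp: x0_def)
    then have "(x, y) \<in> ball (x0, y) e" by (simp add: dist_Pair_Pair dist_real_def)
    moreover have "(x0, y) \<in> {-a..a} \<times> {-pi+\<kappa>..pi-\<kappa>}" using y a by (auto simp: x0_def)
    ultimately show ?thesis using eb by blast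
  qed
  have upper: "(x, y) \<in> \<Omega>" if y: "-pi + \<kappa> \<le> y" "y < pi" and x: "\<bar>x\<bar> < a + K * sqrt (cos (y/2))" for x y
  proof (cases "y \<le> pi - \<kappa>")
    case True
    then show ?thesis using mid y x by auto
  next
    case False
    have xI: "\<bar>x\<bar> < a + \<eta>" using x sq1[of y] K(3) by linarith
    have yp: "\<bar>y\<bar> < pi" "y \<ge> 0" using False y \<kappa> pi1 by auto
    have "y < pi + r x"
    proof (cases "\<bar>x\<bar> \<le> a")
      case True
      then show ?thesis using r0 y by (auto simp: abs_le_iff)
    next
      case False
      have c0: "cos (y/2) > 0" using cos_half_pos yp by blast
      have "(\<bar>x\<bar> - a)\<^sup>2 \<le> (K * sqrt (cos (y/2)))\<^sup>2" using x False by (intro power_mono) auto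
      also have "\<dots> = K\<^sup>2 * cos (y/2)" using c0 by (simp add: power_mult_distrib)
      finally have "L * (\<bar>x\<bar> - a)\<^sup>2 \<le> (L * K\<^sup>2) * cos (y/2)" using L by (simp add: mult.assoc)
      also have "\<dots> \<le> 1 * cos (y/2)" using KL c0 by (intro mult_right_mono) auto
      also have "\<dots> < pi - y" using cos_half_le[of y] yp by simp
      finally show ?thesis using rL[of x] False xI by linarith
    qed
    then have "(x, y) \<in> {(x, y). x \<in> {-a-\<eta><..<a+\<eta>} \<and> y \<in> {pi-\<eta><..<pi+\<eta>} \<and> y < pi + r x}"
      using xI False \<kappa> y \<eta> by (auto simp: abs_less_iff)
    then show ?thesis unfolding top[symmetric] by blast
  qed
  have "(x, y) \<in> \<Omega>" if y: "\<bar>y\<bar> < pi" and x: "\<bar>x\<bar> < a + K * sqrt (cos (y/2))" for x y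
  proof (cases "-pi + \<kappa> \<le> y")
    case True
    then show ?thesis using upper x y by auto
  next
    case False
    define y0 where "y0 = -pi + \<kappa>"
    have y0: "y < y0" "y0 < 0" using False \<kappa> pi1 by (auto simp: y0_def)
    have mono: "cos (y/2) \<le> cos (z/2)" if "y \<le> z" "z \<le> y0" for z
      using cos_monotone_0_pi_le[of "-z/2" "-y/2"] that y y0 by auto
    have xz: "\<bar>x\<bar> < a + K * sqrt (cos (z/2))" if "y \<le> z" "z \<le> y0" for z
    proof -
      have "K * sqrt (cos (y/2)) \<le> K * sqrt (cos (z/2))" using mono[OF that] K by simp
      then show ?thesis using x by linarith
    qed
    have in0: "(x, y0) \<in> \<Omega>" using upper[of y0 x] xz[of y0] y0 pi1 by (auto simp: y0_def)
    show ?thesis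
    proof (rule ccontr)
      \<comment> \<open>The segment from (x, y) up to (x, y0) would start outside \<Omega> and end
        inside, hence meet the frontier. The mirror image of that frontier point is again a frontier
        point, but it lies in the upper part of the cusped region, which is known to be inside the
        open set \<Omega>.\<close>
      assume out: "(x, y) \<notin> \<Omega>"
      have "connected ({x} \<times> {y..y0})" by (intro connected_Times) auto
      moreover have "(x, y0) \<in> {x} \<times> {y..y0} \<inter> \<Omega>" using in0 y0 by simp
      then have "{x} \<times> {y..y0} \<inter> \<Omega> \<noteq> {}" by blast
      moreover have "(x, y) \<in> {x} \<times> {y..y0} - \<Omega>" using out y0 by simp
      then have "{x} \<times> {y..y0} - \<Omega> \<noteq> {}" by blast
      ultimately obtain z where z: "y \<le> z" "z \<le> y0" "(x, z) \<in> frontier \<Omega>"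
        using connected_Int_frontier[of "{x} \<times> {y..y0}" \<Omega>] by auto
      define x0 where "x0 = max (-a) (min a x)"
      have "\<bar>x - x0\<bar> < \<epsilon>" using x K(5) sq1[of y] a \<epsilon> by (auto simp: x0_def)
      then have "dist (x, z) (x0, z) < \<epsilon>" by (simp add: dist_Pair_Pair dist_real_def)
      moreover have "(x0, z) \<in> Rect a" using z y y0 a by (auto simp: Rect_def x0_def)
      ultimately have "infdist (x, z) (Rect a) < \<epsilon>" using infdist_le order.strict_trans1 by blast
      then have "(x, -z) \<in> frontier \<Omega>" using sym z(3) by blast
      moreover have "(x, -z) \<in> \<Omega>" using upper[of "-z" x] xz[OF z(1,2)] z y y0 pi1 \<kappa> by auto
      ultimately show False using op by (simp add: frontier_def interior_open)
    qed
  qed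
  then show ?thesis using that K by blast
qed

section \<open>Cutoff functions\<close>

definition cutoff :: "real \<Rightarrow> real" where "cutoff t = 1 - ustep t"
definition cutoff' :: "real \<Rightarrow> real" where "cutoff' = deriv cutoff"
definition cutoff'' :: "real \<Rightarrow> real" where "cutoff'' = deriv cutoff'"

lemma smooth1_cutoff: "smooth1 cutoff"
  unfolding cutoff_def[abs_def] by (intro smooth1_diff smooth1_const smooth1_ustep)

lemma DERIV_cutoff: "(cutoff has_real_derivative cutoff' x) (at x)"
  using smooth1_derivE[OF smooth1_cutoff] DERIV_imp_deriv unfolding cutoff'_def by metis

lemma smooth1_cutoff': "smooth1 cutoff'"
  using smooth1_deriv[OF smooth1_cutoff DERIV_cutoff] .

lemma DERIV_cutoff': "(cutoff' has_real_derivative cutoff'' x) (at x)"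
  using smooth1_derivE[OF smooth1_cutoff'] DERIV_imp_deriv unfolding cutoff''_def by metis

lemma smooth1_cutoff'': "smooth1 cutoff''"
  using smooth1_deriv[OF smooth1_cutoff' DERIV_cutoff'] .

lemma cutoff_eq_1: "t \<le> 1 \<Longrightarrow> cutoff t = 1" and cutoff_eq_0: "t \<ge> 2 \<Longrightarrow> cutoff t = 0"
  and cutoff_nonneg: "0 \<le> cutoff t" and cutoff_le_1: "cutoff t \<le> 1"
  using ustep_nonneg[of t] ustep_le_1[of t] by (auto simp: cutoff_def ustep_eq_0 ustep_eq_1)

lemma DERIV_eq_0_outside:
  assumes f: "\<And>x. (f has_real_derivative f' x) (at x)" and c: "\<And>x. x \<le> 1 \<Longrightarrow> f x = c" "\<And>x. x \<ge> 2 \<Longrightarrow> f x = d"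
    and x: "x < 1 \<or> x > 2"
  shows "f' x = 0"
proof -
  have "(f has_real_derivative 0) (at x)"
  proof (cases "x < 1")
    case True
    have "((\<lambda>_. c) has_real_derivative 0) (at x)" by simp
    then show ?thesis
      by (rule has_field_derivative_transform_within_open[of _ _ _ "{..<1}"]) (use True c in auto)
  next
    case False
    have "((\<lambda>_. d) has_real_derivative 0) (at x)" by simp
    then show ?thesis
      by (rule has_field_derivative_transform_within_open[of _ _ _ "{2<..}"]) (use x False c in auto)
  qed
  then show ?thesis using f DERIV_unique by blast
qed

lemma cutoff'_eq_0: assumes "t \<le> 1 \<or> t \<ge> 2" shows "cutoff' t = 0"
proof -
  have *: "cutoff' x = 0" if "x < 1 \<or> x > 2" for x
    by (rule DERIV_eq_0_outside[OF DERIV_cutoff _ _ that]) (auto simp: cutoff_eq_1 cutoff_eq_0)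
  have c: "isCont cutoff' x" for x using DERIV_cutoff' DERIV_isCont by blast
  consider "t < 1 \<or> t > 2" | "t = 1" | "t = 2" using assms by linarith
  then show ?thesis
  proof cases
    case 2
    have "((\<lambda>x. cutoff' x) \<longlongrightarrow> cutoff' 1) (at_left 1)"
      using c[of 1] unfolding isCont_def by (rule filterlim_at_split[THEN iffD1, THEN conjunct1])
    moreover have "((\<lambda>x. cutoff' x) \<longlongrightarrow> 0) (at_left 1)"
      by (rule tendsto_eventually) (auto simp: eventually_at_filter *)
    ultimately show ?thesis using 2 tendsto_unique[OF trivial_limit_at_left_real] by blast
  next
    case 3
    have "((\<lambda>x. cutoff' x) \<longlongrightarrow> cutoff' 2) (at_right 2)"
      using c[of 2] unfolding isCont_def by (rule filterlim_at_split[THEN iffD1, THEN conjunct2])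
    moreover have "((\<lambda>x. cutoff' x) \<longlongrightarrow> 0) (at_right 2)"
      by (rule tendsto_eventually) (auto simp: eventually_at_filter *)
    ultimately show ?thesis using 3 tendsto_unique[OF trivial_limit_at_right_real] by blast
  qed (use * in auto)
qed

lemma cutoff''_eq_0: "t < 1 \<or> t > 2 \<Longrightarrow> cutoff'' t = 0"
  by (rule DERIV_eq_0_outside[OF DERIV_cutoff']) (auto simp: cutoff'_eq_0)

lemma cutoff_deriv_bounds: obtains M where "M > 0" "\<And>t. \<bar>cutoff' t\<bar> \<le> M" "\<And>t. \<bar>cutoff'' t\<bar> \<le> M"
proof -
  have "\<exists>M. \<forall>t\<in>{1..2}. \<bar>f t\<bar> \<le> M" if "smooth1 f" for f
    using compact_imp_bounded[OF compact_continuous_image[OF smooth1_continuous[OF that, of "{1..2}"] compact_Icc]]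
    by (auto simp: bounded_iff)
  then obtain M1 M2 where M: "\<And>t. t\<in>{1..2} \<Longrightarrow> \<bar>cutoff' t\<bar> \<le> M1" "\<And>t. t\<in>{1..2} \<Longrightarrow> \<bar>cutoff'' t\<bar> \<le> M2"
    using smooth1_cutoff' smooth1_cutoff'' by meson
  show ?thesis
  proof (rule that[of "max 1 (max M1 M2)"])
    fix t
    show "\<bar>cutoff' t\<bar> \<le> max 1 (max M1 M2)" using M(1)[of t] cutoff'_eq_0[of t] by (cases "t \<in> {1..2}") auto
    show "\<bar>cutoff'' t\<bar> \<le> max 1 (max M1 M2)" using M(2)[of t] cutoff''_eq_0[of t] by (cases "t \<in> {1..2}") auto
  qed simp
qed

text \<open>Compactly supported approximations, from inside, of the indicator of (-b, b): 0 within
  1/n of the ends and 1 from distance 2/n on. They are used with b = pi and b = a to turn functions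
  that do not vanish near the edge into limits of test functions.\<close>

definition plateau :: "real \<Rightarrow> nat \<Rightarrow> real \<Rightarrow> real" where
  "plateau b n y = ustep (real n * (y + b)) * ustep (real n * (b - y))"

lemma smooth1_plateau: "smooth1 (plateau b n)"
proof -
  have "smooth1 (\<lambda>y. ustep (real n * (y + b)))"
    using smooth1_compose[OF smooth1_ustep smooth1_linear[of "real n" "real n * b"]] by (simp add: algebra_simps)
  moreover have "smooth1 (\<lambda>y. ustep (real n * (b - y)))"
    using smooth1_compose[OF smooth1_ustep smooth1_linear[of "- real n" "real n * b"]] by (simp add: algebra_simps)
  ultimately show ?thesis unfolding plateau_def[abs_def] by (rule smooth1_mult)
qed

lemma plateau_nonneg: "0 \<le> plateau b n y" and plateau_le_1: "plateau b n y \<le> 1"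
  using ustep_nonneg ustep_le_1 unfolding plateau_def by (auto intro: mult_le_one)

lemma plateau_eq_0: assumes "n > 0" "\<bar>y\<bar> \<ge> b - 1 / real n" shows "plateau b n y = 0"
proof -
  have "real n * (y + b) \<le> 1 \<or> real n * (b - y) \<le> 1"
    using assms by (cases "y \<ge> 0") (auto simp: field_simps)
  then show ?thesis by (auto simp: plateau_def ustep_eq_0)
qed

lemma plateau_eq_1: assumes "n > 0" "\<bar>y\<bar> \<le> b - 2 / real n" shows "plateau b n y = 1"
proof -
  have "real n * (y + b) \<ge> real n * (2 / real n)" "real n * (b - y) \<ge> real n * (2 / real n)"
    using assms by (intro mult_left_mono; linarith)+
  then show ?thesis using assms by (simp add: plateau_def ustep_eq_1)
qed

lemma eventually_plateau_eq_1: assumes "\<bar>y\<bar> < b" shows "\<forall>\<^sub>F n in sequentially. plateau b (Suc n) y = 1"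
proof -
  have "(\<lambda>n. 2 * inverse (real (Suc n))) \<longlonglongrightarrow> 2 * 0"
    by (intro tendsto_intros LIMSEQ_inverse_real_of_nat)
  then have "\<forall>\<^sub>F n in sequentially. 2 * inverse (real (Suc n)) < b - \<bar>y\<bar>"
    by (rule order_tendstoD) (use assms in simp)
  then show ?thesis
    by eventually_elim (intro plateau_eq_1, auto simp: field_simps)
qed

lemma tendsto_plateau: "\<bar>y\<bar> < b \<Longrightarrow> (\<lambda>n. plateau b (Suc n) y) \<longlonglongrightarrow> 1"
  by (rule tendsto_eventually[OF eventually_plateau_eq_1])

text \<open>With this scaling \<open>cutoff ((x - a) * wt K y)\<close> is 1 up to x = a + (K/3) sqrt
  (cos (y/2)) and 0 from a + (2K/3) sqrt (cos (y/2)) on; the factor 3 leaves room before the edge K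
  sqrt (cos (y/2)) of the cusped region. The real power is the form to which
  \<open>smooth1_mult_cos_powr\<close> applies.\<close>

definition wt :: "real \<Rightarrow> real \<Rightarrow> real" where "wt K y = 3 / K * cos (y/2) powr (- (1/2))"

lemma wt_pos: "K > 0 \<Longrightarrow> \<bar>y\<bar> < pi \<Longrightarrow> wt K y > 0"
  using cos_half_pos[of y] by (simp add: wt_def)

lemma wt_sqrt: "K > 0 \<Longrightarrow> \<bar>y\<bar> < pi \<Longrightarrow> wt K y = 3 / (K * sqrt (cos (y/2)))"
proof -
  assume "K > 0" "\<bar>y\<bar> < pi"
  then have c: "cos (y/2) > 0" using cos_half_pos by blast
  have "cos (y/2) powr (- (1/2)) = inverse (sqrt (cos (y/2)))"
    using c by (subst powr_minus) (simp add: powr_half_sqrt)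
  then show ?thesis using \<open>K > 0\<close> c by (simp add: wt_def field_simps)
qed

text \<open>One cutoff per side. For x \<ge> 0 the second argument is nonpositive, so the second
  cutoff is 1 and cancels the -1, and symmetrically for x \<le> 0. Unlike a product, the sum has
  derivatives without cross terms.\<close>

definition chi :: "real \<Rightarrow> real \<Rightarrow> real \<times> real \<Rightarrow> real" where
  "chi K a p = (if \<bar>snd p\<bar> < pi then cutoff ((fst p - a) * wt K (snd p)) + cutoff ((- fst p - a) * wt K (snd p)) - 1 else 0)"
definition chi_x :: "real \<Rightarrow> real \<Rightarrow> real \<times> real \<Rightarrow> real" where
  "chi_x K a p = (if \<bar>snd p\<bar> < pi then wt K (snd p) * (cutoff' ((fst p - a) * wt K (snd p)) - cutoff' ((- fst p - a) * wt K (snd p))) else 0)"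
definition chi_xx :: "real \<Rightarrow> real \<Rightarrow> real \<times> real \<Rightarrow> real" where
  "chi_xx K a p = (if \<bar>snd p\<bar> < pi then (wt K (snd p))\<^sup>2 * (cutoff'' ((fst p - a) * wt K (snd p)) + cutoff'' ((- fst p - a) * wt K (snd p))) else 0)"

lemma DERIV_chi: "((\<lambda>t. chi K a (t, y)) has_real_derivative chi_x K a (x, y)) (at x)"
  and DERIV_chi_x: "((\<lambda>t. chi_x K a (t, y)) has_real_derivative chi_xx K a (x, y)) (at x)"
proof -
  let ?w = "wt K y"
  have d: "((\<lambda>t. (t - a) * ?w) has_real_derivative ?w) (at x)" "((\<lambda>t. (- t - a) * ?w) has_real_derivative - ?w) (at x)"
    by (auto intro!: derivative_eq_intros)
  have "((\<lambda>t. cutoff ((t - a) * ?w) + cutoff ((- t - a) * ?w) - 1) has_real_derivative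
     cutoff' ((x - a) * ?w) * ?w + cutoff' ((- x - a) * ?w) * (- ?w) - 0) (at x)"
    by (intro DERIV_diff DERIV_add DERIV_const DERIV_chain2[OF DERIV_cutoff] d)
  then show "((\<lambda>t. chi K a (t, y)) has_real_derivative chi_x K a (x, y)) (at x)"
    by (cases "\<bar>y\<bar> < pi") (simp_all add: chi_def chi_x_def algebra_simps)
  have "((\<lambda>t. ?w * (cutoff' ((t - a) * ?w) - cutoff' ((- t - a) * ?w))) has_real_derivative
     ?w * (cutoff'' ((x - a) * ?w) * ?w - cutoff'' ((- x - a) * ?w) * (- ?w))) (at x)"
    by (intro DERIV_cmult DERIV_diff DERIV_chain2[OF DERIV_cutoff'] d)
  then show "((\<lambda>t. chi_x K a (t, y)) has_real_derivative chi_xx K a (x, y)) (at x)"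
    by (cases "\<bar>y\<bar> < pi") (simp_all add: chi_x_def chi_xx_def power2_eq_square algebra_simps)
qed

lemma chi_middle:
  assumes "K > 0" "\<bar>x\<bar> \<le> a" "\<bar>y\<bar> < pi"
  shows "chi K a (x, y) = 1" "chi_x K a (x, y) = 0" "chi_xx K a (x, y) = 0"
proof -
  have "(x - a) * wt K y \<le> 0" "(- x - a) * wt K y \<le> 0"
    using assms wt_pos[of K y] by (auto intro!: mult_nonpos_nonneg simp: abs_le_iff)
  then show "chi K a (x, y) = 1" "chi_x K a (x, y) = 0" "chi_xx K a (x, y) = 0"
    using assms by (auto simp: chi_def chi_x_def chi_xx_def cutoff_eq_1 cutoff'_eq_0 cutoff''_eq_0)
qed

lemma chi_zero:
  assumes "K > 0" "a > 0" "\<bar>x\<bar> > a + 2 * K / 3 * sqrt (cos (y/2))" "\<bar>y\<bar> < pi"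
  shows "chi K a (x, y) = 0" "chi_x K a (x, y) = 0" "chi_xx K a (x, y) = 0"
proof -
  let ?w = "wt K y"
  have c: "sqrt (cos (y/2)) > 0" using cos_half_pos[OF assms(4)] by simp
  have w: "?w > 0" using wt_pos assms by blast
  have "2 * K / 3 * sqrt (cos (y/2)) * ?w = 2" using c assms by (simp add: wt_sqrt)
  moreover have "2 * K / 3 * sqrt (cos (y/2)) < \<bar>x\<bar> - a" using assms by linarith
  from mult_strict_right_mono[OF this w] 
  have "2 * K / 3 * sqrt (cos (y/2)) * ?w < (\<bar>x\<bar> - a) * ?w" .
  ultimately have big: "(\<bar>x\<bar> - a) * ?w > 2" by linarith
  have small: "(- \<bar>x\<bar> - a) * ?w < 0" using w assms by (intro mult_neg_pos) auto
  show "chi K a (x, y) = 0" "chi_x K a (x, y) = 0" "chi_xx K a (x, y) = 0"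
    using big small assms
    by (cases "x \<ge> 0"; simp add: chi_def chi_x_def chi_xx_def cutoff_eq_1 cutoff_eq_0 cutoff'_eq_0 cutoff''_eq_0)+
qed

lemma chi_bounds:
  assumes "K > 0" "a > 0" shows "0 \<le> chi K a p" "chi K a p \<le> 1"
proof -
  have "(- \<bar>fst p\<bar> - a) * wt K (snd p) \<le> 0" if "\<bar>snd p\<bar> < pi"
    using wt_pos[OF assms(1) that] assms by (intro mult_nonpos_nonneg) auto
  then show "0 \<le> chi K a p" "chi K a p \<le> 1"
    using cutoff_nonneg cutoff_le_1 assms
    by (cases "fst p \<ge> 0"; auto simp: chi_def cutoff_eq_1)+
qed

lemma chi_deriv_bounds:
  obtains M where "M > 0"
    "\<And>K a p. K > 0 \<Longrightarrow> \<bar>snd p\<bar> < pi \<Longrightarrow> \<bar>chi_x K a p\<bar> \<le> M * wt K (snd p)"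
    "\<And>K a p. K > 0 \<Longrightarrow> \<bar>snd p\<bar> < pi \<Longrightarrow> \<bar>chi_xx K a p\<bar> \<le> M * (wt K (snd p))\<^sup>2"
proof -
  obtain M where M: "M > 0" "\<And>t. \<bar>cutoff' t\<bar> \<le> M" "\<And>t. \<bar>cutoff'' t\<bar> \<le> M" using cutoff_deriv_bounds by blast
  show ?thesis
  proof (rule that[of "2 * M"])
    fix K a :: real and p :: "real \<times> real" assume "K > 0" "\<bar>snd p\<bar> < pi"
    then have w: "wt K (snd p) > 0" using wt_pos by blast
    have "\<bar>cutoff' s - cutoff' t\<bar> \<le> 2 * M" "\<bar>cutoff'' s + cutoff'' t\<bar> \<le> 2 * M" for s t
      using M(2)[of s] M(2)[of t] M(3)[of s] M(3)[of t] by linarith+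
    then show "\<bar>chi_x K a p\<bar> \<le> 2 * M * wt K (snd p)" "\<bar>chi_xx K a p\<bar> \<le> 2 * M * (wt K (snd p))\<^sup>2"
      using w M(1) by (auto simp: chi_x_def chi_xx_def abs_mult mult.commute intro!: mult_right_mono)
  qed (use M in simp)
qed

lemma smooth1_measurable: "smooth1 f \<Longrightarrow> f \<in> borel_measurable borel"
  by (intro borel_measurable_continuous_onI smooth1_continuous)

lemma borel_imp_lebesgue_measurable: "f \<in> borel_measurable borel \<Longrightarrow> f \<in> borel_measurable (lebesgue :: (real \<times> real) measure)"
  by (intro measurable_completion) simp

lemma borel_measurable_chi [measurable]:
  "chi K a \<in> borel_measurable borel" "chi_x K a \<in> borel_measurable borel" "chi_xx K a \<in> borel_measurable borel"
proof -
  note [measurable] = smooth1_measurable[OF smooth1_cutoff] smooth1_measurable[OF smooth1_cutoff'] smooth1_measurable[OF smooth1_cutoff'']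
    borel_measurable_continuous_onI[OF continuous_on_fst[OF continuous_on_id]] borel_measurable_continuous_onI[OF continuous_on_snd[OF continuous_on_id]]
  show "chi K a \<in> borel_measurable borel" "chi_x K a \<in> borel_measurable borel" "chi_xx K a \<in> borel_measurable borel"
    unfolding chi_def[abs_def] chi_x_def[abs_def] chi_xx_def[abs_def] wt_def by measurable
qed

text \<open>The Dirichlet eigenfunctions of the interval [-pi, pi], with eigenvalues k^2/4.\<close>

definition sn :: "nat \<Rightarrow> real \<Rightarrow> real" where "sn k y = sin (real k * ((y + pi) / 2))"

lemma abs_sin_mult_le: "\<bar>sin (real k * t)\<bar> \<le> real k * \<bar>sin t\<bar>"
proof (induction k)
  case (Suc k)
  have "\<bar>sin (real (Suc k) * t)\<bar> = \<bar>sin (real k * t) * cos t + cos (real k * t) * sin t\<bar>"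
    using sin_add[of "real k * t" t] by (simp add: algebra_simps)
  also have "\<dots> \<le> \<bar>sin (real k * t)\<bar> * 1 + 1 * \<bar>sin t\<bar>"
    by (rule order_trans[OF abs_triangle_ineq])
       (unfold abs_mult, intro add_mono mult_left_mono mult_right_mono, auto)
  also have "\<dots> \<le> real (Suc k) * \<bar>sin t\<bar>" using Suc by (simp add: algebra_simps)
  finally show ?case .
qed simp

text \<open>The case k = 1 is the function cos (y/2) itself, and |sin (k t)| \<le> k |sin t| does
  the rest. The bound vanishes to first order at both ends, exactly the order of the singularity of
  \<open>chi_xx\<close>.\<close>

lemma sn_bound: assumes "\<bar>y\<bar> < pi" shows "\<bar>sn k y\<bar> \<le> real k * cos (y/2)"
proof -
  have "sin ((y + pi) / 2) = cos (y/2)" by (simp add: add_divide_distrib sin_add)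
  then show ?thesis using abs_sin_mult_le[of k "(y + pi) / 2"] cos_half_pos[OF assms] by (simp add: sn_def)
qed

lemma smooth1_sn: "smooth1 (sn k)"
  using smooth1_compose[OF smooth1_sin smooth1_linear[of "real k / 2" "real k * pi / 2"]]
  unfolding sn_def[abs_def] by (simp add: algebra_simps add_divide_distrib)

lemma test_funI:
  fixes \<Phi> :: "real \<times> real \<Rightarrow> real"
  assumes "smooth2 \<Phi>" "compact C" "\<And>p. \<Phi> p \<noteq> 0 \<Longrightarrow> p \<in> C" "C \<subseteq> \<Omega>"
  shows "test_fun \<Omega> \<Phi>"
proof -
  have "closure {p. \<Phi> p \<noteq> 0} \<subseteq> C"
    using assms by (intro closure_minimal compact_imp_closed) auto
  moreover then have "compact (closure {p. \<Phi> p \<noteq> 0})"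
    unfolding compact_eq_bounded_closed using bounded_subset[OF compact_imp_bounded[OF assms(2)]] by simp
  ultimately show ?thesis using assms unfolding test_fun_def by blast
qed

lemma chi_support:
  assumes "0 < K" "K \<le> 1" "a > 0" "chi K a p \<noteq> 0 \<or> chi_x K a p \<noteq> 0 \<or> chi_xx K a p \<noteq> 0"
  shows "\<bar>snd p\<bar> < pi" "\<bar>fst p\<bar> \<le> a + 2 * K / 3 * sqrt (cos (snd p / 2))" "\<bar>fst p\<bar> \<le> a + 1"
proof -
  show y: "\<bar>snd p\<bar> < pi" using assms(4) by (auto simp: chi_def chi_x_def chi_xx_def split: if_splits)
  show x: "\<bar>fst p\<bar> \<le> a + 2 * K / 3 * sqrt (cos (snd p / 2))"
  proof (rule ccontr)
    assume "\<not> ?thesis"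
    then have "\<bar>fst p\<bar> > a + 2 * K / 3 * sqrt (cos (snd p / 2))" by simp
    from chi_zero[OF assms(1,3) this y] assms(4) show False by simp
  qed
  have "2 * K / 3 * sqrt (cos (snd p / 2)) \<le> 1 * 1"
    using assms cos_half_pos[OF y] by (intro mult_mono) auto
  with x show "\<bar>fst p\<bar> \<le> a + 1" by linarith
qed

definition slab :: "real \<Rightarrow> (real \<times> real) set" where
  "slab a = cbox (- (a + 1), - pi) (a + 1, pi)"

lemma slab_iff: "p \<in> slab a \<longleftrightarrow> \<bar>fst p\<bar> \<le> a + 1 \<and> \<bar>snd p\<bar> \<le> pi"
  by (cases p) (auto simp: slab_def cbox_Pair_eq abs_le_iff)

lemma slab_lmeasurable: "slab a \<in> lmeasurable"
  by (simp add: slab_def)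

lemma wt_ge_1: assumes "0 < K" "K \<le> 1" "\<bar>y\<bar> < pi" shows "wt K y \<ge> 1" "(wt K y)\<^sup>2 * cos (y/2) = 9 / K\<^sup>2"
proof -
  have c: "cos (y/2) > 0" using cos_half_pos assms by blast
  have "K * sqrt (cos (y/2)) \<le> 1 * 1" using assms c by (intro mult_mono) auto
  then show "wt K y \<ge> 1" using c assms by (simp add: wt_sqrt field_simps)
  show "(wt K y)\<^sup>2 * cos (y/2) = 9 / K\<^sup>2" using c assms by (simp add: wt_sqrt power_divide power_mult_distrib)
qed

text \<open>The vanishing of \<open>t\<close> to first order at \<open>y = \<plusminus>\<pi>\<close> compensates the singularity of the cutoff.\<close>

lemma chi_dominated:
  assumes K: "0 < K" "K \<le> 1" and a: "a > 0" and h: "smooth1 h" and D: "D \<ge> 0"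
  obtains B where 
    "\<And>p t. \<bar>t\<bar> \<le> D * cos (snd p / 2) \<Longrightarrow> \<bar>h (fst p) * t * chi K a p\<bar> \<le> B * indicator (slab a) p"
    "\<And>p t. \<bar>t\<bar> \<le> D * cos (snd p / 2) \<Longrightarrow> \<bar>h (fst p) * t * chi_x K a p\<bar> \<le> B * indicator (slab a) p"
    "\<And>p t. \<bar>t\<bar> \<le> D * cos (snd p / 2) \<Longrightarrow> \<bar>h (fst p) * t * chi_xx K a p\<bar> \<le> B * indicator (slab a) p"
proof -
  obtain M where M: "M > 0" "\<And>K a p. K > 0 \<Longrightarrow> \<bar>snd p\<bar> < pi \<Longrightarrow> \<bar>chi_x K a p\<bar> \<le> M * wt K (snd p)"
    "\<And>K a p. K > 0 \<Longrightarrow> \<bar>snd p\<bar> < pi \<Longrightarrow> \<bar>chi_xx K a p\<bar> \<le> M * (wt K (snd p))\<^sup>2"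
    using chi_deriv_bounds by blast
  have "bounded (h ` {-(a+1)..a+1})"
    by (intro compact_imp_bounded compact_continuous_image smooth1_continuous h compact_Icc)
  then obtain H where "\<forall>x\<in>{-(a+1)..a+1}. \<bar>h x\<bar> \<le> H"
    unfolding bounded_iff by auto
  then have H: "\<bar>h x\<bar> \<le> H" if "\<bar>x\<bar> \<le> a + 1" for x using that by (auto simp: abs_le_iff)
  have H0: "H \<ge> 0" using H[of 0] a by linarith
  define B where "B = H * (D * (M + 1) * (9 / K\<^sup>2))"
  \<comment> \<open>All three weights are at most (M + 1) wt^2, because wt \<ge> 1 on the strip. The
    identity wt^2 cos (y/2) = 9 / K^2 then removes the singularity at once for the three of
    them.\<close>
  have gen: "\<bar>h (fst p) * t * c\<bar> \<le> B * indicator (slab a) p"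
    if t: "\<bar>t\<bar> \<le> D * cos (snd p / 2)" and c: "\<bar>c\<bar> \<le> (M + 1) * (wt K (snd p))\<^sup>2" 
      and s: "c \<noteq> 0 \<Longrightarrow> \<bar>snd p\<bar> < pi \<and> \<bar>fst p\<bar> \<le> a + 1" for p t c
  proof (cases "c = 0")
    case True
    then show ?thesis using H0 D M(1) K by (simp add: B_def)
  next
    case False
    have "\<bar>t\<bar> * \<bar>c\<bar> \<le> (D * cos (snd p / 2)) * ((M + 1) * (wt K (snd p))\<^sup>2)"
      using t c by (intro mult_mono) auto
    also have "\<dots> = D * (M + 1) * ((wt K (snd p))\<^sup>2 * cos (snd p / 2))" by simp
    also have "\<dots> = D * (M + 1) * (9 / K\<^sup>2)" using wt_ge_1(2)[of K "snd p"] K s[OF False] by simp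
    finally have tc: "\<bar>t\<bar> * \<bar>c\<bar> \<le> D * (M + 1) * (9 / K\<^sup>2)" .
    have "\<bar>h (fst p)\<bar> * (\<bar>t\<bar> * \<bar>c\<bar>) \<le> B"
      unfolding B_def by (rule mult_mono[OF _ tc]) (use H s[OF False] H0 in auto)
    moreover have "p \<in> slab a" using s[OF False] by (simp add: slab_iff)
    ultimately show ?thesis by (simp add: abs_mult mult.assoc)
  qed
  have w: "wt K (snd p) \<ge> 1" "wt K (snd p) \<le> (wt K (snd p))\<^sup>2" if "\<bar>snd p\<bar> < pi" for p :: "real \<times> real"
    using wt_ge_1(1)[OF K that] self_le_power[of "wt K (snd p)" 2] by auto
  show ?thesis
  proof (rule that[of B])
    fix p :: "real \<times> real" and t :: real assume t: "\<bar>t\<bar> \<le> D * cos (snd p / 2)"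
    show "\<bar>h (fst p) * t * chi K a p\<bar> \<le> B * indicator (slab a) p"
    proof (rule gen[OF t])
      show "\<bar>chi K a p\<bar> \<le> (M + 1) * (wt K (snd p))\<^sup>2"
      proof (cases "\<bar>snd p\<bar> < pi")
        case True
        have "\<bar>chi K a p\<bar> \<le> 1 * 1" using chi_bounds[OF K(1) a, of p] by simp
        also have "\<dots> \<le> (M + 1) * (wt K (snd p))\<^sup>2" using w[OF True] M(1) by (intro mult_mono) auto
        finally show ?thesis .
      qed (use M(1) in \<open>simp add: chi_def\<close>)
    qed (use chi_support[OF K a] in blast)
    show "\<bar>h (fst p) * t * chi_x K a p\<bar> \<le> B * indicator (slab a) p"
    proof (rule gen[OF t])
      show "\<bar>chi_x K a p\<bar> \<le> (M + 1) * (wt K (snd p))\<^sup>2"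
      proof (cases "\<bar>snd p\<bar> < pi")
        case True
        have "\<bar>chi_x K a p\<bar> \<le> M * wt K (snd p)" using M(2)[OF K(1) True] .
        also have "\<dots> \<le> (M + 1) * (wt K (snd p))\<^sup>2" using w[OF True] M(1) by (intro mult_mono) auto
        finally show ?thesis .
      qed (use M(1) in \<open>simp add: chi_x_def\<close>)
    qed (use chi_support[OF K a] in blast)
    show "\<bar>h (fst p) * t * chi_xx K a p\<bar> \<le> B * indicator (slab a) p"
    proof (rule gen[OF t])
      show "\<bar>chi_xx K a p\<bar> \<le> (M + 1) * (wt K (snd p))\<^sup>2"
      proof (cases "\<bar>snd p\<bar> < pi")
        case True
        have "\<bar>chi_xx K a p\<bar> \<le> M * (wt K (snd p))\<^sup>2" using M(3)[OF K(1) True] .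
        also have "\<dots> \<le> (M + 1) * (wt K (snd p))\<^sup>2" using w[OF True] M(1) by (intro mult_mono) auto
        finally show ?thesis .
      qed (use M(1) in \<open>simp add: chi_xx_def\<close>)
    qed (use chi_support[OF K a] in blast)
  qed
qed

lemma measurable_fst_snd_borel [measurable]: "fst \<in> borel_measurable (borel :: (real \<times> real) measure)" "snd \<in> borel_measurable (borel :: (real \<times> real) measure)"
  by (auto intro!: borel_measurable_continuous_onI continuous_intros)

lemma smooth1_measurable_fst_snd:
  assumes "smooth1 f"
  shows "(\<lambda>p::real \<times> real. f (fst p)) \<in> borel_measurable borel" "(\<lambda>p::real \<times> real. f (snd p)) \<in> borel_measurable borel"
  using smooth1_measurable[OF assms] by measurable

lemma sqi_of_real_bounded:
  assumes "f \<in> borel_measurable borel" "\<And>p. \<bar>f p\<bar> \<le> B * indicator (slab a) p"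
  shows "sqi (\<lambda>p. complex_of_real (f p))"
proof (rule sqi_bounded_support[OF _ slab_lmeasurable])
  show "(\<lambda>p. complex_of_real (f p)) \<in> borel_measurable lebesgue"
    using borel_imp_lebesgue_measurable[OF assms(1)] by simp
  show "norm (complex_of_real (f p)) \<le> B * indicator (slab a) p" for p using assms(2)[of p] by simp
qed

lemma sqi_dominated_convergence_real:
  fixes g :: "nat \<Rightarrow> real \<times> real \<Rightarrow> real"
  assumes f: "sqi f" and g: "\<And>n. g n \<in> borel_measurable borel"
    and bd: "\<And>n p. \<bar>g n p\<bar> \<le> C * indicator (slab a) p"
    and lim: "\<And>p. (\<lambda>n. g n p) \<longlonglongrightarrow> g' p"
  shows "(\<lambda>n. \<integral>p. f p * complex_of_real (g n p) \<partial>lebesgue) \<longlonglongrightarrow> (\<integral>p. f p * complex_of_real (g' p) \<partial>lebesgue)"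
proof (rule sqi_dominated_convergence[OF f _ slab_lmeasurable])
  show "(\<lambda>p. complex_of_real (g n p)) \<in> borel_measurable lebesgue" for n
    using borel_imp_lebesgue_measurable[OF g] by simp
  show "norm (complex_of_real (g n p)) \<le> C * indicator (slab a) p" for n p using bd[of n p] by simp
  show "(\<lambda>n. complex_of_real (g n p)) \<longlonglongrightarrow> complex_of_real (g' p)" for p by (intro tendsto_of_real lim)
qed

section \<open>Weak formulation on the cusped region and transfer of x-derivatives\<close>

text \<open>\<open>U\<close>, \<open>Ux\<close>, \<open>Uxx\<close>, \<open>Uy\<close>, \<open>Uyy\<close> are the extensions by zero of a function and its weak derivatives on \<open>\<Omega>\<close>.\<close>

locale rect_weak =
  fixes \<Omega> :: "(real \<times> real) set" and a K :: real and U Ux Uxx Uy Uyy :: "real \<times> real \<Rightarrow> complex"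
  assumes a: "a > 0" and K: "0 < K" "K \<le> 1"
    and cusp: "\<And>x y. \<bar>y\<bar> < pi \<Longrightarrow> \<bar>x\<bar> < a + K * sqrt (cos (y/2)) \<Longrightarrow> (x, y) \<in> \<Omega>"
    and edge: "\<And>x. \<bar>x\<bar> \<le> a \<Longrightarrow> (x, pi) \<notin> \<Omega> \<and> (x, - pi) \<notin> \<Omega>"
    and sqi: "sqi U" "sqi Ux" "sqi Uxx" "sqi Uy" "sqi Uyy"
    and wx: "\<And>\<phi>. test_fun \<Omega> \<phi> \<Longrightarrow> (\<integral>p. U p * complex_of_real (px \<phi> p) \<partial>lebesgue) = - (\<integral>p. Ux p * complex_of_real (\<phi> p) \<partial>lebesgue)"
    and wxx: "\<And>\<phi>. test_fun \<Omega> \<phi> \<Longrightarrow> (\<integral>p. U p * complex_of_real (px (px \<phi>) p) \<partial>lebesgue) = (\<integral>p. Uxx p * complex_of_real (\<phi> p) \<partial>lebesgue)"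
    and wyy: "\<And>\<phi>. test_fun \<Omega> \<phi> \<Longrightarrow> (\<integral>p. U p * complex_of_real (py (py \<phi>) p) \<partial>lebesgue) = (\<integral>p. Uyy p * complex_of_real (\<phi> p) \<partial>lebesgue)"
    and h10: "\<exists>\<phi>s :: nat \<Rightarrow> real \<times> real \<Rightarrow> complex. (\<forall>n. test_fun \<Omega> (\<phi>s n)) \<and>
        (\<lambda>n. nrm (\<lambda>p. \<phi>s n p - U p)) \<longlonglongrightarrow> 0 \<and> (\<lambda>n. nrm (\<lambda>p. py (\<phi>s n) p - Uy p)) \<longlonglongrightarrow> 0"
begin

text \<open>The cutoff is singular only at y = -pi and y = pi. A factor \<theta> that vanishes near
  these lines makes the product smooth, with support in a compact part of the cusped region.\<close>

lemma test_chi: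
  assumes G: "smooth1 G" and \<theta>: "smooth1 \<theta>" and \<epsilon>: "\<epsilon> > 0" and supp: "\<And>y. \<bar>y\<bar> \<ge> pi - \<epsilon> \<Longrightarrow> \<theta> y = 0"
  shows "test_fun \<Omega> (\<lambda>p. G (fst p) * \<theta> (snd p) * chi K a p)"
    and "test_fun \<Omega> (\<lambda>p. G (fst p) * \<theta> (snd p) * chi_x K a p)"
proof -
  obtain n where n: "n > 0" "2 / real n < \<epsilon>"
    using reals_Archimedean2[of "2 / \<epsilon>"] \<epsilon> by (metis divide_less_eq divide_pos_pos gr0I mult.commute not_less_iff_gr_or_eq of_nat_0 of_nat_0_less_iff zero_less_numeral)
  \<comment> \<open>A globally smooth substitute for the weight. It agrees with \<open>wt K\<close>
    wherever \<theta> is not 0, since n is so large that the plateau is 1 there.\<close>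
  define \<tau> where "\<tau> y = (3 / K * plateau pi n y) * cos (y/2) powr (- (1/2))" for y
  have \<tau>: "smooth1 \<tau>" unfolding \<tau>_def[abs_def]
  proof (rule smooth1_mult_cos_powr)
    show "smooth1 (\<lambda>y. 3 / K * plateau pi n y)" by (intro smooth1_mult smooth1_const smooth1_plateau)
    show "1 / real n > 0" using n by simp
  qed (use n plateau_eq_0 in auto)
  have \<tau>_eq: "\<tau> y = wt K y" if "\<theta> y \<noteq> 0" for y
  proof -
    have "\<bar>y\<bar> < pi - \<epsilon>" using supp[of y] that by (cases "\<bar>y\<bar> < pi - \<epsilon>") auto
    then have "plateau pi n y = 1" using n by (intro plateau_eq_1) linarith+
    then show ?thesis by (simp add: \<tau>_def wt_def)
  qed
  have y: "\<bar>y\<bar> < pi" if "\<theta> y \<noteq> 0" for y using supp[of y] that \<epsilon> by force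
  \<comment> \<open>The closed condition with 2K/3 implies the strict one with K because the cosine
    is positive here; hence the compact set still lies in \<Omega>.\<close>
  let ?C = "{p. \<bar>snd p\<bar> \<le> pi - \<epsilon> \<and> \<bar>fst p\<bar> \<le> a + 2 * K / 3 * sqrt (cos (snd p / 2))}"
  have C: "compact ?C" "?C \<subseteq> \<Omega>"
  proof -
    have "2 * K / 3 * sqrt (cos t) \<le> 1 * 1" for t
      using K by (cases "cos t \<ge> 0", intro mult_mono) (auto intro: order_trans[of _ 0] simp: mult_nonneg_nonpos)
    then have le: "2 * K / 3 * sqrt (cos (snd p / 2)) \<le> 1" for p :: "real \<times> real" by simp
    have "\<bar>fst p\<bar> \<le> a + 1" if p: "p \<in> ?C" for p
    proof -
      have "\<bar>fst p\<bar> \<le> a + 2 * K / 3 * sqrt (cos (snd p / 2))" using p by blast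
      with le[of p] show ?thesis by linarith
    qed
    then have "?C \<subseteq> slab a" using \<epsilon> by (auto simp: slab_iff)
    moreover have "bounded (slab a)" by (simp add: slab_def)
    moreover have "closed ?C" by (intro closed_Collect_conj closed_Collect_le continuous_intros) auto
    ultimately show "compact ?C" using bounded_subset compact_eq_bounded_closed by blast
    show "?C \<subseteq> \<Omega>"
    proof
      fix p assume p: "p \<in> ?C"
      then have yp: "\<bar>snd p\<bar> < pi" using \<epsilon> by simp
      have "K * sqrt (cos (snd p / 2)) > 0" using cos_half_pos[OF yp] K by simp
      then have "2 * K / 3 * sqrt (cos (snd p / 2)) < K * sqrt (cos (snd p / 2))" by simp
      then have "\<bar>fst p\<bar> < a + K * sqrt (cos (snd p / 2))" using p by auto
      from cusp[OF yp this] show "p \<in> \<Omega>" by simp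
    qed
  qed
  have inC: "p \<in> ?C" if "\<theta> (snd p) \<noteq> 0" "chi K a p \<noteq> 0 \<or> chi_x K a p \<noteq> 0" for p
    using chi_support[OF K a, of p] supp[of "snd p"] that by force
  have lin: "smooth1 (\<lambda>x. x - a)" "smooth1 (\<lambda>x. - x - a)"
    using smooth1_linear[of 1 "-a"] smooth1_linear[of "-1" "-a"] by simp_all
  have mG: "smooth1 (\<lambda>x. - G x)" using smooth1_mult[OF smooth1_const[of "-1"] G] by simp
  \<comment> \<open>The summand -1 in \<open>chi\<close> also has to be of the form S (\<sigma>
    \<tau>); the constant function S = 1 with zero arguments serves for this.\<close>
  have "(\<lambda>p. (G (fst p) * \<theta> (snd p) * cutoff ((fst p - a) * \<tau> (snd p)) + G (fst p) * \<theta> (snd p) * cutoff ((- fst p - a) * \<tau> (snd p)))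
     + (- G (fst p)) * \<theta> (snd p) * ((\<lambda>_. 1) (0 * 0))) \<in> mono2"
    using mono2_base[OF G \<theta> smooth1_cutoff lin(1) \<tau>] mono2_base[OF G \<theta> smooth1_cutoff lin(2) \<tau>]
      mono2_base[OF mG \<theta> smooth1_const[of 1] smooth1_const[of 0] smooth1_const[of 0]]
    by (intro mono2_add) auto
  also have "(\<lambda>p. (G (fst p) * \<theta> (snd p) * cutoff ((fst p - a) * \<tau> (snd p)) + G (fst p) * \<theta> (snd p) * cutoff ((- fst p - a) * \<tau> (snd p)))
     + (- G (fst p)) * \<theta> (snd p) * ((\<lambda>_. 1) (0 * 0))) = (\<lambda>p. G (fst p) * \<theta> (snd p) * chi K a p)"
  proof
    fix p show "(G (fst p) * \<theta> (snd p) * cutoff ((fst p - a) * \<tau> (snd p)) + G (fst p) * \<theta> (snd p) * cutoff ((- fst p - a) * \<tau> (snd p)))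
     + (- G (fst p)) * \<theta> (snd p) * ((\<lambda>_. 1) (0 * 0)) = G (fst p) * \<theta> (snd p) * chi K a p"
      using \<tau>_eq[of "snd p"] y[of "snd p"] by (cases "\<theta> (snd p) = 0") (auto simp: chi_def algebra_simps)
  qed
  finally show "test_fun \<Omega> (\<lambda>p. G (fst p) * \<theta> (snd p) * chi K a p)"
    by (intro test_funI[OF mono2_smooth2 C(1) _ C(2)]) (use inC in auto)
  have "(\<lambda>p. G (fst p) * (\<theta> (snd p) * \<tau> (snd p)) * cutoff' ((fst p - a) * \<tau> (snd p)) + 
      (- G (fst p)) * (\<theta> (snd p) * \<tau> (snd p)) * cutoff' ((- fst p - a) * \<tau> (snd p))) \<in> mono2"
    using mono2_base[OF G smooth1_mult[OF \<theta> \<tau>] smooth1_cutoff' lin(1) \<tau>] mono2_base[OF mG smooth1_mult[OF \<theta> \<tau>] smooth1_cutoff' lin(2) \<tau>]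
    by (intro mono2_add) auto
  also have "(\<lambda>p. G (fst p) * (\<theta> (snd p) * \<tau> (snd p)) * cutoff' ((fst p - a) * \<tau> (snd p)) + 
      (- G (fst p)) * (\<theta> (snd p) * \<tau> (snd p)) * cutoff' ((- fst p - a) * \<tau> (snd p))) = (\<lambda>p. G (fst p) * \<theta> (snd p) * chi_x K a p)"
  proof
    fix p show "G (fst p) * (\<theta> (snd p) * \<tau> (snd p)) * cutoff' ((fst p - a) * \<tau> (snd p)) + 
      (- G (fst p)) * (\<theta> (snd p) * \<tau> (snd p)) * cutoff' ((- fst p - a) * \<tau> (snd p)) = G (fst p) * \<theta> (snd p) * chi_x K a p"
      using \<tau>_eq[of "snd p"] y[of "snd p"] by (cases "\<theta> (snd p) = 0") (auto simp: chi_x_def algebra_simps)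
  qed
  finally show "test_fun \<Omega> (\<lambda>p. G (fst p) * \<theta> (snd p) * chi_x K a p)"
    by (intro test_funI[OF mono2_smooth2 C(1) _ C(2)]) (use inC in auto)
qed

text \<open>Integrates the identity G'' chi = (G chi)_xx - 2 (G chi_x)_x + G chi_xx against u. It is
  arranged so that no derivative of G remains on the right: G will be an oscillating exponential,
  and a term G' chi_x would bring in a factor growing with its frequency.\<close>

lemma integral_chi_compact:
  assumes G: "smooth1 G" "\<And>x. (G has_real_derivative G1 x) (at x)" "\<And>x. (G1 has_real_derivative G2 x) (at x)"
    and \<theta>: "smooth1 \<theta>" and \<epsilon>: "\<epsilon> > 0" and supp: "\<And>y. \<bar>y\<bar> \<ge> pi - \<epsilon> \<Longrightarrow> \<theta> y = 0"
    and D: "D \<ge> 0" "\<And>y. \<bar>y\<bar> < pi \<Longrightarrow> \<bar>\<theta> y\<bar> \<le> D * cos (y/2)"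
  shows "(\<integral>p. U p * complex_of_real (G2 (fst p) * \<theta> (snd p) * chi K a p) \<partial>lebesgue) = 
     (\<integral>p. Uxx p * complex_of_real (G (fst p) * \<theta> (snd p) * chi K a p) \<partial>lebesgue) + 
     2 * (\<integral>p. Ux p * complex_of_real (G (fst p) * \<theta> (snd p) * chi_x K a p) \<partial>lebesgue) +
     (\<integral>p. U p * complex_of_real (G (fst p) * \<theta> (snd p) * chi_xx K a p) \<partial>lebesgue)"
proof -
  let ?F = "\<lambda>h c p. h (fst p) * \<theta> (snd p) * c p"
  have G1: "smooth1 G1" using smooth1_deriv[OF G(1,2)] .
  have G2: "smooth1 G2" using smooth1_deriv[OF G1 G(3)] .
  have \<theta>D: "\<bar>\<theta> (snd p)\<bar> \<le> D * cos (snd p / 2)" if "\<bar>snd p\<bar> < pi" for p :: "real \<times> real" using D(2) that by blast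
  have sq: "sqi (\<lambda>p. complex_of_real (?F h (chi K a) p))" "sqi (\<lambda>p. complex_of_real (?F h (chi_x K a) p))"
      "sqi (\<lambda>p. complex_of_real (?F h (chi_xx K a) p))" if h: "smooth1 h" for h
  proof -
    note [measurable] = smooth1_measurable_fst_snd(1)[OF h] smooth1_measurable_fst_snd(2)[OF \<theta>]
    obtain B where B: "\<And>p t. \<bar>t\<bar> \<le> D * cos (snd p / 2) \<Longrightarrow> \<bar>h (fst p) * t * chi K a p\<bar> \<le> B * indicator (slab a) p"
      "\<And>p t. \<bar>t\<bar> \<le> D * cos (snd p / 2) \<Longrightarrow> \<bar>h (fst p) * t * chi_x K a p\<bar> \<le> B * indicator (slab a) p"
      "\<And>p t. \<bar>t\<bar> \<le> D * cos (snd p / 2) \<Longrightarrow> \<bar>h (fst p) * t * chi_xx K a p\<bar> \<le> B * indicator (slab a) p"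
      using chi_dominated[OF K a h D(1)] by blast
    have B0: "B * indicator (slab a) p \<ge> 0" for p :: "real \<times> real"
      using B(1)[of 0 "(0,0)"] D a by (auto simp: indicator_def slab_iff)
    show "sqi (\<lambda>p. complex_of_real (?F h (chi K a) p))" "sqi (\<lambda>p. complex_of_real (?F h (chi_x K a) p))"
      "sqi (\<lambda>p. complex_of_real (?F h (chi_xx K a) p))"
    proof (rule_tac [!] sqi_of_real_bounded[of _ B a])
      fix p :: "real \<times> real"
      show "\<bar>?F h (chi K a) p\<bar> \<le> B * indicator (slab a) p" "\<bar>?F h (chi_x K a) p\<bar> \<le> B * indicator (slab a) p" 
         "\<bar>?F h (chi_xx K a) p\<bar> \<le> B * indicator (slab a) p"
        using B[OF \<theta>D] B0[of p] by (cases "\<bar>snd p\<bar> < pi"; simp add: chi_def chi_x_def chi_xx_def)+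
    qed measurable
  qed
  have px0: "px (?F G (chi K a)) = (\<lambda>p. ?F G1 (chi K a) p + ?F G (chi_x K a) p)"
  proof (rule px_eqI)
    fix p :: "real \<times> real"
    show "((\<lambda>t. ?F G (chi K a) (t, snd p)) has_vector_derivative ?F G1 (chi K a) p + ?F G (chi_x K a) p) (at (fst p))"
      using DERIV_mult[OF DERIV_cmult_right[OF G(2)[of "fst p"], of "\<theta> (snd p)"] DERIV_chi[of K a "snd p" "fst p"]]
      by (simp add: has_real_derivative_iff_has_vector_derivative[symmetric] algebra_simps)
  qed
  have px1: "px (\<lambda>p. ?F G1 (chi K a) p + ?F G (chi_x K a) p) = (\<lambda>p. ?F G2 (chi K a) p + 2 * ?F G1 (chi_x K a) p + ?F G (chi_xx K a) p)"
  proof (rule px_eqI)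
    fix p :: "real \<times> real"
    show "((\<lambda>t. ?F G1 (chi K a) (t, snd p) + ?F G (chi_x K a) (t, snd p)) has_vector_derivative 
       ?F G2 (chi K a) p + 2 * ?F G1 (chi_x K a) p + ?F G (chi_xx K a) p) (at (fst p))"
      using DERIV_add[OF DERIV_mult[OF DERIV_cmult_right[OF G(3)[of "fst p"], of "\<theta> (snd p)"] DERIV_chi[of K a "snd p" "fst p"]]
         DERIV_mult[OF DERIV_cmult_right[OF G(2)[of "fst p"], of "\<theta> (snd p)"] DERIV_chi_x[of K a "snd p" "fst p"]]]
      by (simp add: has_real_derivative_iff_has_vector_derivative[symmetric] algebra_simps)
  qed
  have px2: "px (?F G (chi_x K a)) = (\<lambda>p. ?F G1 (chi_x K a) p + ?F G (chi_xx K a) p)"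
  proof (rule px_eqI)
    fix p :: "real \<times> real"
    show "((\<lambda>t. ?F G (chi_x K a) (t, snd p)) has_vector_derivative ?F G1 (chi_x K a) p + ?F G (chi_xx K a) p) (at (fst p))"
      using DERIV_mult[OF DERIV_cmult_right[OF G(2)[of "fst p"], of "\<theta> (snd p)"] DERIV_chi_x[of K a "snd p" "fst p"]]
      by (simp add: has_real_derivative_iff_has_vector_derivative[symmetric] algebra_simps)
  qed
  note int = sqi_integrable_mult[OF sqi(1) sq(1)[OF G2]] sqi_integrable_mult[OF sqi(1) sq(2)[OF G1]] sqi_integrable_mult[OF sqi(1) sq(3)[OF G(1)]]
  let ?I = "\<lambda>h c. \<integral>p. U p * complex_of_real (?F h c p) \<partial>lebesgue"
  have "?I G2 (chi K a) + 2 * ?I G1 (chi_x K a) + ?I G (chi_xx K a) = (\<integral>p. U p * complex_of_real (px (px (?F G (chi K a))) p) \<partial>lebesgue)"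
  proof -
    have "(\<integral>p. U p * complex_of_real (px (px (?F G (chi K a))) p) \<partial>lebesgue) = 
      (\<integral>p. U p * complex_of_real (?F G2 (chi K a) p) + 2 * (U p * complex_of_real (?F G1 (chi_x K a) p)) + U p * complex_of_real (?F G (chi_xx K a) p) \<partial>lebesgue)"
      unfolding px0 px1 by (intro Bochner_Integration.integral_cong) (simp_all add: algebra_simps)
    also have "\<dots> = ?I G2 (chi K a) + 2 * ?I G1 (chi_x K a) + ?I G (chi_xx K a)"
      by (subst Bochner_Integration.integral_add | simp only: integral_mult_right_zero | intro int Bochner_Integration.integrable_add integrable_mult_right)+
    finally show ?thesis by simp
  qed
  also have "\<dots> = (\<integral>p. Uxx p * complex_of_real (?F G (chi K a) p) \<partial>lebesgue)"
    by (rule wxx[OF test_chi(1)[OF G(1) \<theta> \<epsilon> supp]])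
  finally have 1: "?I G2 (chi K a) + 2 * ?I G1 (chi_x K a) + ?I G (chi_xx K a) = (\<integral>p. Uxx p * complex_of_real (?F G (chi K a) p) \<partial>lebesgue)" .
  have "?I G1 (chi_x K a) + ?I G (chi_xx K a) = (\<integral>p. U p * complex_of_real (?F G1 (chi_x K a) p) + U p * complex_of_real (?F G (chi_xx K a) p) \<partial>lebesgue)"
    by (rule Bochner_Integration.integral_add[symmetric]; rule int)
  also have "\<dots> = (\<integral>p. U p * complex_of_real (px (?F G (chi_x K a)) p) \<partial>lebesgue)"
    unfolding px2 by (intro Bochner_Integration.integral_cong) (simp_all add: algebra_simps)
  also have "\<dots> = - (\<integral>p. Ux p * complex_of_real (?F G (chi_x K a) p) \<partial>lebesgue)"
    by (rule wx[OF test_chi(2)[OF G(1) \<theta> \<epsilon> supp]])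
  finally have 2: "?I G1 (chi_x K a) = - (\<integral>p. Ux p * complex_of_real (?F G (chi_x K a) p) \<partial>lebesgue) - ?I G (chi_xx K a)"
    by (simp add: algebra_simps)
  show ?thesis using 1 unfolding 2 by (simp add: algebra_simps)
qed

text \<open>Limit of the compact case with \<theta> the sine times a plateau. No y-derivative is
  involved, so the steepening plateau does no harm, and \<bar>\<theta>\<bar> \<le> k cos (y/2) holds
  uniformly and dominates even the integrand with \<open>chi_xx\<close>.\<close>

lemma integral_chi_sn:
  assumes G: "smooth1 G" "\<And>x. (G has_real_derivative G1 x) (at x)" "\<And>x. (G1 has_real_derivative G2 x) (at x)"
  shows "(\<integral>p. U p * complex_of_real (G2 (fst p) * sn k (snd p) * chi K a p) \<partial>lebesgue) = 
     (\<integral>p. Uxx p * complex_of_real (G (fst p) * sn k (snd p) * chi K a p) \<partial>lebesgue) + 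
     2 * (\<integral>p. Ux p * complex_of_real (G (fst p) * sn k (snd p) * chi_x K a p) \<partial>lebesgue) +
     (\<integral>p. U p * complex_of_real (G (fst p) * sn k (snd p) * chi_xx K a p) \<partial>lebesgue)"
proof -
  define \<theta> where "\<theta> n y = sn k y * plateau pi (Suc n) y" for n y
  have \<theta>: "smooth1 (\<theta> n)" for n unfolding \<theta>_def[abs_def] by (intro smooth1_mult smooth1_sn smooth1_plateau)
  have \<theta>b: "\<bar>\<theta> n y\<bar> \<le> real k * cos (y/2)" if "\<bar>y\<bar> < pi" for n y
  proof -
    have "\<bar>\<theta> n y\<bar> \<le> \<bar>sn k y\<bar> * 1" unfolding \<theta>_def abs_mult
      using plateau_nonneg[of pi "Suc n" y] plateau_le_1[of pi "Suc n" y] by (intro mult_left_mono) auto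
    then show ?thesis using sn_bound[OF that, of k] by simp
  qed
  have G2: "smooth1 G2" using smooth1_deriv[OF smooth1_deriv[OF G(1,2)] G(3)] .
  have lim: "(\<lambda>n. \<integral>p. V p * complex_of_real (h (fst p) * \<theta> n (snd p) * c p) \<partial>lebesgue) \<longlonglongrightarrow>
    (\<integral>p. V p * complex_of_real (h (fst p) * sn k (snd p) * c p) \<partial>lebesgue)" 
    if V: "sqi V" and h: "smooth1 h" and c: "c \<in> {chi K a, chi_x K a, chi_xx K a}" for V h c
  proof -
    obtain B where B': "\<And>p t. \<bar>t\<bar> \<le> real k * cos (snd p / 2) \<Longrightarrow> \<bar>h (fst p) * t * chi K a p\<bar> \<le> B * indicator (slab a) p"
      "\<And>p t. \<bar>t\<bar> \<le> real k * cos (snd p / 2) \<Longrightarrow> \<bar>h (fst p) * t * chi_x K a p\<bar> \<le> B * indicator (slab a) p"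
      "\<And>p t. \<bar>t\<bar> \<le> real k * cos (snd p / 2) \<Longrightarrow> \<bar>h (fst p) * t * chi_xx K a p\<bar> \<le> B * indicator (slab a) p"
      using chi_dominated[OF K a h of_nat_0_le_iff] by blast
    have B: "\<bar>h (fst p) * t * c p\<bar> \<le> B * indicator (slab a) p" if "\<bar>t\<bar> \<le> real k * cos (snd p / 2)" for p t
      using c B'[OF that] by (elim insertE) auto
    have B0: "B * indicator (slab a) p \<ge> 0" for p :: "real \<times> real"
      using B[of 0 "(0,0)"] a by (auto simp: indicator_def slab_iff)
    have c0: "c p = 0" if "\<not> \<bar>snd p\<bar> < pi" for p using c that by (auto simp: chi_def chi_x_def chi_xx_def)
    have [measurable]: "c \<in> borel_measurable borel" using c borel_measurable_chi by blast
    show ?thesis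
    proof (rule sqi_dominated_convergence_real[OF V])
      note [measurable] = smooth1_measurable_fst_snd(1)[OF h] smooth1_measurable_fst_snd(2)[OF \<theta>]
      show "(\<lambda>p. h (fst p) * \<theta> n (snd p) * c p) \<in> borel_measurable borel" for n by measurable
      show "\<bar>h (fst p) * \<theta> n (snd p) * c p\<bar> \<le> B * indicator (slab a) p" for n p
        using B[OF \<theta>b, of p n] c0[of p] B0[of p] by (cases "\<bar>snd p\<bar> < pi") auto
      show "(\<lambda>n. h (fst p) * \<theta> n (snd p) * c p) \<longlonglongrightarrow> h (fst p) * sn k (snd p) * c p" for p
      proof (cases "\<bar>snd p\<bar> < pi")
        case True
        have "(\<lambda>n. h (fst p) * (sn k (snd p) * plateau pi (Suc n) (snd p)) * c p) \<longlonglongrightarrow> h (fst p) * (sn k (snd p) * 1) * c p"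
          by (intro tendsto_intros tendsto_plateau True)
        then show ?thesis by (simp add: \<theta>_def)
      qed (simp add: c0)
    qed
  qed
  have eq: "(\<integral>p. U p * complex_of_real (G2 (fst p) * \<theta> n (snd p) * chi K a p) \<partial>lebesgue) = 
     (\<integral>p. Uxx p * complex_of_real (G (fst p) * \<theta> n (snd p) * chi K a p) \<partial>lebesgue) + 
     2 * (\<integral>p. Ux p * complex_of_real (G (fst p) * \<theta> n (snd p) * chi_x K a p) \<partial>lebesgue) +
     (\<integral>p. U p * complex_of_real (G (fst p) * \<theta> n (snd p) * chi_xx K a p) \<partial>lebesgue)" for n
    by (rule integral_chi_compact[OF G \<theta>, of "1 / real (Suc n)" n "real k"])
       (use \<theta>b plateau_eq_0[of "Suc n"] in \<open>auto simp: \<theta>_def\<close>)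
  show ?thesis
    by (rule LIMSEQ_unique[OF lim[OF sqi(1) G2]], simp, unfold eq, 
        intro tendsto_add tendsto_mult tendsto_const lim sqi G) auto
qed

end

section \<open>Weak identities\<close>

lemma integrable_bounded_lborel:
  fixes f :: "real \<times> real \<Rightarrow> complex"
  assumes f: "f \<in> borel_measurable borel" and S: "S \<in> lmeasurable" and b: "\<And>p. norm (f p) \<le> B * indicator S p"
  shows "integrable lborel f"
proof -
  have "integrable lebesgue (\<lambda>p. B * indicator S p :: real)"
    using S by (intro integrable_mult_right integrable_real_indicator) (auto simp: fmeasurable_def)
  then have "integrable lebesgue f"
  proof (rule Bochner_Integration.integrable_bound)
    show "f \<in> borel_measurable lebesgue" using borel_imp_lebesgue_measurable f by (intro measurable_completion) simp
    show "AE p in lebesgue. norm (f p) \<le> norm (B * indicator S p :: real)"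
      by (intro AE_I2 order_trans[OF b]) simp
  qed
  then show ?thesis using f by (simp add: integrable_completion)
qed

lemma lebesgue_Fubini:
  fixes f :: "real \<times> real \<Rightarrow> complex"
  assumes f: "f \<in> borel_measurable borel" and S: "S \<in> lmeasurable" and b: "\<And>p. norm (f p) \<le> B * indicator S p"
  shows "(\<integral>p. f p \<partial>lebesgue) = (\<integral>x. (\<integral>y. f (x, y) \<partial>lborel) \<partial>lborel)"
proof -
  have "(\<integral>p. f p \<partial>lebesgue) = (\<integral>p. f p \<partial>lborel)" using f by (simp add: integral_completion)
  also have "\<dots> = (\<integral>p. f p \<partial>(lborel \<Otimes>\<^sub>M lborel))" by (simp add: lborel_prod)
  also have "\<dots> = (\<integral>x. (\<integral>y. f (x, y) \<partial>lborel) \<partial>lborel)"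
    using integrable_bounded_lborel[OF assms] by (intro lborel_pair.integral_fst'[symmetric]) (simp add: lborel_prod)
  finally show ?thesis .
qed

lemma continuous_compact_support_bounded:
  fixes \<phi> :: "real \<times> real \<Rightarrow> complex"
  assumes c: "continuous_on UNIV \<phi>" and C: "compact C" and s: "\<And>p. p \<notin> C \<Longrightarrow> \<phi> p = 0"
  obtains B where "\<And>p. norm (\<phi> p) \<le> B * indicator C p" "B \<ge> 0"
proof -
  have "bounded (\<phi> ` C)"
    by (intro compact_imp_bounded compact_continuous_image C continuous_on_subset[OF c]) auto
  then obtain B where B: "\<forall>p\<in>C. norm (\<phi> p) \<le> B" unfolding bounded_iff by auto
  have "norm (\<phi> p) \<le> max B 0 * indicator C p" for p
    using B s[of p] by (cases "p \<in> C") auto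
  then show ?thesis using that by fastforce
qed

lemma test_fun_facts:
  fixes \<phi> :: "real \<times> real \<Rightarrow> complex"
  assumes "test_fun \<Omega> \<phi>"
  shows "continuous_on UNIV \<phi>" "continuous_on UNIV (py \<phi>)" "sqi \<phi>" "sqi (py \<phi>)" "p \<notin> \<Omega> \<Longrightarrow> \<phi> p = 0"
    "((\<lambda>t. \<phi> (x, t)) has_vector_derivative py \<phi> (x, y)) (at y)" "p \<notin> \<Omega> \<Longrightarrow> py \<phi> p = 0"
proof -
  obtain C where sm: "smooth2 \<phi>" and C: "compact C" "C \<subseteq> \<Omega>" and z: "\<And>p. p \<notin> C \<Longrightarrow> \<phi> p = 0"
  proof
    show "smooth2 \<phi>" "compact (closure {p. \<phi> p \<noteq> 0})" "closure {p. \<phi> p \<noteq> 0} \<subseteq> \<Omega>"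
      using assms by (simp_all only: test_fun_def)
    fix p assume "p \<notin> closure {p. \<phi> p \<noteq> 0}"
    then have "p \<notin> {p. \<phi> p \<noteq> 0}" using closure_subset[of "{p. \<phi> p \<noteq> 0}"] by (rule contra_subsetD[rotated])
    then show "\<phi> p = 0" by (simp only: mem_Collect_eq not_not)
  qed
  have "continuous_on UNIV (dpart ws \<phi>)" for ws using sm by (auto simp: smooth2_def)
  from this[of "[]"] this[of "[False]"] 
  show c: "continuous_on UNIV \<phi>" "continuous_on UNIV (py \<phi>)" by simp_all
  show d: "((\<lambda>t. \<phi> (x, t)) has_vector_derivative py \<phi> (x, y)) (at y)" for x y
  proof -
    from sm have "\<forall>p. ((\<lambda>t. \<phi> (t, snd p)) has_vector_derivative px \<phi> p) (at (fst p)) \<and>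
          ((\<lambda>t. \<phi> (fst p, t)) has_vector_derivative py \<phi> p) (at (snd p))"
      unfolding smooth2_def by (elim allE[of _ "[]"], unfold dpart.simps, elim conjE)
    then show ?thesis by (elim allE[of _ "(x, y)"], unfold fst_conv snd_conv, elim conjE)
  qed
  show "p \<notin> \<Omega> \<Longrightarrow> \<phi> p = 0" using z[of p] C(2) by auto
  have z': "py \<phi> p = 0" if "p \<notin> C" for p
  proof -
    obtain x y where p: "p = (x, y)" by (cases p)
    have o: "open (Pair x -` (- C))"
      using compact_imp_closed[OF C(1)] by (intro continuous_open_vimage) (auto intro!: continuous_intros)
    have "((\<lambda>_. 0) has_vector_derivative 0) (at y)" by simp
    then have "((\<lambda>t. \<phi> (x, t)) has_vector_derivative 0) (at y)"
      by (rule has_vector_derivative_transform_within_open[OF _ o]) (use that p z in auto)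
    then show ?thesis using d vector_derivative_unique_at p by blast
  qed
  show "p \<notin> \<Omega> \<Longrightarrow> py \<phi> p = 0" using z'[of p] C(2) by auto
  have L: "C \<in> lmeasurable" using C by (simp add: lmeasurable_compact)
  have sq: "sqi g" if gg: "continuous_on UNIV g" "\<And>p. p \<notin> C \<Longrightarrow> g p = 0" for g
  proof -
    obtain B where "\<And>p. norm (g p) \<le> B * indicator C p"
      using continuous_compact_support_bounded[OF gg(1) C(1) gg(2)] by metis
    then show ?thesis
      using borel_imp_lebesgue_measurable borel_measurable_continuous_onI[OF gg(1)] 
      by (intro sqi_bounded_support[OF _ L]) (auto intro: measurable_completion)
  qed
  show "sqi \<phi>" using sq[OF c(1) z] .
  show "sqi (py \<phi>)" using sq[OF c(2) z'] .
qed

text \<open>Test functions on \<Omega> need not be confined to \<bar>y\<bar> < pi, since \<Omega>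
  may extend above and below. This factor cuts the vertical lines at the edges of the
  rectangle.\<close>

definition strip :: "real \<times> real \<Rightarrow> real" where "strip p = (if \<bar>snd p\<bar> < pi then 1 else 0)"

lemma strip_measurable [measurable]: "strip \<in> borel_measurable borel"
  unfolding strip_def[abs_def] by measurable

lemma smooth1_bounded_slab:
  assumes "smooth1 h" "smooth1 \<theta>" and supp: "\<And>x. \<bar>x\<bar> \<ge> a \<Longrightarrow> h x = 0" and a: "a > 0"
  obtains B where "B \<ge> 0" "\<And>p. \<bar>strip p * (h (fst p) * \<theta> (snd p))\<bar> \<le> B * indicator (slab a) p"
proof -
  have "bounded (h ` {-a..a})" "bounded (\<theta> ` {-pi..pi})"
    by (intro compact_imp_bounded compact_continuous_image smooth1_continuous assms compact_Icc)+
  then obtain H T where H: "\<forall>x\<in>{-a..a}. \<bar>h x\<bar> \<le> H" and T: "\<forall>y\<in>{-pi..pi}. \<bar>\<theta> y\<bar> \<le> T"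
    unfolding bounded_iff by auto
  have HT: "H \<ge> 0" "T \<ge> 0" using H[rule_format, of 0] T[rule_format, of 0] a by auto
  show ?thesis
  proof (rule that[of "H * T"])
    fix p :: "real \<times> real"
    show "\<bar>strip p * (h (fst p) * \<theta> (snd p))\<bar> \<le> H * T * indicator (slab a) p"
    proof (cases "\<bar>fst p\<bar> < a \<and> \<bar>snd p\<bar> < pi")
      case True
      have "\<bar>h (fst p)\<bar> * \<bar>\<theta> (snd p)\<bar> \<le> H * T"
        by (rule mult_mono) (use H T True HT in \<open>auto simp: abs_less_iff\<close>)
      then show ?thesis using True by (simp add: strip_def slab_iff abs_mult)
    next
      case False
      then show ?thesis using supp HT by (auto simp: strip_def not_less)
    qed
  qed (use HT in simp)
qed

context rect_weak
begin

text \<open>For \<bar>x\<bar> \<le> a the points (x, pi) and (x, -pi) are outside \<Omega>, so every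
  test function on \<Omega> vanishes there. Integration by parts on the vertical segments thus has
  no boundary terms although \<theta>1 may be nonzero at the ends. The H^1_0 approximation of u by
  test functions carries the identity over to U and Uy; this is where the Dirichlet condition
  enters.\<close>

lemma integral_strip_by_parts:
  assumes G: "smooth1 G" and supp: "\<And>x. \<bar>x\<bar> \<ge> a \<Longrightarrow> G x = 0"
    and \<theta>: "smooth1 \<theta>1" "\<And>y. (\<theta>1 has_real_derivative \<theta>2 y) (at y)"
  shows "(\<integral>p. U p * complex_of_real (strip p * (G (fst p) * \<theta>2 (snd p))) \<partial>lebesgue) =
    - (\<integral>p. Uy p * complex_of_real (strip p * (G (fst p) * \<theta>1 (snd p))) \<partial>lebesgue)"
proof -
  have \<theta>2: "smooth1 \<theta>2" using smooth1_deriv[OF \<theta>] .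
  note [measurable] = smooth1_measurable_fst_snd[OF G] smooth1_measurable_fst_snd[OF \<theta>(1)] smooth1_measurable_fst_snd[OF \<theta>2]
  let ?h = "\<lambda>\<theta> p. strip p * (G (fst p) * \<theta> (snd p))"
  obtain B1 where B1: "B1 \<ge> 0" "\<And>p. \<bar>?h \<theta>1 p\<bar> \<le> B1 * indicator (slab a) p"
    using smooth1_bounded_slab[OF G \<theta>(1) supp a] by metis
  obtain B2 where B2: "B2 \<ge> 0" "\<And>p. \<bar>?h \<theta>2 p\<bar> \<le> B2 * indicator (slab a) p"
    using smooth1_bounded_slab[OF G \<theta>2 supp a] by metis
  have sq: "sqi (\<lambda>p. complex_of_real (?h \<theta>1 p))" "sqi (\<lambda>p. complex_of_real (?h \<theta>2 p))"
    by (rule sqi_of_real_bounded[OF _ B1(2)], measurable) (rule sqi_of_real_bounded[OF _ B2(2)], measurable)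
  have test: "(\<integral>p. \<phi> p * complex_of_real (?h \<theta>2 p) \<partial>lebesgue) + (\<integral>p. py \<phi> p * complex_of_real (?h \<theta>1 p) \<partial>lebesgue) = 0"
    if \<phi>: "test_fun \<Omega> \<phi>" for \<phi> :: "real \<times> real \<Rightarrow> complex"
  proof -
    note tf = test_fun_facts[OF \<phi>]
    have [measurable]: "\<phi> \<in> borel_measurable borel" "py \<phi> \<in> borel_measurable borel"
      using tf(1,2) by (auto intro: borel_measurable_continuous_onI)
    let ?F = "\<lambda>p. \<phi> p * complex_of_real (?h \<theta>2 p) + py \<phi> p * complex_of_real (?h \<theta>1 p)"
    have "bounded (\<phi> ` slab a)" "bounded (py \<phi> ` slab a)"
      by (intro compact_imp_bounded compact_continuous_image continuous_on_subset[OF tf(1)] continuous_on_subset[OF tf(2)]; simp add: slab_def)+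
    then obtain M1 M2 where M: "\<forall>p\<in>slab a. norm (\<phi> p) \<le> M1" "\<forall>p\<in>slab a. norm (py \<phi> p) \<le> M2"
      unfolding bounded_iff by auto
    have F: "norm (?F p) \<le> (\<bar>M1\<bar> * B2 + \<bar>M2\<bar> * B1) * indicator (slab a) p" for p
    proof (cases "p \<in> slab a")
      case True
      have "norm (\<phi> p) \<le> \<bar>M1\<bar>" "norm (py \<phi> p) \<le> \<bar>M2\<bar>" "\<bar>?h \<theta>2 p\<bar> \<le> B2" "\<bar>?h \<theta>1 p\<bar> \<le> B1" 
        using M True B1(2)[of p] B2(2)[of p] by (auto intro: order_trans[OF _ abs_ge_self])
      then have "norm (\<phi> p) * \<bar>?h \<theta>2 p\<bar> \<le> \<bar>M1\<bar> * B2" "norm (py \<phi> p) * \<bar>?h \<theta>1 p\<bar> \<le> \<bar>M2\<bar> * B1"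
        by (auto intro!: mult_mono)
      then show ?thesis using True norm_triangle_ineq[of "\<phi> p * complex_of_real (?h \<theta>2 p)" "py \<phi> p * complex_of_real (?h \<theta>1 p)"]
        by (simp add: norm_mult del: of_real_mult)
    next
      case False
      then have "?h \<theta>1 p = 0" "?h \<theta>2 p = 0" using B1(2)[of p] B2(2)[of p] by simp_all
      then have "?F p = 0" by (simp only: of_real_0 mult_zero_right add_0)
      then show ?thesis using False by (simp only:) simp
    qed
    have inner: "(\<integral>y. ?F (x, y) \<partial>lborel) = 0" for x
    proof (cases "\<bar>x\<bar> \<le> a")
      case True
      have e: "\<phi> (x, pi) = 0" "\<phi> (x, - pi) = 0" using tf(5) edge[OF True] by auto
      let ?D = "\<lambda>y. \<phi> (x, y) * of_real (\<theta>2 y) + py \<phi> (x, y) * of_real (\<theta>1 y)"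
      have "(\<integral>y. ?F (x, y) \<partial>lborel) = (\<integral>y. of_real (G x) * (indicator {-pi..pi} y *\<^sub>R ?D y) \<partial>lborel)"
      proof (rule integral_cong_AE)
        \<comment> \<open>The strip cuts with an open interval and the fundamental theorem needs the
          closed one; they differ in two points.\<close>
        have "AE y in lborel. y \<noteq> pi" "AE y in lborel. y \<noteq> - pi" by (auto intro: AE_lborel_singleton)
        then show "AE y in lborel. ?F (x, y) = of_real (G x) * (indicator {-pi..pi} y *\<^sub>R ?D y)"
          by eventually_elim (auto simp: strip_def indicator_def algebra_simps abs_less_iff split: if_splits)
        have m: "f \<in> borel_measurable borel \<Longrightarrow> (\<lambda>y. f (x, y)) \<in> borel_measurable borel" for f :: "real \<times> real \<Rightarrow> complex"
          by (rule measurable_compose[of "\<lambda>y. (x, y)"]) (auto intro!: borel_measurable_continuous_onI continuous_intros)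
        have "?F \<in> borel_measurable borel" by measurable
        from m[OF this] show "(\<lambda>y. ?F (x, y)) \<in> borel_measurable lborel"
          unfolding measurable_cong_sets[OF sets_lborel refl] .
        have "(\<lambda>y. \<phi> (x, y)) \<in> borel_measurable borel" "(\<lambda>y. py \<phi> (x, y)) \<in> borel_measurable borel"
          by (rule m; measurable)+
        moreover have "\<theta>1 \<in> borel_measurable borel" "\<theta>2 \<in> borel_measurable borel"
          by (auto intro: smooth1_measurable \<theta>(1) \<theta>2)
        ultimately
        show "(\<lambda>y. of_real (G x) * (indicator {-pi..pi} y *\<^sub>R ?D y)) \<in> borel_measurable lborel"
          unfolding measurable_cong_sets[OF sets_lborel refl]
          by (intro borel_measurable_times borel_measurable_add borel_measurable_const borel_measurable_scaleR borel_measurable_indicator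
              borel_measurable_of_real) auto
      qed
      also have "\<dots> = of_real (G x) * (\<integral>y. indicator {-pi..pi} y *\<^sub>R ?D y \<partial>lborel)" by (rule integral_mult_right_zero)
      also have "(\<integral>y. indicator {-pi..pi} y *\<^sub>R ?D y \<partial>lborel) = \<phi> (x, pi) * of_real (\<theta>1 pi) - \<phi> (x, - pi) * of_real (\<theta>1 (- pi))"
      proof (rule integral_FTC_Icc)
        fix y
        have "((\<lambda>y. complex_of_real (\<theta>1 y)) has_vector_derivative of_real (\<theta>2 y)) (at y)"
          using \<theta>(2)[of y] by (intro has_vector_derivative_of_real) (simp add: has_real_derivative_iff_has_vector_derivative)
        from has_vector_derivative_mult[OF tf(6) this]
        show "((\<lambda>y. \<phi> (x, y) * of_real (\<theta>1 y)) has_vector_derivative ?D y) (at y within {-pi..pi})"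
          by (rule has_vector_derivative_at_within)
      next
        have "continuous_on {-pi..pi} (\<lambda>y. f (x, y))" if "continuous_on UNIV f" for f :: "real \<times> real \<Rightarrow> complex"
          by (rule continuous_on_compose2[OF that]) (auto intro!: continuous_intros)
        then show "continuous_on {-pi..pi} ?D"
          using tf(1,2) \<theta> \<theta>2 by (intro continuous_intros smooth1_continuous) auto
      qed simp
      finally show ?thesis using e by simp
    next
      case False
      then show ?thesis using supp[of x] by simp
    qed
    have "(\<integral>p. ?F p \<partial>lebesgue) = (\<integral>x. (\<integral>y. ?F (x, y) \<partial>lborel) \<partial>lborel)"
      by (rule lebesgue_Fubini[OF _ slab_lmeasurable F]) measurable
    also have "\<dots> = 0" unfolding inner by simp
    finally show ?thesis
      using sqi_integrable_mult[OF tf(3) sq(2)] sqi_integrable_mult[OF tf(4) sq(1)] by simp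
  qed
  obtain \<phi>s where \<phi>s: "\<And>n. test_fun \<Omega> (\<phi>s n)" 
     "(\<lambda>n. nrm (\<lambda>p. \<phi>s n p - U p)) \<longlonglongrightarrow> 0" "(\<lambda>n. nrm (\<lambda>p. py (\<phi>s n) p - Uy p)) \<longlonglongrightarrow> 0"
    using h10 by blast
  have "(\<lambda>n. (\<integral>p. \<phi>s n p * complex_of_real (?h \<theta>2 p) \<partial>lebesgue) + (\<integral>p. py (\<phi>s n) p * complex_of_real (?h \<theta>1 p) \<partial>lebesgue))
     \<longlonglongrightarrow> (\<integral>p. U p * complex_of_real (?h \<theta>2 p) \<partial>lebesgue) + (\<integral>p. Uy p * complex_of_real (?h \<theta>1 p) \<partial>lebesgue)"
    by (intro tendsto_add nrm_tendsto_integral \<phi>s sqi sq test_fun_facts[OF \<phi>s(1)])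
  then have "(\<integral>p. U p * complex_of_real (?h \<theta>2 p) \<partial>lebesgue) + (\<integral>p. Uy p * complex_of_real (?h \<theta>1 p) \<partial>lebesgue) = 0"
    unfolding test[OF \<phi>s(1)] using LIMSEQ_unique tendsto_const by blast
  then show ?thesis by (simp add: add_eq_0_iff2)
qed

text \<open>Both y-derivatives are first moved onto the test function and one is then moved back
  onto U. The formula with a single derivative of \<theta> survives when the plateau inside \<theta>
  becomes steep; second derivatives of the plateau would not be controlled.\<close>

lemma integral_rect_yy_compact:
  assumes G: "smooth1 G" and \<epsilon>: "\<epsilon> > 0" and suppG: "\<And>x. \<bar>x\<bar> \<ge> a - \<epsilon> \<Longrightarrow> G x = 0"
    and \<theta>: "smooth1 \<theta>" "\<And>y. (\<theta> has_real_derivative \<theta>1 y) (at y)" "\<And>y. (\<theta>1 has_real_derivative \<theta>2 y) (at y)"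
    and supp: "\<And>y. \<bar>y\<bar> \<ge> pi - \<epsilon> \<Longrightarrow> \<theta> y = 0" and supp2: "\<And>y. \<bar>y\<bar> \<ge> pi \<Longrightarrow> \<theta>2 y = 0"
  shows "(\<integral>p. Uyy p * complex_of_real (strip p * (G (fst p) * \<theta> (snd p))) \<partial>lebesgue) = 
    - (\<integral>p. Uy p * complex_of_real (strip p * (G (fst p) * \<theta>1 (snd p))) \<partial>lebesgue)"
proof -
  let ?\<Phi> = "\<lambda>p. G (fst p) * \<theta> (snd p)"
  let ?C = "cbox (- (a - \<epsilon>), - (pi - \<epsilon>)) (a - \<epsilon>, pi - \<epsilon>)"
  have \<theta>1: "smooth1 \<theta>1" using smooth1_deriv[OF \<theta>(1,2)] .
  have "(\<lambda>p. G (fst p) * \<theta> (snd p) * ((\<lambda>_. 1) (0 * 0))) \<in> mono2"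
    using mono2_base[OF G \<theta>(1) smooth1_const[of 1] smooth1_const[of 0] smooth1_const[of 0]] by simp
  then have sm: "smooth2 ?\<Phi>" using mono2_smooth2 by simp
  have test: "test_fun \<Omega> ?\<Phi>"
  proof (rule test_funI[OF sm, of ?C])
    show "p \<in> ?C" if "?\<Phi> p \<noteq> 0" for p
    proof -
      have "\<not> \<bar>fst p\<bar> \<ge> a - \<epsilon>" "\<not> \<bar>snd p\<bar> \<ge> pi - \<epsilon>" using that suppG[of "fst p"] supp[of "snd p"] by force+
      then show ?thesis by (cases p) (auto simp: cbox_Pair_eq abs_less_iff not_le)
    qed
    show "?C \<subseteq> \<Omega>"
    proof
      fix p assume "p \<in> ?C"
      then have p: "\<bar>snd p\<bar> < pi" "\<bar>fst p\<bar> < a" using \<epsilon> by (cases p; auto simp: cbox_Pair_eq abs_less_iff)+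
      have "K * sqrt (cos (snd p / 2)) > 0" using cos_half_pos[OF p(1)] K by simp
      then show "p \<in> \<Omega>" using cusp[of "snd p" "fst p"] p by simp
    qed
  qed simp
  have py1: "py ?\<Phi> = (\<lambda>p. G (fst p) * \<theta>1 (snd p))"
  proof (rule py_eqI)
    fix p :: "real \<times> real"
    show "((\<lambda>t. G (fst (fst p, t)) * \<theta> (snd (fst p, t))) has_vector_derivative G (fst p) * \<theta>1 (snd p)) (at (snd p))"
      using DERIV_cmult[OF \<theta>(2)] by (simp add: has_real_derivative_iff_has_vector_derivative[symmetric])
  qed
  have py2: "py (\<lambda>p. G (fst p) * \<theta>1 (snd p)) = (\<lambda>p. G (fst p) * \<theta>2 (snd p))"
  proof (rule py_eqI)
    fix p :: "real \<times> real"
    show "((\<lambda>t. G (fst (fst p, t)) * \<theta>1 (snd (fst p, t))) has_vector_derivative G (fst p) * \<theta>2 (snd p)) (at (snd p))"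
      using DERIV_cmult[OF \<theta>(3)] by (simp add: has_real_derivative_iff_has_vector_derivative[symmetric])
  qed
  have s: "strip p * ?\<Phi> p = ?\<Phi> p" for p using supp[of "snd p"] \<epsilon> by (auto simp: strip_def)
  have s2: "strip p * (G (fst p) * \<theta>2 (snd p)) = G (fst p) * \<theta>2 (snd p)" for p using supp2[of "snd p"] by (auto simp: strip_def)
  have "(\<integral>p. Uyy p * complex_of_real (strip p * (G (fst p) * \<theta> (snd p))) \<partial>lebesgue) = (\<integral>p. Uyy p * complex_of_real (?\<Phi> p) \<partial>lebesgue)"
    by (simp only: s)
  also have "\<dots> = (\<integral>p. U p * complex_of_real (py (py ?\<Phi>) p) \<partial>lebesgue)" using wyy[OF test] by simp
  also have "\<dots> = (\<integral>p. U p * complex_of_real (strip p * (G (fst p) * \<theta>2 (snd p))) \<partial>lebesgue)" unfolding py1 py2 s2 ..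
  also have "\<dots> = - (\<integral>p. Uy p * complex_of_real (strip p * (G (fst p) * \<theta>1 (snd p))) \<partial>lebesgue)"
    by (rule integral_strip_by_parts[OF G _ \<theta>1 \<theta>(3)]) (use suppG \<epsilon> in auto)
  finally show ?thesis .
qed

end

lemma DERIV_zero_outside:
  assumes f: "\<And>y. (f has_real_derivative f' y) (at y)" and z: "\<And>y. \<bar>y\<bar> > c \<Longrightarrow> f y = 0" and y: "\<bar>y\<bar> > c"
  shows "f' y = 0"
proof -
  have o: "open {z::real. \<bar>z\<bar> > c}" by (intro open_Collect_less continuous_intros)
  have "((\<lambda>_. 0) has_real_derivative 0) (at y)" by simp
  then have "(f has_real_derivative 0) (at y)"
    by (rule has_field_derivative_transform_within_open[OF _ o]) (use y z in auto)
  then show ?thesis using f DERIV_unique by blast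
qed

lemma DERIV_plateau:
  "(plateau b n has_real_derivative
     real n * (cutoff' (real n * (b - y)) * ustep (real n * (y + b)) - cutoff' (real n * (y + b)) * ustep (real n * (b - y)))) (at y)"
proof -
  have u: "(ustep has_real_derivative - cutoff' x) (at x)" for x
    using DERIV_diff[OF DERIV_const[of 1] DERIV_cutoff[of x]] by (simp add: cutoff_def[abs_def])
  have "((\<lambda>y. real n * (y + b)) has_real_derivative real n) (at y)" "((\<lambda>y. real n * (b - y)) has_real_derivative - real n) (at y)"
    by (auto intro!: derivative_eq_intros)
  from DERIV_mult[OF DERIV_chain2[OF u this(1)] DERIV_chain2[OF u this(2)]]
  show ?thesis unfolding plateau_def[abs_def] by (simp add: algebra_simps)
qed

definition rect_ind :: "real \<Rightarrow> real \<times> real \<Rightarrow> real" where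
  "rect_ind a p = (if \<bar>fst p\<bar> < a \<and> \<bar>snd p\<bar> < pi then 1 else 0)"

lemma rect_ind_measurable [measurable]: "rect_ind a \<in> borel_measurable borel"
  unfolding rect_ind_def[abs_def] by measurable

definition sn' :: "nat \<Rightarrow> real \<Rightarrow> real" where "sn' k y = real k / 2 * cos (real k * ((y + pi) / 2))"

lemma DERIV_sn: "(sn k has_real_derivative sn' k y) (at y)"
  and DERIV_sn': "(sn' k has_real_derivative - ((real k)\<^sup>2 / 4) * sn k y) (at y)"
  unfolding sn_def[abs_def] sn'_def[abs_def]
  by (auto intro!: derivative_eq_intros simp: power2_eq_square)

lemma smooth1_sn': "smooth1 (sn' k)"
  using smooth1_deriv[OF smooth1_sn DERIV_sn] .

context rect_weak
begin

text \<open>Removes the plateau in x, which kept the test functions away from the vertical sides,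
  together with the cutoff hidden in \<psi>. Plateaus are eventually equal to 1 at each interior
  point, so eventual equality is the convenient form of convergence.\<close>

lemma tendsto_rect:
  assumes V: "sqi V" and G: "smooth1 G" and m: "\<And>n. \<psi> n \<in> borel_measurable borel"
    and bd: "\<And>n y. \<bar>y\<bar> < pi \<Longrightarrow> \<bar>\<psi> n y\<bar> \<le> T"
    and ev: "\<And>y. \<bar>y\<bar> < pi \<Longrightarrow> \<forall>\<^sub>F n in sequentially. \<psi> n y = \<psi>' y"
  shows "(\<lambda>n. \<integral>p. V p * complex_of_real (strip p * ((G (fst p) * plateau a (Suc n) (fst p)) * \<psi> n (snd p))) \<partial>lebesgue)
    \<longlonglongrightarrow> (\<integral>p. V p * complex_of_real (rect_ind a p * (G (fst p) * \<psi>' (snd p))) \<partial>lebesgue)"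
proof -
  have "bounded (G ` {-a..a})"
    by (intro compact_imp_bounded compact_continuous_image smooth1_continuous assms compact_Icc)
  then obtain H where "\<forall>x\<in>{-a..a}. \<bar>G x\<bar> \<le> H" unfolding bounded_iff by auto
  then have H: "\<bar>G x\<bar> \<le> H" if "\<bar>x\<bar> < a" for x using that by (auto simp: abs_less_iff)
  have HT: "H \<ge> 0" "T \<ge> 0" using H[of 0] bd[of 0] a pi_gt_zero by force+
  have X0: "plateau a (Suc n) x = 0" if "\<not> \<bar>x\<bar> < a" for n x
  proof (rule plateau_eq_0)
    have "1 / real (Suc n) > 0" by simp
    then show "\<bar>x\<bar> \<ge> a - 1 / real (Suc n)" using that by linarith
  qed simp
  show ?thesis
  proof (rule sqi_dominated_convergence_real[OF V])
    note [measurable] = smooth1_measurable_fst_snd(1)[OF G] smooth1_measurable_fst_snd(1)[OF smooth1_plateau] m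
    show "(\<lambda>p. strip p * ((G (fst p) * plateau a (Suc n) (fst p)) * \<psi> n (snd p))) \<in> borel_measurable borel" for n
      by measurable
    show "\<bar>strip p * ((G (fst p) * plateau a (Suc n) (fst p)) * \<psi> n (snd p))\<bar> \<le> H * T * indicator (slab a) p" for n p
    proof (cases "\<bar>fst p\<bar> < a \<and> \<bar>snd p\<bar> < pi")
      case True
      have "\<bar>G (fst p)\<bar> * \<bar>plateau a (Suc n) (fst p)\<bar> \<le> H * 1"
        by (rule mult_mono) (use H True HT plateau_nonneg[of a "Suc n" "fst p"] plateau_le_1[of a "Suc n" "fst p"] in auto)
      then have "(\<bar>G (fst p)\<bar> * \<bar>plateau a (Suc n) (fst p)\<bar>) * \<bar>\<psi> n (snd p)\<bar> \<le> H * T"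
        using mult_mono[of "\<bar>G (fst p)\<bar> * \<bar>plateau a (Suc n) (fst p)\<bar>" H "\<bar>\<psi> n (snd p)\<bar>" T] bd[of "snd p" n] True HT by auto
      then show ?thesis using True by (simp add: strip_def slab_iff abs_mult)
    next
      case False
      then show ?thesis using X0[of "fst p" n] HT by (auto simp: strip_def)
    qed
    show "(\<lambda>n. strip p * ((G (fst p) * plateau a (Suc n) (fst p)) * \<psi> n (snd p))) \<longlonglongrightarrow> rect_ind a p * (G (fst p) * \<psi>' (snd p))" for p
    proof (cases "\<bar>fst p\<bar> < a \<and> \<bar>snd p\<bar> < pi")
      case True
      have "\<forall>\<^sub>F n in sequentially. strip p * ((G (fst p) * plateau a (Suc n) (fst p)) * \<psi> n (snd p)) = rect_ind a p * (G (fst p) * \<psi>' (snd p))"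
        using eventually_plateau_eq_1[OF conjunct1[OF True]] ev[OF conjunct2[OF True]]
        by eventually_elim (use True in \<open>simp add: strip_def rect_ind_def\<close>)
      then show ?thesis by (rule tendsto_eventually)
    next
      case False
      then have z: "strip p * ((G (fst p) * plateau a (Suc n) (fst p)) * \<psi> n (snd p)) = 0" for n
        using X0[of "fst p" n] by (auto simp: strip_def)
      moreover have "rect_ind a p = 0" using False by (auto simp: rect_ind_def)
      ultimately show ?thesis unfolding z by simp
    qed
  qed
qed

text \<open>The two integrations by parts have different reasons. The first is a limit of compactly
  supported functions: the derivative of the plateau is of size n, but it lives within 2/n of the
  edges, where the sine is at most k/n, and it disappears in the limit. The second has the cosine as
  test function, which does not vanish at the edges for k > 0, and uses the vanishing of u
  there.\<close>

lemma integral_rect_sn: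
  assumes G: "smooth1 G"
  shows "(\<integral>p. Uyy p * complex_of_real (rect_ind a p * (G (fst p) * sn k (snd p))) \<partial>lebesgue) =
    - of_real ((real k)\<^sup>2 / 4) * (\<integral>p. U p * complex_of_real (rect_ind a p * (G (fst p) * sn k (snd p))) \<partial>lebesgue)"
proof -
  define m where "m n = plateau pi (Suc n)" for n
  define m' where "m' n y = real (Suc n) * (cutoff' (real (Suc n) * (pi - y)) * ustep (real (Suc n) * (y + pi)) - 
      cutoff' (real (Suc n) * (y + pi)) * ustep (real (Suc n) * (pi - y)))" for n y
  define X where "X n x = G x * plateau a (Suc n) x" for n x
  have m: "smooth1 (m n)" "(m n has_real_derivative m' n y) (at y)" for n y
    unfolding m_def m'_def by (rule smooth1_plateau DERIV_plateau)+
  have X: "smooth1 (X n)" for n unfolding X_def by (intro smooth1_mult G smooth1_plateau)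
  have X0: "X n x = 0" if "\<bar>x\<bar> \<ge> a - 1 / real (Suc n)" for n x
    using plateau_eq_0[of "Suc n" a x] that by (simp add: X_def)
  have X0': "X n x = 0" if "\<bar>x\<bar> \<ge> a" for n x
  proof (rule X0)
    have "1 / real (Suc n) > 0" by simp
    then show "\<bar>x\<bar> \<ge> a - 1 / real (Suc n)" using that by linarith
  qed
  define \<theta> where "\<theta> n y = sn k y * m n y" for n y
  define \<theta>' where "\<theta>' n y = sn' k y * m n y + m' n y * sn k y" for n y
  have \<theta>: "smooth1 (\<theta> n)" "(\<theta> n has_real_derivative \<theta>' n y) (at y)" for n y
    unfolding \<theta>_def \<theta>'_def by (intro smooth1_mult smooth1_sn m) (rule DERIV_mult[OF DERIV_sn m(2)])
  have \<theta>': "smooth1 (\<theta>' n)" for n using smooth1_deriv[OF \<theta>] .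
  have \<theta>0: "\<theta> n y = 0" if "\<bar>y\<bar> \<ge> pi - 1 / real (Suc n)" for n y
    using plateau_eq_0[of "Suc n" pi y] that by (simp add: \<theta>_def m_def)
  obtain M where M: "M > 0" "\<And>t. \<bar>cutoff' t\<bar> \<le> M" using cutoff_deriv_bounds by metis
  have m'0: "m' n y = 0" if "\<bar>y\<bar> \<le> pi - 2 / real (Suc n)" for n y
  proof -
    have "real (Suc n) * (pi - y) \<ge> real (Suc n) * (2 / real (Suc n))" "real (Suc n) * (y + pi) \<ge> real (Suc n) * (2 / real (Suc n))"
      using that by (intro mult_left_mono; linarith)+
    then show ?thesis by (simp add: m'_def cutoff'_eq_0 del: of_nat_Suc)
  qed
  have m'b: "\<bar>m' n y\<bar> \<le> real (Suc n) * (2 * M)" for n y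
  proof -
    have *: "\<bar>cutoff' s * ustep t\<bar> \<le> M" for s t
      using mult_mono[OF M(2)[of s], of "\<bar>ustep t\<bar>" 1] ustep_nonneg[of t] ustep_le_1[of t] M(1) by (simp add: abs_mult)
    show ?thesis unfolding m'_def abs_mult
      by (intro mult_mono) (use *[of "real (Suc n) * (pi - y)" "real (Suc n) * (y + pi)"]
          *[of "real (Suc n) * (y + pi)" "real (Suc n) * (pi - y)"] in auto)
  qed
  have \<theta>'b: "\<bar>\<theta>' n y\<bar> \<le> real k / 2 + 2 * M * real k" if y: "\<bar>y\<bar> < pi" for n y
  proof -
    have "\<bar>sn' k y\<bar> \<le> real k / 2 * 1" unfolding sn'_def abs_mult by (intro mult_mono) auto
    then have "\<bar>sn' k y * m n y\<bar> \<le> real k / 2 * 1" unfolding abs_mult m_def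
      by (intro mult_mono) (use plateau_nonneg[of pi "Suc n" y] plateau_le_1[of pi "Suc n" y] in auto)
    moreover have "\<bar>m' n y * sn k y\<bar> \<le> 2 * M * real k"
    proof (cases "\<bar>y\<bar> \<le> pi - 2 / real (Suc n)")
      case True
      then show ?thesis using m'0 M(1) by simp
    next
      case False
      \<comment> \<open>Here pi - \<bar>y\<bar> < 2 / (n + 1), and cos (y/2) is at most half of that
        distance; the resulting 1 / (n + 1) balances the slope of the plateau.\<close>
      have "\<bar>sn k y\<bar> \<le> real k * cos (y/2)" using sn_bound[OF y] .
      also have "\<dots> \<le> real k * (1 / real (Suc n))"
        using cos_half_le[of y] y False by (intro mult_left_mono) auto
      finally have "\<bar>m' n y\<bar> * \<bar>sn k y\<bar> \<le> (real (Suc n) * (2 * M)) * (real k * (1 / real (Suc n)))"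
        using m'b[of n y] M(1) by (intro mult_mono) auto
      also have "\<dots> = 2 * M * real k" by simp
      finally show ?thesis by (simp add: abs_mult)
    qed
    ultimately show ?thesis unfolding \<theta>'_def using abs_triangle_ineq[of "sn' k y * m n y" "m' n y * sn k y"] by linarith
  qed
  have ev: "\<forall>\<^sub>F n in sequentially. m n y = 1 \<and> m' n y = 0" if "\<bar>y\<bar> < pi" for y
  proof -
    have "(\<lambda>n. 2 * inverse (real (Suc n))) \<longlonglongrightarrow> 2 * 0"
      by (intro tendsto_intros LIMSEQ_inverse_real_of_nat)
    then have "\<forall>\<^sub>F n in sequentially. 2 * inverse (real (Suc n)) < pi - \<bar>y\<bar>"
      by (rule order_tendstoD) (use that in simp)
    then show ?thesis
    proof eventually_elim
      case (elim n)
      then have "\<bar>y\<bar> \<le> pi - 2 / real (Suc n)" by (simp add: divide_inverse)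
      then show ?case using m'0 plateau_eq_1[of "Suc n" y pi] by (simp add: m_def)
    qed
  qed
  have compact_case: "(\<integral>p. Uyy p * complex_of_real (strip p * (X n (fst p) * \<theta> n (snd p))) \<partial>lebesgue) = 
    - (\<integral>p. Uy p * complex_of_real (strip p * (X n (fst p) * \<theta>' n (snd p))) \<partial>lebesgue)" for n
  proof -
    obtain \<theta>'' where \<theta>'': "\<And>y. (\<theta>' n has_real_derivative \<theta>'' y) (at y)" using smooth1_derivE[OF \<theta>'] by metis
    have z1: "\<theta>' n y = 0" if "\<bar>y\<bar> > pi - 1 / real (Suc n)" for y
      by (rule DERIV_zero_outside[OF \<theta>(2) _ that]) (simp add: \<theta>0)
    have z2: "\<theta>'' y = 0" if "\<bar>y\<bar> \<ge> pi" for y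
    proof (rule DERIV_zero_outside[OF \<theta>'' z1])
      have "1 / real (Suc n) > 0" by simp
      then show "pi - 1 / real (Suc n) < \<bar>y\<bar>" using that by linarith
    qed
    have pos: "1 / real (Suc n) > 0" by simp
    show ?thesis by (rule integral_rect_yy_compact[OF X pos X0 \<theta> \<theta>'' \<theta>0 z2])
  qed
  have by_parts: "(\<integral>p. U p * complex_of_real (strip p * (X n (fst p) * (- ((real k)\<^sup>2 / 4) * sn k (snd p)))) \<partial>lebesgue) = 
    - (\<integral>p. Uy p * complex_of_real (strip p * (X n (fst p) * sn' k (snd p))) \<partial>lebesgue)" for n
    by (rule integral_strip_by_parts[OF X X0' smooth1_sn' DERIV_sn'])
  have b1: "\<bar>\<theta> n y\<bar> \<le> real k" if "\<bar>y\<bar> < pi" for n y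
  proof -
    have "\<bar>sn k y\<bar> \<le> real k * 1" using sn_bound[OF that, of k] by (rule order_trans) (intro mult_left_mono, auto)
    then have "\<bar>\<theta> n y\<bar> \<le> real k * 1 * 1" unfolding \<theta>_def m_def abs_mult
      by (intro mult_mono) (use plateau_nonneg[of pi "Suc n" y] plateau_le_1[of pi "Suc n" y] in auto)
    then show ?thesis by simp
  qed
  have b2: "\<bar>sn' k y\<bar> \<le> real k / 2" for y
    unfolding sn'_def abs_mult using mult_left_mono[OF abs_cos_le_one, of "real k / 2"] by simp
  have b3: "\<bar>- ((real k)\<^sup>2 / 4) * sn k y\<bar> \<le> (real k)\<^sup>2 / 4" for y
    unfolding sn_def abs_mult using mult_left_mono[OF abs_sin_le_one, of "(real k)\<^sup>2 / 4"] by simp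
  have l1: "(\<lambda>n. \<integral>p. Uyy p * complex_of_real (strip p * (X n (fst p) * \<theta> n (snd p))) \<partial>lebesgue)
    \<longlonglongrightarrow> (\<integral>p. Uyy p * complex_of_real (rect_ind a p * (G (fst p) * sn k (snd p))) \<partial>lebesgue)"
    unfolding X_def by (rule tendsto_rect[OF sqi(5) G smooth1_measurable[OF \<theta>(1)] b1])
      (assumption, rule eventually_mono[OF ev], auto simp: \<theta>_def)
  have l2: "(\<lambda>n. \<integral>p. Uy p * complex_of_real (strip p * (X n (fst p) * \<theta>' n (snd p))) \<partial>lebesgue)
    \<longlonglongrightarrow> (\<integral>p. Uy p * complex_of_real (rect_ind a p * (G (fst p) * sn' k (snd p))) \<partial>lebesgue)"
    unfolding X_def by (rule tendsto_rect[OF sqi(4) G smooth1_measurable[OF \<theta>'] \<theta>'b])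
      (assumption, rule eventually_mono[OF ev], auto simp: \<theta>'_def)
  have l3: "(\<lambda>n. \<integral>p. Uy p * complex_of_real (strip p * (X n (fst p) * sn' k (snd p))) \<partial>lebesgue)
    \<longlonglongrightarrow> (\<integral>p. Uy p * complex_of_real (rect_ind a p * (G (fst p) * sn' k (snd p))) \<partial>lebesgue)"
    unfolding X_def by (rule tendsto_rect[OF sqi(4) G smooth1_measurable[OF smooth1_sn'] b2]) auto
  have l4: "(\<lambda>n. \<integral>p. U p * complex_of_real (strip p * (X n (fst p) * (- ((real k)\<^sup>2 / 4) * sn k (snd p)))) \<partial>lebesgue)
    \<longlonglongrightarrow> (\<integral>p. U p * complex_of_real (rect_ind a p * (G (fst p) * (- ((real k)\<^sup>2 / 4) * sn k (snd p)))) \<partial>lebesgue)"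
    unfolding X_def 
    by (rule tendsto_rect[OF sqi(1) G smooth1_measurable[OF smooth1_mult[OF smooth1_const smooth1_sn]] b3]) auto
  have "(\<integral>p. Uyy p * complex_of_real (rect_ind a p * (G (fst p) * sn k (snd p))) \<partial>lebesgue) =
     - (\<integral>p. Uy p * complex_of_real (rect_ind a p * (G (fst p) * sn' k (snd p))) \<partial>lebesgue)"
    using LIMSEQ_unique[OF l1[unfolded compact_case] tendsto_minus[OF l2]] .
  also have "\<dots> = (\<integral>p. U p * complex_of_real (rect_ind a p * (G (fst p) * (- ((real k)\<^sup>2 / 4) * sn k (snd p)))) \<partial>lebesgue)"
    using LIMSEQ_unique[OF l4[unfolded by_parts] tendsto_minus[OF l3]] by simp
  also have "\<dots> = (\<integral>p. (- of_real ((real k)\<^sup>2 / 4)) * (U p * complex_of_real (rect_ind a p * (G (fst p) * sn k (snd p)))) \<partial>lebesgue)"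
    by (intro Bochner_Integration.integral_cong) (simp_all add: algebra_simps)
  also have "\<dots> = - of_real ((real k)\<^sup>2 / 4) * (\<integral>p. U p * complex_of_real (rect_ind a p * (G (fst p) * sn k (snd p))) \<partial>lebesgue)"
    by (rule integral_mult_right_zero)
  finally show ?thesis .
qed

end

section \<open>Trigonometric sums as test functions\<close>

definition mode :: "real \<Rightarrow> nat \<Rightarrow> real \<times> real \<Rightarrow> complex" where
  "mode \<xi> k p = exp (complex_of_real (fst p) * (1 + \<i> * of_real \<xi>)) * of_real (sn k (snd p))"

lemma smooth1_exp_cos: "smooth1 (\<lambda>x. exp x * cos (\<xi> * x))" and smooth1_exp_sin: "smooth1 (\<lambda>x. exp x * sin (\<xi> * x))"
  using smooth1_compose[OF smooth1_cos smooth1_linear[of \<xi> 0]] smooth1_compose[OF smooth1_sin smooth1_linear[of \<xi> 0]]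
  by (auto intro!: smooth1_mult smooth1_exp)

lemma mode_Re_Im: "mode \<xi> k p = of_real (exp (fst p) * cos (\<xi> * fst p) * sn k (snd p)) + \<i> * of_real (exp (fst p) * sin (\<xi> * fst p) * sn k (snd p))"
proof -
  have "exp (complex_of_real (fst p) * (1 + \<i> * of_real \<xi>)) = exp (of_real (fst p)) * cis (\<xi> * fst p)"
    by (simp add: exp_add[symmetric] cis_conv_exp algebra_simps)
  then show ?thesis by (simp add: mode_def exp_of_real complex_eq_iff)
qed

definition trig :: "(real \<times> nat) set \<Rightarrow> (real \<times> nat \<Rightarrow> complex) \<Rightarrow> real \<times> real \<Rightarrow> complex" where
  "trig A b p = (\<Sum>j\<in>A. b j * mode (fst j) (snd j) p)"

lemma sqi_sum: "finite A \<Longrightarrow> (\<And>j. j \<in> A \<Longrightarrow> sqi (f j)) \<Longrightarrow> sqi (\<lambda>p. \<Sum>j\<in>A. f j p)"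
  by (induction A rule: finite_induct) (auto intro: sqi_add sqi_cmult[of "\<lambda>_. 0" 0] simp: sqi_def[of "\<lambda>_. 0"])

context rect_weak
begin

abbreviation pairing :: "(real \<times> real \<Rightarrow> complex) \<Rightarrow> (real \<times> real \<Rightarrow> real) \<Rightarrow> (real \<times> real \<Rightarrow> complex) \<Rightarrow> complex" where
  "pairing V c Q \<equiv> \<integral>p. V p * (complex_of_real (c p) * Q p) \<partial>lebesgue"

definition wing :: "real \<times> real \<Rightarrow> real" where "wing p = chi K a p - rect_ind a p"

lemma chi_rect: "rect_ind a p * chi K a p = rect_ind a p"
  using chi_middle(1)[OF K(1), of "fst p" a "snd p"] by (cases p) (auto simp: rect_ind_def)

lemma sqi_weight_real:
  assumes h: "smooth1 h" and c: "c \<in> {chi K a, chi_x K a, chi_xx K a, rect_ind a}"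
  shows "sqi (\<lambda>p. complex_of_real (h (fst p) * sn k (snd p) * c p))"
proof -
  obtain B where B: "\<And>p t. \<bar>t\<bar> \<le> real k * cos (snd p / 2) \<Longrightarrow> \<bar>h (fst p) * t * chi K a p\<bar> \<le> B * indicator (slab a) p"
      "\<And>p t. \<bar>t\<bar> \<le> real k * cos (snd p / 2) \<Longrightarrow> \<bar>h (fst p) * t * chi_x K a p\<bar> \<le> B * indicator (slab a) p"
      "\<And>p t. \<bar>t\<bar> \<le> real k * cos (snd p / 2) \<Longrightarrow> \<bar>h (fst p) * t * chi_xx K a p\<bar> \<le> B * indicator (slab a) p"
    using chi_dominated[OF K a h of_nat_0_le_iff] by blast
  have B0: "B * indicator (slab a) p \<ge> 0" for p :: "real \<times> real"
    using B(1)[of 0 "(0,0)"] a by (auto simp: indicator_def slab_iff)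
  have s: "\<bar>sn k (snd p)\<bar> \<le> real k * cos (snd p / 2)" "\<bar>sn k (snd p) * rect_ind a p\<bar> \<le> real k * cos (snd p / 2)" if "\<bar>snd p\<bar> < pi" for p :: "real \<times> real"
    using sn_bound[OF that, of k] by (auto simp: rect_ind_def)
  have bd: "\<bar>h (fst p) * sn k (snd p) * c p\<bar> \<le> B * indicator (slab a) p" for p
  proof (cases "\<bar>snd p\<bar> < pi")
    case True
    have "h (fst p) * sn k (snd p) * rect_ind a p = h (fst p) * (sn k (snd p) * rect_ind a p) * chi K a p"
      using chi_rect[of p] by (simp add: mult.assoc)
    then show ?thesis using c B(1)[OF s(1)[OF True]] B(2)[OF s(1)[OF True]] B(3)[OF s(1)[OF True]] B(1)[OF s(2)[OF True]] by auto
  next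
    case False
    then have "c p = 0" using c by (auto simp: chi_def chi_x_def chi_xx_def rect_ind_def)
    then show ?thesis using B0 by simp
  qed
  have [measurable]: "c \<in> borel_measurable borel" using c borel_measurable_chi rect_ind_measurable by auto
  note [measurable] = smooth1_measurable_fst_snd(1)[OF h] smooth1_measurable_fst_snd(2)[OF smooth1_sn]
  show ?thesis by (rule sqi_of_real_bounded[OF _ bd]) measurable
qed

lemma sqi_weight_mode:
  assumes c: "c \<in> {chi K a, chi_x K a, chi_xx K a, rect_ind a, wing}"
  shows "sqi (\<lambda>p. complex_of_real (c p) * mode \<xi> k p)"
proof -
  have *: "sqi (\<lambda>p. complex_of_real (c p) * mode \<xi> k p)" if "c \<in> {chi K a, chi_x K a, chi_xx K a, rect_ind a}" for c
    using sqi_add[OF sqi_weight_real[OF smooth1_exp_cos[of \<xi>] that, of k] sqi_cmult[OF sqi_weight_real[OF smooth1_exp_sin[of \<xi>] that, of k], of \<i>]]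
    by (simp add: mode_Re_Im algebra_simps)
  show ?thesis using c *[of c] sqi_diff[OF *[of "chi K a"] *[of "rect_ind a"]] by (auto simp: wing_def[abs_def] algebra_simps)
qed

lemma pairing_mode:
  assumes V: "sqi V" and c: "c \<in> {chi K a, chi_x K a, chi_xx K a, rect_ind a}"
  shows "pairing V c (mode \<xi> k) = (\<integral>p. V p * complex_of_real (exp (fst p) * cos (\<xi> * fst p) * sn k (snd p) * c p) \<partial>lebesgue) +
    \<i> * (\<integral>p. V p * complex_of_real (exp (fst p) * sin (\<xi> * fst p) * sn k (snd p) * c p) \<partial>lebesgue)"
proof -
  have "pairing V c (mode \<xi> k) = (\<integral>p. V p * complex_of_real (exp (fst p) * cos (\<xi> * fst p) * sn k (snd p) * c p) +
    \<i> * (V p * complex_of_real (exp (fst p) * sin (\<xi> * fst p) * sn k (snd p) * c p)) \<partial>lebesgue)"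
    by (intro Bochner_Integration.integral_cong) (simp_all add: mode_Re_Im algebra_simps)
  also have "\<dots> = (\<integral>p. V p * complex_of_real (exp (fst p) * cos (\<xi> * fst p) * sn k (snd p) * c p) \<partial>lebesgue) +
    (\<integral>p. \<i> * (V p * complex_of_real (exp (fst p) * sin (\<xi> * fst p) * sn k (snd p) * c p)) \<partial>lebesgue)"
    by (intro Bochner_Integration.integral_add integrable_mult_right sqi_integrable_mult[OF V] sqi_weight_real[OF _ c] 
        smooth1_exp_cos smooth1_exp_sin)
  finally show ?thesis by (simp only: integral_mult_right_zero)
qed

text \<open>The test functions so far are real, so the exponential is split into its real and
  imaginary parts.\<close>

lemma pairing_mode_xx:
  "(1 + \<i> * of_real \<xi>)\<^sup>2 * pairing U (chi K a) (mode \<xi> k) = 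
    pairing Uxx (chi K a) (mode \<xi> k) + 2 * pairing Ux (chi_x K a) (mode \<xi> k) + pairing U (chi_xx K a) (mode \<xi> k)"
proof -
  let ?c = "\<lambda>x. exp x * cos (\<xi> * x)" and ?s = "\<lambda>x. exp x * sin (\<xi> * x)"
  let ?c1 = "\<lambda>x. exp x * (cos (\<xi> * x) - \<xi> * sin (\<xi> * x))" and ?s1 = "\<lambda>x. exp x * (sin (\<xi> * x) + \<xi> * cos (\<xi> * x))"
  \<comment> \<open>The second derivatives in the form of the real and imaginary parts of (1 + \<i>
    \<xi>)^2 exp ((1 + \<i> \<xi>) x), so that they recombine to the factor on the left.\<close>
  let ?c2 = "\<lambda>x. (1 - \<xi>\<^sup>2) * ?c x - 2 * \<xi> * ?s x" and ?s2 = "\<lambda>x. (1 - \<xi>\<^sup>2) * ?s x + 2 * \<xi> * ?c x"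
  have d: "(?c has_real_derivative ?c1 x) (at x)" "(?c1 has_real_derivative ?c2 x) (at x)"
     "(?s has_real_derivative ?s1 x) (at x)" "(?s1 has_real_derivative ?s2 x) (at x)" for x
    by (auto intro!: derivative_eq_intros simp: algebra_simps power2_eq_square)
  note c = integral_chi_sn[OF smooth1_exp_cos d(1,2), where k = k]
  note s = integral_chi_sn[OF smooth1_exp_sin d(3,4), where k = k]
  have ch: "chi K a \<in> {chi K a, chi_x K a, chi_xx K a, rect_ind a}" "chi_x K a \<in> {chi K a, chi_x K a, chi_xx K a, rect_ind a}"
     "chi_xx K a \<in> {chi K a, chi_x K a, chi_xx K a, rect_ind a}" by auto
  have sm: "smooth1 ?c2" "smooth1 ?s2" 
    by (intro smooth1_diff smooth1_add smooth1_mult[OF smooth1_const] smooth1_exp_cos smooth1_exp_sin)+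
  have "(1 + \<i> * of_real \<xi>)\<^sup>2 * pairing U (chi K a) (mode \<xi> k) = (\<integral>p. (1 + \<i> * of_real \<xi>)\<^sup>2 * (U p * (complex_of_real (chi K a p) * mode \<xi> k p)) \<partial>lebesgue)"
    by (rule integral_mult_right_zero[symmetric])
  also have "\<dots> = (\<integral>p. U p * complex_of_real (?c2 (fst p) * sn k (snd p) * chi K a p) +
    \<i> * (U p * complex_of_real (?s2 (fst p) * sn k (snd p) * chi K a p)) \<partial>lebesgue)"
    by (intro Bochner_Integration.integral_cong) (simp_all add: mode_Re_Im algebra_simps power2_eq_square)
  also have "\<dots> = (\<integral>p. U p * complex_of_real (?c2 (fst p) * sn k (snd p) * chi K a p) \<partial>lebesgue) +
    (\<integral>p. \<i> * (U p * complex_of_real (?s2 (fst p) * sn k (snd p) * chi K a p)) \<partial>lebesgue)"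
    by (intro Bochner_Integration.integral_add integrable_mult_right sqi_integrable_mult[OF sqi(1)] sqi_weight_real[OF _ ch(1)] sm)
  also have "\<dots> = (\<integral>p. U p * complex_of_real (?c2 (fst p) * sn k (snd p) * chi K a p) \<partial>lebesgue) +
    \<i> * (\<integral>p. U p * complex_of_real (?s2 (fst p) * sn k (snd p) * chi K a p) \<partial>lebesgue)"
    by (simp only: integral_mult_right_zero)
  also have "\<dots> = pairing Uxx (chi K a) (mode \<xi> k) + 2 * pairing Ux (chi_x K a) (mode \<xi> k) + pairing U (chi_xx K a) (mode \<xi> k)"
    unfolding c s pairing_mode[OF sqi(1) ch(3)] pairing_mode[OF sqi(2) ch(2)] pairing_mode[OF sqi(3) ch(1)]
    by (simp only: ring_distribs mult.assoc mult.left_commute[of \<i> 2] add_ac)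
  finally show ?thesis .
qed

lemma pairing_mode_yy:
  "pairing Uyy (rect_ind a) (mode \<xi> k) = - of_real ((real k)\<^sup>2 / 4) * pairing U (rect_ind a) (mode \<xi> k)"
proof -
  have r: "rect_ind a \<in> {chi K a, chi_x K a, chi_xx K a, rect_ind a}" by simp
  show ?thesis unfolding pairing_mode[OF sqi(5) r] pairing_mode[OF sqi(1) r]
    using integral_rect_sn[OF smooth1_exp_cos[of \<xi>], of k] integral_rect_sn[OF smooth1_exp_sin[of \<xi>], of k]
    by (simp add: algebra_simps)
qed

lemma pairing_add_weight:
  assumes "sqi V" "sqi (\<lambda>p. complex_of_real (c p) * Q p)" "sqi (\<lambda>p. complex_of_real (d p) * Q p)" 
  shows "pairing V (\<lambda>p. c p + d p) Q = pairing V c Q + pairing V d Q"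
proof -
  have "pairing V (\<lambda>p. c p + d p) Q = (\<integral>p. V p * (complex_of_real (c p) * Q p) + V p * (complex_of_real (d p) * Q p) \<partial>lebesgue)"
    by (intro Bochner_Integration.integral_cong) (simp_all add: algebra_simps)
  also have "\<dots> = pairing V c Q + pairing V d Q"
    by (intro Bochner_Integration.integral_add sqi_integrable_mult assms)
  finally show ?thesis .
qed

lemma chi_split: "chi K a = (\<lambda>p. rect_ind a p + wing p)"
  by (simp add: wing_def)

text \<open>The equation replaces Uxx by -F - Uyy - l^2 U only on the rectangle, because only there
  is the pairing with Uyy known; on the wings Uxx stays as it is. The last term arises when the
  factor l^2 - k^2/4 of the rectangle pairing is completed to a factor of the pairing with
  \<open>chi\<close>.\<close>

lemma mode_identity:
  fixes l :: real
  defines "F \<equiv> \<lambda>p. - (Uxx p + Uyy p) - of_real (l\<^sup>2) * U p"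
  shows "((1 + \<i> * of_real \<xi>)\<^sup>2 + of_real (l\<^sup>2 - (real k)\<^sup>2 / 4)) * pairing U (chi K a) (mode \<xi> k) = 
    - pairing F (rect_ind a) (mode \<xi> k) + pairing Uxx wing (mode \<xi> k) + 2 * pairing Ux (chi_x K a) (mode \<xi> k) +
      pairing U (chi_xx K a) (mode \<xi> k) + of_real (l\<^sup>2 - (real k)\<^sup>2 / 4) * pairing U wing (mode \<xi> k)"
proof -
  let ?E = "mode \<xi> k"
  have sw: "sqi (\<lambda>p. complex_of_real (rect_ind a p) * ?E p)" "sqi (\<lambda>p. complex_of_real (wing p) * ?E p)"
    by (rule sqi_weight_mode; simp)+
  have spl: "pairing V (chi K a) ?E = pairing V (rect_ind a) ?E + pairing V wing ?E" if "sqi V" for V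
    using pairing_add_weight[OF that sw] by (simp only: chi_split)
  note i = sqi_integrable_mult[OF sqi(1) sw(1)] sqi_integrable_mult[OF sqi(3) sw(1)] sqi_integrable_mult[OF sqi(5) sw(1)]
  have "pairing F (rect_ind a) ?E = (\<integral>p. - (Uxx p * (complex_of_real (rect_ind a p) * ?E p)) - Uyy p * (complex_of_real (rect_ind a p) * ?E p) 
     - of_real (l\<^sup>2) * (U p * (complex_of_real (rect_ind a p) * ?E p)) \<partial>lebesgue)"
    unfolding F_def by (intro Bochner_Integration.integral_cong) (simp_all add: algebra_simps)
  also have "\<dots> = - pairing Uxx (rect_ind a) ?E - pairing Uyy (rect_ind a) ?E - of_real (l\<^sup>2) * pairing U (rect_ind a) ?E"
    by (subst Bochner_Integration.integral_diff | simp only: integral_mult_right_zero Bochner_Integration.integral_minus | 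
        intro i Bochner_Integration.integrable_diff integrable_mult_right Bochner_Integration.integrable_minus)+
  finally have "pairing Uxx (rect_ind a) ?E = - pairing F (rect_ind a) ?E + of_real ((real k)\<^sup>2 / 4) * pairing U (rect_ind a) ?E - of_real (l\<^sup>2) * pairing U (rect_ind a) ?E"
    unfolding pairing_mode_yy by (simp add: algebra_simps)
  with pairing_mode_xx[of \<xi> k] spl[OF sqi(1)] spl[OF sqi(3)]
  show ?thesis by (simp only: of_real_diff) (simp add: algebra_simps)
qed

lemma sqi_weight_trig:
  assumes "finite A" "c \<in> {chi K a, chi_x K a, chi_xx K a, rect_ind a, wing}"
  shows "sqi (\<lambda>p. complex_of_real (c p) * trig A b p)"
proof -
  have "sqi (\<lambda>p. \<Sum>j\<in>A. b j * (complex_of_real (c p) * mode (fst j) (snd j) p))"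
    by (intro sqi_sum assms sqi_cmult sqi_weight_mode)
  then show ?thesis by (simp add: trig_def sum_distrib_left mult_ac)
qed

lemma pairing_trig:
  assumes "finite A" "sqi V" "c \<in> {chi K a, chi_x K a, chi_xx K a, rect_ind a, wing}"
  shows "pairing V c (trig A b) = (\<Sum>j\<in>A. b j * pairing V c (mode (fst j) (snd j)))"
proof -
  have "pairing V c (trig A b) = (\<integral>p. (\<Sum>j\<in>A. b j * (V p * (complex_of_real (c p) * mode (fst j) (snd j) p))) \<partial>lebesgue)"
    by (intro Bochner_Integration.integral_cong) (simp_all add: trig_def sum_distrib_left mult_ac)
  also have "\<dots> = (\<Sum>j\<in>A. \<integral>p. b j * (V p * (complex_of_real (c p) * mode (fst j) (snd j) p)) \<partial>lebesgue)"
    by (intro Bochner_Integration.integral_sum integrable_mult_right sqi_integrable_mult assms sqi_weight_mode)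
  finally show ?thesis by (simp only: integral_mult_right_zero)
qed

text \<open>The factor l^2 is the same for all modes and stays outside the sum; k^2/4 varies with
  the mode and goes into the coefficients, giving a separate trigonometric sum with its own Parseval
  bound.\<close>

lemma trig_identity:
  fixes l :: real
  defines "F \<equiv> \<lambda>p. - (Uxx p + Uyy p) - of_real (l\<^sup>2) * U p"
    and "S \<equiv> \<lambda>j :: real \<times> nat. (1 + \<i> * of_real (fst j))\<^sup>2 + of_real (l\<^sup>2 - (real (snd j))\<^sup>2 / 4)"
  assumes A: "finite A"
  shows "pairing U (chi K a) (trig A (\<lambda>j. S j * b j)) = 
    - pairing F (rect_ind a) (trig A b) + pairing Uxx wing (trig A b) + 2 * pairing Ux (chi_x K a) (trig A b) +
      pairing U (chi_xx K a) (trig A b) + of_real (l\<^sup>2) * pairing U wing (trig A b) 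
      - pairing U wing (trig A (\<lambda>j. of_real ((real (snd j))\<^sup>2 / 4) * b j))"
proof -
  have F: "sqi F" unfolding F_def 
    using sqi_diff[OF sqi_cmult[OF sqi_add[OF sqi(3,5)], of "-1"] sqi_cmult[OF sqi(1)]] by simp
  have id: "S j * pairing U (chi K a) (mode (fst j) (snd j)) = 
    - pairing F (rect_ind a) (mode (fst j) (snd j)) + pairing Uxx wing (mode (fst j) (snd j)) + 2 * pairing Ux (chi_x K a) (mode (fst j) (snd j)) +
      pairing U (chi_xx K a) (mode (fst j) (snd j)) + of_real (l\<^sup>2 - (real (snd j))\<^sup>2 / 4) * pairing U wing (mode (fst j) (snd j))" for j
    unfolding S_def F_def by (rule mode_identity)
  have "pairing U (chi K a) (trig A (\<lambda>j. S j * b j)) = (\<Sum>j\<in>A. b j * (S j * pairing U (chi K a) (mode (fst j) (snd j))))"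
    by (simp add: pairing_trig[OF A sqi(1)] mult_ac)
  also have "\<dots> = - (\<Sum>j\<in>A. b j * pairing F (rect_ind a) (mode (fst j) (snd j))) + (\<Sum>j\<in>A. b j * pairing Uxx wing (mode (fst j) (snd j)))
     + 2 * (\<Sum>j\<in>A. b j * pairing Ux (chi_x K a) (mode (fst j) (snd j))) + (\<Sum>j\<in>A. b j * pairing U (chi_xx K a) (mode (fst j) (snd j)))
     + of_real (l\<^sup>2) * (\<Sum>j\<in>A. b j * pairing U wing (mode (fst j) (snd j)))
     - (\<Sum>j\<in>A. of_real ((real (snd j))\<^sup>2 / 4) * b j * pairing U wing (mode (fst j) (snd j)))"
    unfolding id sum_distrib_left sum_negf[symmetric] sum.distrib[symmetric] sum_subtractf[symmetric]
    by (intro sum.cong refl) (simp only: of_real_diff, simp add: algebra_simps)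
  also have "\<dots> = - pairing F (rect_ind a) (trig A b) + pairing Uxx wing (trig A b) + 2 * pairing Ux (chi_x K a) (trig A b) +
      pairing U (chi_xx K a) (trig A b) + of_real (l\<^sup>2) * pairing U wing (trig A b) 
      - pairing U wing (trig A (\<lambda>j. of_real ((real (snd j))\<^sup>2 / 4) * b j))"
    using F by (simp add: pairing_trig[OF A] sqi)
  finally show ?thesis .
qed

end

section \<open>Parseval identities\<close>

lemma finite_Parseval:
  fixes f :: "'i \<Rightarrow> real \<Rightarrow> complex"
  assumes I: "finite I" and cont: "\<And>i. i \<in> I \<Longrightarrow> continuous_on {s..t} (f i)"
    and orth: "\<And>i j. i \<in> I \<Longrightarrow> j \<in> I \<Longrightarrow> (\<integral>x. indicator {s..t} x *\<^sub>R (f i x * cnj (f j x)) \<partial>lborel) = (if i = j then of_real N else 0)"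
  shows "(\<integral>x. indicator {s..t} x * (norm (\<Sum>i\<in>I. c i * f i x))\<^sup>2 \<partial>lborel) = N * (\<Sum>i\<in>I. (norm (c i))\<^sup>2)"
proof -
  have int: "integrable lborel (\<lambda>x. indicator {s..t} x *\<^sub>R (f i x * cnj (f j x)))" if "i \<in> I" "j \<in> I" for i j
  proof -
    have "continuous_on {s..t} (\<lambda>x. f i x * cnj (f j x))" using cont that by (intro continuous_intros) auto
    from borel_integrable_atLeastAtMost'[OF this] show ?thesis by (simp only: set_integrable_def)
  qed
  have "complex_of_real (\<integral>x. indicator {s..t} x * (norm (\<Sum>i\<in>I. c i * f i x))\<^sup>2 \<partial>lborel) =
    (\<integral>x. complex_of_real (indicator {s..t} x * (norm (\<Sum>i\<in>I. c i * f i x))\<^sup>2) \<partial>lborel)" 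
    by (rule integral_complex_of_real[symmetric])
  also have "\<dots> = (\<integral>x. (\<Sum>i\<in>I. \<Sum>j\<in>I. c i * cnj (c j) * (indicator {s..t} x *\<^sub>R (f i x * cnj (f j x)))) \<partial>lborel)"
  proof (rule Bochner_Integration.integral_cong[OF refl])
    fix x
    have "complex_of_real (indicator {s..t} x * (norm (\<Sum>i\<in>I. c i * f i x))\<^sup>2) = 
      of_real (indicator {s..t} x) * ((\<Sum>i\<in>I. c i * f i x) * cnj (\<Sum>j\<in>I. c j * f j x))"
      by (simp only: of_real_mult complex_norm_square)
    also have "\<dots> = (\<Sum>i\<in>I. \<Sum>j\<in>I. c i * cnj (c j) * (indicator {s..t} x *\<^sub>R (f i x * cnj (f j x))))"
    proof -
      have "(\<Sum>i\<in>I. c i * f i x) * cnj (\<Sum>j\<in>I. c j * f j x) = (\<Sum>i\<in>I. \<Sum>j\<in>I. (c i * f i x) * cnj (c j * f j x))"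
        by (simp only: cnj_sum sum_product)
      then show ?thesis by (simp only: sum_distrib_left) (intro sum.cong refl, simp add: scaleR_conv_of_real mult_ac)
    qed
    finally show "complex_of_real (indicator {s..t} x * (norm (\<Sum>i\<in>I. c i * f i x))\<^sup>2) =
      (\<Sum>i\<in>I. \<Sum>j\<in>I. c i * cnj (c j) * (indicator {s..t} x *\<^sub>R (f i x * cnj (f j x))))" .
  qed
  also have "\<dots> = (\<Sum>i\<in>I. \<Sum>j\<in>I. c i * cnj (c j) * (if i = j then of_real N else 0))"
  proof -
    have "(\<integral>x. (\<Sum>i\<in>I. \<Sum>j\<in>I. c i * cnj (c j) * (indicator {s..t} x *\<^sub>R (f i x * cnj (f j x)))) \<partial>lborel) =
      (\<Sum>i\<in>I. \<integral>x. (\<Sum>j\<in>I. c i * cnj (c j) * (indicator {s..t} x *\<^sub>R (f i x * cnj (f j x)))) \<partial>lborel)"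
      by (intro Bochner_Integration.integral_sum Bochner_Integration.integrable_sum integrable_mult_right int)
    also have "\<dots> = (\<Sum>i\<in>I. \<Sum>j\<in>I. \<integral>x. c i * cnj (c j) * (indicator {s..t} x *\<^sub>R (f i x * cnj (f j x))) \<partial>lborel)"
      by (intro sum.cong refl Bochner_Integration.integral_sum integrable_mult_right int)
    also have "\<dots> = (\<Sum>i\<in>I. \<Sum>j\<in>I. c i * cnj (c j) * (if i = j then of_real N else 0))"
      by (intro sum.cong refl) (simp only: integral_mult_right_zero orth)
    finally show ?thesis .
  qed
  also have "\<dots> = (\<Sum>i\<in>I. of_real N * of_real ((norm (c i))\<^sup>2))"
  proof (intro sum.cong refl)
    fix i assume i: "i \<in> I"
    have "(\<Sum>j\<in>I. c i * cnj (c j) * (if i = j then of_real N else 0)) = (\<Sum>j\<in>I. if i = j then c i * cnj (c i) * of_real N else 0)"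
      by (intro sum.cong) auto
    also have "\<dots> = c i * cnj (c i) * of_real N" using I i by simp
    finally show "(\<Sum>j\<in>I. c i * cnj (c j) * (if i = j then of_real N else 0)) = of_real N * of_real ((norm (c i))\<^sup>2)"
      by (simp only: complex_norm_square mult_ac)
  qed
  also have "\<dots> = of_real (N * (\<Sum>i\<in>I. (norm (c i))\<^sup>2))" by (simp add: sum_distrib_left)
  finally show ?thesis using of_real_eq_iff by blast
qed

lemma sn_orthogonal:
  assumes "k \<ge> 1" "l \<ge> 1"
  shows "(\<integral>y. indicator {-pi..pi} y *\<^sub>R (complex_of_real (sn k y) * cnj (complex_of_real (sn l y))) \<partial>lborel) = (if k = l then of_real pi else 0)"
proof -
  let ?t = "\<lambda>y. (y + pi) / 2"
  \<comment> \<open>An antiderivative of the product of the two sines, read off from the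
    product-to-sum formula; the case k = l has a zero difference frequency and gives the linear
    term.\<close>
  define H where "H y = (if k = l then y / 2 - sin (2 * real k * ?t y) / (2 * real k) else 
     sin ((real k - real l) * ?t y) / (real k - real l) - sin ((real k + real l) * ?t y) / (real k + real l))" for y
  have d: "(H has_real_derivative sn k y * sn l y) (at y)" for y
  proof (cases "k = l")
    case True
    have "((\<lambda>y. y / 2 - sin (2 * real k * ?t y) / (2 * real k)) has_real_derivative 1/2 - cos (2 * (real k * ?t y)) / 2) (at y)"
      using assms by (auto intro!: derivative_eq_intros simp: field_simps)
    moreover have "1/2 - cos (2 * (real k * ?t y)) / 2 = sn k y * sn l y"
      unfolding True[symmetric] sn_def cos_double_sin power2_eq_square by (simp add: diff_divide_distrib)
    ultimately show ?thesis using True by (simp add: H_def[abs_def])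
  next
    case False
    have d: "((\<lambda>y. sin (c * ?t y) / c) has_real_derivative cos (c * ?t y) / 2) (at y)" if "c \<noteq> 0" for c
      using that by (auto intro!: derivative_eq_intros)
    have "real k - real l \<noteq> 0" "real k + real l \<noteq> 0" using False assms by auto
    from DERIV_diff[OF d[OF this(1)] d[OF this(2)]]
    have "((\<lambda>y. sin ((real k - real l) * ?t y) / (real k - real l) - sin ((real k + real l) * ?t y) / (real k + real l)) 
       has_real_derivative cos ((real k - real l) * ?t y) / 2 - cos ((real k + real l) * ?t y) / 2) (at y)" .
    moreover have "cos ((real k - real l) * ?t y) / 2 - cos ((real k + real l) * ?t y) / 2 = sn k y * sn l y"
      by (simp only: sn_def left_diff_distrib distrib_right cos_diff cos_add) (simp add: diff_divide_distrib add_divide_distrib)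
    ultimately show ?thesis using False by (simp add: H_def[abs_def])
  qed
  have "(\<integral>y. indicator {-pi..pi} y *\<^sub>R (sn k y * sn l y) \<partial>lborel) = H pi - H (- pi)"
    by (rule integral_FTC_Icc)
       (use d in \<open>auto simp: has_real_derivative_iff_has_vector_derivative intro: has_vector_derivative_at_within 
           intro!: smooth1_continuous smooth1_mult smooth1_sn\<close>)
  also have "\<dots> = (if k = l then pi else 0)"
  proof -
    have "sin (2 * real k * ?t pi) = 0" "sin (2 * real k * ?t (- pi)) = 0" 
      using sin_npi[of "2 * k"] by simp_all
    moreover have "sin ((real k + real l) * ?t pi) = 0" using sin_npi[of "k + l"] by simp
    moreover have "sin ((real k - real l) * ?t pi) = 0" 
      using sin_npi[of k] sin_npi[of l] by (simp add: left_diff_distrib sin_diff)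
    ultimately show ?thesis by (simp add: H_def)
  qed
  finally have "complex_of_real (\<integral>y. indicator {-pi..pi} y *\<^sub>R (sn k y * sn l y) \<partial>lborel) = (if k = l then of_real pi else 0)" by simp
  then show ?thesis 
    unfolding integral_complex_of_real[symmetric] by (simp add: scaleR_conv_of_real)
qed

text \<open>Differences of these frequencies are integral multiples of pi / (a + 1), so the
  exponentials are orthogonal on an interval of length 2 (a + 1), just as for the usual Fourier
  series; the shift by 1/2 keeps the frequencies themselves away from 0.\<close>

definition freq :: "real \<Rightarrow> int \<Rightarrow> real" where "freq a n = pi / (a + 1) * (of_int n + 1/2)"

lemma freq_inj: "a > 0 \<Longrightarrow> freq a n = freq a m \<longleftrightarrow> n = m"
  by (simp add: freq_def)

lemma cis_orthogonal:
  assumes a: "a > 0"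
  shows "(\<integral>x. indicator {-(a+1)..a+1} x *\<^sub>R (cis (freq a n * x) * cnj (cis (freq a m * x))) \<partial>lborel) = 
    (if n = m then of_real (2 * (a + 1)) else 0)"
proof -
  define c where "c = freq a n - freq a m"
  have cis: "cis (freq a n * x) * cnj (cis (freq a m * x)) = cis (c * x)" for x
    by (simp add: cis_cnj cis_mult c_def algebra_simps)
  show ?thesis
  proof (cases "n = m")
    case True
    have "(\<integral>x. indicator {-(a+1)..a+1} x *\<^sub>R (1::complex) \<partial>lborel) = of_real (a + 1) - of_real (- (a + 1))"
      by (rule integral_FTC_Icc) (use a in \<open>auto intro!: derivative_eq_intros has_vector_derivative_of_real continuous_intros\<close>)
    then show ?thesis using True unfolding cis by (simp add: c_def)
  next
    case False
    then have c: "c \<noteq> 0" using freq_inj[OF a] by (simp add: c_def)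
    have "(\<integral>x. indicator {-(a+1)..a+1} x *\<^sub>R cis (c * x) \<partial>lborel) = cis (c * (a+1)) / (\<i> * of_real c) - cis (c * (-(a+1))) / (\<i> * of_real c)"
    proof (rule integral_FTC_Icc)
      fix x
      have "((\<lambda>z. exp (\<i> * of_real c * z) / (\<i> * of_real c)) has_field_derivative exp (\<i> * of_real c * of_real x)) (at (complex_of_real x))"
        using c by (auto intro!: derivative_eq_intros)
      from has_vector_derivative_real_field[OF this]
      show "((\<lambda>x. cis (c * x) / (\<i> * of_real c)) has_vector_derivative cis (c * x)) (at x within {-(a+1)..a+1})"
        by (simp add: cis_conv_exp mult.assoc)
    qed (use a in \<open>auto intro!: continuous_intros\<close>)
    moreover have "cis (c * (a+1)) = cis (c * (-(a+1)))"
    proof -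
      have "freq a n * (a + 1) = pi * (of_int n + 1/2)" for n using a by (simp add: freq_def)
      then have "c * (a + 1) = of_int (n - m) * pi" by (simp add: c_def left_diff_distrib) (simp add: algebra_simps)
      then have "sin (c * (a + 1)) = 0" unfolding sin_zero_iff_int2 by blast
      then show ?thesis unfolding mult_minus_right by (simp add: complex_eq_iff)
    qed
    ultimately show ?thesis using False unfolding cis by simp
  qed
qed

definition modes :: "real \<Rightarrow> int set \<Rightarrow> nat set \<Rightarrow> (real \<times> nat) set" where
  "modes a N L = freq a ` N \<times> L"

text \<open>The trigonometric sum without the weight exp x. The weight would destroy orthogonality,
  so Parseval is applied to this function, and the weight, bounded by exp (a + 1) on the slab, is
  put back by \<open>trig_eq_flat_trig\<close>.\<close>

definition flat_trig :: "(real \<times> nat) set \<Rightarrow> (real \<times> nat \<Rightarrow> complex) \<Rightarrow> real \<times> real \<Rightarrow> complex" where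
  "flat_trig A b p = (\<Sum>j\<in>A. b j * (cis (fst j * fst p) * of_real (sn (snd j) (snd p))))"

definition xcoeff :: "real \<Rightarrow> int set \<Rightarrow> (real \<times> nat \<Rightarrow> complex) \<Rightarrow> nat \<Rightarrow> real \<Rightarrow> complex" where
  "xcoeff a N b k x = (\<Sum>n\<in>N. b (freq a n, k) * cis (freq a n * x))"

lemma trig_eq_flat_trig: "trig A b p = of_real (exp (fst p)) * flat_trig A b p"
proof -
  have "exp (complex_of_real (fst p) * (1 + \<i> * of_real \<xi>)) = of_real (exp (fst p)) * cis (\<xi> * fst p)" for \<xi>
    by (simp add: exp_add[symmetric] cis_conv_exp algebra_simps exp_of_real[symmetric])
  then show ?thesis by (simp add: trig_def flat_trig_def mode_def sum_distrib_left mult_ac)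
qed

lemma flat_trig_modes:
  assumes "a > 0" 
  shows "flat_trig (modes a N L) b (x, y) = (\<Sum>k\<in>L. xcoeff a N b k x * of_real (sn k y))"
proof -
  have "flat_trig (modes a N L) b (x, y) = (\<Sum>\<xi>\<in>freq a ` N. \<Sum>k\<in>L. b (\<xi>, k) * (cis (\<xi> * x) * of_real (sn k y)))"
    by (simp add: flat_trig_def modes_def sum.cartesian_product case_prod_unfold)
  also have "\<dots> = (\<Sum>n\<in>N. \<Sum>k\<in>L. b (freq a n, k) * (cis (freq a n * x) * of_real (sn k y)))"
    using freq_inj[OF assms] by (subst sum.reindex) (auto simp: inj_on_def)
  also have "\<dots> = (\<Sum>k\<in>L. xcoeff a N b k x * of_real (sn k y))"
    by (subst sum.swap) (simp add: xcoeff_def sum_distrib_right mult.assoc)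
  finally show ?thesis .
qed

lemma xcoeff_Parseval:
  assumes "a > 0" "finite N"
  shows "(\<integral>x. indicator {-(a+1)..a+1} x * (norm (xcoeff a N b k x))\<^sup>2 \<partial>lborel) = 2 * (a + 1) * (\<Sum>n\<in>N. (norm (b (freq a n, k)))\<^sup>2)"
  unfolding xcoeff_def using cis_orthogonal[OF assms(1)] assms
  by (intro finite_Parseval) (auto intro!: continuous_intros)

lemma continuous_xcoeff: "continuous_on S (xcoeff a N b k)"
  unfolding xcoeff_def[abs_def] by (intro continuous_intros)

lemma slab_integral_product:
  fixes f :: "real \<Rightarrow> real \<Rightarrow> real"
  assumes f: "continuous_on UNIV (\<lambda>p. f (fst p) (snd p))"
  shows "(\<integral>p. indicator (slab a) p * f (fst p) (snd p) \<partial>lebesgue) = 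
    (\<integral>x. indicator {-(a+1)..a+1} x * (\<integral>y. indicator {-pi..pi} y * f x y \<partial>lborel) \<partial>lborel)"
    "integrable lebesgue (\<lambda>p. indicator (slab a) p * f (fst p) (snd p))"
proof -
  have fm: "(\<lambda>p. f (fst p) (snd p)) \<in> borel_measurable borel" using f by (rule borel_measurable_continuous_onI)
  have sm: "slab a \<in> sets borel" by (simp add: slab_def)
  have "bounded ((\<lambda>p. f (fst p) (snd p)) ` slab a)"
    by (intro compact_imp_bounded compact_continuous_image continuous_on_subset[OF f]) (auto simp: slab_def)
  then obtain B where B: "\<forall>p\<in>slab a. \<bar>f (fst p) (snd p)\<bar> \<le> B" unfolding bounded_iff by auto
  let ?g = "\<lambda>p. complex_of_real (indicator (slab a) p * f (fst p) (snd p))"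
  have g: "?g \<in> borel_measurable borel" using fm sm by measurable
  have b: "norm (?g p) \<le> B * indicator (slab a) p" for p using B by (cases "p \<in> slab a") auto
  have "complex_of_real (\<integral>p. indicator (slab a) p * f (fst p) (snd p) \<partial>lebesgue) = (\<integral>p. ?g p \<partial>lebesgue)"
    by (rule integral_complex_of_real[symmetric])
  also have "\<dots> = (\<integral>x. (\<integral>y. ?g (x, y) \<partial>lborel) \<partial>lborel)" by (rule lebesgue_Fubini[OF g slab_lmeasurable b])
  also have "\<dots> = complex_of_real (\<integral>x. (\<integral>y. indicator (slab a) (x, y) * f x y \<partial>lborel) \<partial>lborel)" 
    by (simp only: integral_complex_of_real fst_conv snd_conv)
  finally have "(\<integral>p. indicator (slab a) p * f (fst p) (snd p) \<partial>lebesgue) = (\<integral>x. (\<integral>y. indicator (slab a) (x, y) * f x y \<partial>lborel) \<partial>lborel)"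
    using of_real_eq_iff by blast
  also have "\<dots> = (\<integral>x. (\<integral>y. indicator {-(a+1)..a+1} x * (indicator {-pi..pi} y * f x y) \<partial>lborel) \<partial>lborel)"
    by (intro Bochner_Integration.integral_cong refl) (auto simp: indicator_def slab_iff abs_le_iff)
  finally show "(\<integral>p. indicator (slab a) p * f (fst p) (snd p) \<partial>lebesgue) = 
    (\<integral>x. indicator {-(a+1)..a+1} x * (\<integral>y. indicator {-pi..pi} y * f x y \<partial>lborel) \<partial>lborel)"
    by (simp only: integral_mult_right_zero)
  have "integrable lborel ?g" by (rule integrable_bounded_lborel[OF g slab_lmeasurable b])
  then have "integrable lborel (\<lambda>p. indicator (slab a) p * f (fst p) (snd p))"
    using integrable_Re by fastforce
  then show "integrable lebesgue (\<lambda>p. indicator (slab a) p * f (fst p) (snd p))" 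
    using borel_measurable_times[OF borel_measurable_indicator[OF sm] fm] by (subst integrable_completion) simp_all
qed

lemma slab_integral_xcoeff:
  assumes a: "a > 0" and N: "finite N" and L: "finite L"
  shows "(\<integral>x. indicator {-(a+1)..a+1} x * (\<Sum>k\<in>L. w k * (norm (xcoeff a N b k x))\<^sup>2) \<partial>lborel) = 
    2 * (a + 1) * (\<Sum>j\<in>modes a N L. w (snd j) * (norm (b j))\<^sup>2)"
proof -
  have int: "integrable lborel (\<lambda>x. indicator {-(a+1)..a+1} x * (norm (xcoeff a N b k x))\<^sup>2)" for k
  proof -
    have "continuous_on {-(a+1)..a+1} (\<lambda>x. (norm (xcoeff a N b k x))\<^sup>2)" by (intro continuous_intros continuous_xcoeff)
    from borel_integrable_atLeastAtMost'[OF this] show ?thesis by (simp only: set_integrable_def real_scaleR_def)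
  qed
  have "(\<integral>x. indicator {-(a+1)..a+1} x * (\<Sum>k\<in>L. w k * (norm (xcoeff a N b k x))\<^sup>2) \<partial>lborel) = 
    (\<integral>x. (\<Sum>k\<in>L. w k * (indicator {-(a+1)..a+1} x * (norm (xcoeff a N b k x))\<^sup>2)) \<partial>lborel)"
    by (simp add: sum_distrib_left mult_ac)
  also have "\<dots> = (\<Sum>k\<in>L. w k * (2 * (a + 1) * (\<Sum>n\<in>N. (norm (b (freq a n, k)))\<^sup>2)))"
    by (subst Bochner_Integration.integral_sum, intro integrable_mult_right int)
       (simp only: integral_mult_right_zero xcoeff_Parseval[OF a N])
  also have "\<dots> = 2 * (a + 1) * (\<Sum>k\<in>L. \<Sum>n\<in>N. w k * (norm (b (freq a n, k)))\<^sup>2)"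
    by (simp add: sum_distrib_left mult_ac)
  also have "(\<Sum>k\<in>L. \<Sum>n\<in>N. w k * (norm (b (freq a n, k)))\<^sup>2) = (\<Sum>n\<in>N. \<Sum>k\<in>L. w k * (norm (b (freq a n, k)))\<^sup>2)"
    by (rule sum.swap)
  also have "\<dots> = (\<Sum>\<xi>\<in>freq a ` N. \<Sum>k\<in>L. w k * (norm (b (\<xi>, k)))\<^sup>2)"
    using freq_inj[OF a] by (subst sum.reindex) (auto simp: inj_on_def)
  also have "\<dots> = (\<Sum>j\<in>modes a N L. w (snd j) * (norm (b j))\<^sup>2)"
    by (simp add: modes_def sum.cartesian_product case_prod_unfold)
  finally show ?thesis .
qed

lemma continuous_flat_trig: "continuous_on S (flat_trig A b)"
  unfolding flat_trig_def[abs_def]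
  by (intro continuous_intros continuous_on_compose2[OF smooth1_continuous[OF smooth1_sn, of UNIV]]) auto

text \<open>Parseval in y for fixed x, then in x for each k. The index k = 0 is excluded since its
  sine is identically 0 and does not have square norm pi.\<close>

lemma nrm_flat_trig:
  assumes a: "a > 0" and N: "finite N" and L: "finite L" "0 \<notin> L"
  shows "(nrm (\<lambda>p. indicator (slab a) p * flat_trig (modes a N L) b p))\<^sup>2 = 2 * pi * (a + 1) * (\<Sum>j\<in>modes a N L. (norm (b j))\<^sup>2)"
proof -
  let ?q = "flat_trig (modes a N L) b"
  have "(nrm (\<lambda>p. indicator (slab a) p * ?q p))\<^sup>2 = (\<integral>p. indicator (slab a) p * (norm (?q (fst p, snd p)))\<^sup>2 \<partial>lebesgue)"
    unfolding nrm_sq by (intro Bochner_Integration.integral_cong refl) (auto simp: indicator_def)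
  also have "\<dots> = (\<integral>x. indicator {-(a+1)..a+1} x * (\<integral>y. indicator {-pi..pi} y * (norm (?q (x, y)))\<^sup>2 \<partial>lborel) \<partial>lborel)"
    by (rule slab_integral_product(1)) (auto intro!: continuous_intros continuous_flat_trig)
  also have "\<dots> = (\<integral>x. indicator {-(a+1)..a+1} x * (\<Sum>k\<in>L. pi * (norm (xcoeff a N b k x))\<^sup>2) \<partial>lborel)"
  proof -
    have "(\<integral>y. indicator {-pi..pi} y * (norm (?q (x, y)))\<^sup>2 \<partial>lborel) = pi * (\<Sum>k\<in>L. (norm (xcoeff a N b k x))\<^sup>2)" for x
      unfolding flat_trig_modes[OF a]
    proof (rule finite_Parseval[OF L(1)])
      show "continuous_on {-pi..pi} (\<lambda>y. complex_of_real (sn k y))" for k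
        by (intro continuous_intros smooth1_continuous smooth1_sn)
      fix k l assume "k \<in> L" "l \<in> L"
      then have "k \<ge> 1" "l \<ge> 1" using L(2) by (metis One_nat_def Suc_leI neq0_conv)+
      then show "(\<integral>y. indicator {-pi..pi} y *\<^sub>R (complex_of_real (sn k y) * cnj (complex_of_real (sn l y))) \<partial>lborel) = (if k = l then of_real pi else 0)"
        by (rule sn_orthogonal)
    qed
    then show ?thesis by (simp add: sum_distrib_left)
  qed
  also have "\<dots> = 2 * (a + 1) * (\<Sum>j\<in>modes a N L. pi * (norm (b j))\<^sup>2)"
    by (rule slab_integral_xcoeff[OF a N L(1)])
  finally show ?thesis by (simp add: sum_distrib_left mult_ac)
qed

lemma sum_inverse_squares_le: "finite L \<Longrightarrow> 0 \<notin> L \<Longrightarrow> (\<Sum>k\<in>L. 1 / (real k)\<^sup>2) \<le> 2"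
proof -
  assume L: "finite L" "0 \<notin> L"
  have step: "1 / (real (Suc n))\<^sup>2 \<le> 1 / real n - 1 / real (Suc n)" if "n > 0" for n
  proof -
    have "1 / real n - 1 / real (Suc n) = 1 / (real n * real (Suc n))" using that by (simp add: field_simps)
    also have "\<dots> \<ge> 1 / (real (Suc n))\<^sup>2" 
      unfolding power2_eq_square using that by (intro divide_left_mono mult_right_mono) auto
    finally show ?thesis .
  qed
  have *: "(\<Sum>k\<in>{1..n}. 1 / (real k)\<^sup>2) \<le> 2 - 1 / real n" if "n > 0" for n
    using that
  proof (induction n rule: nat_induct_non_zero)
    case (Suc n)
    then show ?case using step[of n] by simp
  qed simp
  show ?thesis
  proof (cases "L = {}")
    case False
    then have M: "Max L > 0" using L by (metis Max_in gr0I)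
    have "L \<subseteq> {1..Max L}" using L by (auto simp: Suc_le_eq intro!: Nat.gr0I)
    then have "(\<Sum>k\<in>L. 1 / (real k)\<^sup>2) \<le> (\<Sum>k\<in>{1..Max L}. 1 / (real k)\<^sup>2)"
      by (intro sum_mono2) auto
    also have "\<dots> \<le> 2 - 1 / real (Max L)" using *[OF M] .
    finally show ?thesis by (rule order_trans) simp
  qed simp
qed

text \<open>As \<open>\<bar>sin (k (y + \<pi>) / 2)\<bar> \<le> k cos (y/2)\<close>, this bounds a trigonometric sum divided by \<open>cos (y/2)\<close>;
  summability of \<open>1/k\<^sup>2\<close> controls it in \<open>L\<^sup>2\<close> by the coefficients weighted with \<open>k\<^sup>2\<close>.\<close>

definition majorant :: "real \<Rightarrow> int set \<Rightarrow> nat set \<Rightarrow> (real \<times> nat \<Rightarrow> complex) \<Rightarrow> real \<times> real \<Rightarrow> real" where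
  "majorant a N L b p = indicator (slab a) p * (\<Sum>k\<in>L. real k * norm (xcoeff a N b k (fst p)))"

lemma flat_trig_le_majorant:
  assumes "a > 0" "p \<in> slab a" "\<bar>snd p\<bar> < pi"
  shows "norm (flat_trig (modes a N L) b p) \<le> cos (snd p / 2) * majorant a N L b p"
proof -
  obtain x y where p: "p = (x, y)" by (cases p)
  have "norm (flat_trig (modes a N L) b p) \<le> (\<Sum>k\<in>L. norm (xcoeff a N b k x) * \<bar>sn k y\<bar>)"
    unfolding p flat_trig_modes[OF assms(1)] by (rule order_trans[OF norm_sum]) (simp add: norm_mult)
  also have "\<dots> \<le> (\<Sum>k\<in>L. norm (xcoeff a N b k x) * (real k * cos (y/2)))"
    using assms by (intro sum_mono mult_left_mono sn_bound) (auto simp: p)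
  also have "\<dots> = cos (snd p / 2) * majorant a N L b p" using assms by (simp add: majorant_def p sum_distrib_left mult_ac)
  finally show ?thesis .
qed

lemma majorant_measurable: "majorant a N L b \<in> borel_measurable borel"
proof -
  have "(\<lambda>p. (\<Sum>k\<in>L. real k * norm (xcoeff a N b k (fst p)))) \<in> borel_measurable borel"
    by (intro borel_measurable_continuous_onI continuous_intros continuous_on_compose2[OF continuous_xcoeff[of UNIV]]) auto
  moreover have "slab a \<in> sets borel" by (simp add: slab_def)
  ultimately show ?thesis unfolding majorant_def[abs_def] by measurable
qed

lemma nrm_majorant:
  assumes a: "a > 0" and N: "finite N" and L: "finite L" "0 \<notin> L"
  shows "(nrm (\<lambda>p. of_real (majorant a N L b p)))\<^sup>2 \<le> 8 * pi * (a + 1) * (\<Sum>j\<in>modes a N L. real (snd j) ^ 4 * (norm (b j))\<^sup>2)"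
    and "sqi (\<lambda>p. of_real (majorant a N L b p))"
proof -
  let ?s = "\<lambda>x. \<Sum>k\<in>L. real k * norm (xcoeff a N b k x)" and ?t = "\<lambda>x. 2 * (\<Sum>k\<in>L. real k ^ 4 * (norm (xcoeff a N b k x))\<^sup>2)"
  have cs: "(?s x)\<^sup>2 \<le> ?t x" for x
  proof -
    \<comment> \<open>Writing k as (1/k) k^2 before applying Cauchy-Schwarz isolates the summable
      factor 1/k^2, whose sum is at most 2; this is the factor 2 in \<open>?t\<close>.\<close>
    have "?s x = (\<Sum>k\<in>L. (1 / real k) * (real k ^ 2 * norm (xcoeff a N b k x)))"
      using L by (intro sum.cong refl) (auto simp: power2_eq_square)
    then have "(?s x)\<^sup>2 \<le> (\<Sum>k\<in>L. (1 / real k)\<^sup>2) * (\<Sum>k\<in>L. (real k ^ 2 * norm (xcoeff a N b k x))\<^sup>2)"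
      using Cauchy_Schwarz_ineq_sum[of "\<lambda>k. 1 / real k" "\<lambda>k. real k ^ 2 * norm (xcoeff a N b k x)" L] by simp
    also have "\<dots> \<le> 2 * (\<Sum>k\<in>L. (real k ^ 2 * norm (xcoeff a N b k x))\<^sup>2)"
      using sum_inverse_squares_le[OF L] by (intro mult_right_mono sum_nonneg) (auto simp: power_divide)
    finally show ?thesis by (simp add: power_mult_distrib flip: power_mult)
  qed
  have c: "continuous_on UNIV (\<lambda>p::real \<times> real. (?s (fst p))\<^sup>2)" "continuous_on UNIV (\<lambda>p::real \<times> real. ?t (fst p))"
    by (intro continuous_intros continuous_on_compose2[OF continuous_xcoeff[of UNIV]]; auto)+
  have eq: "(norm (complex_of_real (majorant a N L b p)))\<^sup>2 = indicator (slab a) p * (?s (fst p))\<^sup>2" for p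
    by (simp only: norm_of_real majorant_def) (auto simp: indicator_def)
  note i = slab_integral_product[where f = "\<lambda>x y. (?s x)\<^sup>2", OF c(1), of a] and j = slab_integral_product[where f = "\<lambda>x y. ?t x", OF c(2), of a]
  show "sqi (\<lambda>p. of_real (majorant a N L b p))"
    using borel_imp_lebesgue_measurable[OF majorant_measurable] i(2) unfolding sqi_def eq by simp
  have "(nrm (\<lambda>p. of_real (majorant a N L b p)))\<^sup>2 = (\<integral>p. indicator (slab a) p * (?s (fst p))\<^sup>2 \<partial>lebesgue)"
    unfolding nrm_sq eq ..
  also have "\<dots> \<le> (\<integral>p. indicator (slab a) p * ?t (fst p) \<partial>lebesgue)"
    by (rule integral_mono[OF i(2) j(2)]) (use cs in \<open>auto intro!: mult_left_mono\<close>)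
  also have "\<dots> = (\<integral>x. indicator {-(a+1)..a+1} x * (\<integral>y. indicator {-pi..pi} y * ?t x \<partial>lborel) \<partial>lborel)" by (rule j(1))
  also have "\<dots> = (\<integral>x. indicator {-(a+1)..a+1} x * (\<Sum>k\<in>L. (4 * pi * real k ^ 4) * (norm (xcoeff a N b k x))\<^sup>2) \<partial>lborel)"
  proof -
    have "(\<integral>y. indicator {-pi..pi} y * ?t x \<partial>lborel) = (\<Sum>k\<in>L. (4 * pi * real k ^ 4) * (norm (xcoeff a N b k x))\<^sup>2)" for x
      by (simp add: integral_mult_left_zero sum_distrib_left mult_ac)
    then show ?thesis by simp
  qed
  also have "\<dots> = 2 * (a + 1) * (\<Sum>j\<in>modes a N L. (4 * pi * real (snd j) ^ 4) * (norm (b j))\<^sup>2)"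
    by (rule slab_integral_xcoeff[OF a N L(1)])
  finally show "(nrm (\<lambda>p. of_real (majorant a N L b p)))\<^sup>2 \<le> 8 * pi * (a + 1) * (\<Sum>j\<in>modes a N L. real (snd j) ^ 4 * (norm (b j))\<^sup>2)"
    by (simp only: mult.assoc sum_distrib_left[symmetric]) (simp add: algebra_simps)
qed

section \<open>Density of trigonometric sums\<close>

lemma nrm_dominated_tendsto_0:
  assumes D: "sqi D" and m: "\<And>n. h n \<in> borel_measurable lebesgue" 
    and bd: "\<And>n. AE p in lebesgue. norm (h n p) \<le> norm (D p)" 
    and lim: "AE p in lebesgue. (\<lambda>n. h n p) \<longlonglongrightarrow> 0"
  shows "(\<lambda>n. nrm (h n)) \<longlonglongrightarrow> 0"
proof -
  have "(\<lambda>n. \<integral>p. (norm (h n p))\<^sup>2 \<partial>lebesgue) \<longlonglongrightarrow> (\<integral>p. 0 \<partial>(lebesgue :: (real \<times> real) measure))"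
  proof (rule integral_dominated_convergence)
    show "integrable lebesgue (\<lambda>p. (norm (D p))\<^sup>2)" using D by (simp add: sqi_def)
    show "(\<lambda>p. (norm (h n p))\<^sup>2) \<in> borel_measurable lebesgue" for n using m by measurable
    show "AE p in lebesgue. (\<lambda>n. (norm (h n p))\<^sup>2) \<longlonglongrightarrow> 0" 
      using lim by eventually_elim (metis tendsto_norm_zero tendsto_null_power zero_less_numeral)
    show "AE p in lebesgue. norm ((norm (h n p))\<^sup>2) \<le> (norm (D p))\<^sup>2" for n
      using bd[of n] by eventually_elim (simp add: power_mono)
  qed simp
  then have "(\<lambda>n. sqrt (\<integral>p. (norm (h n p))\<^sup>2 \<partial>lebesgue)) \<longlonglongrightarrow> sqrt 0"
    by (intro tendsto_real_sqrt) simp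
  then show ?thesis by (simp add: nrm_def)
qed

lemma sqi_slab_continuous:
  assumes "continuous_on UNIV g"
  shows "sqi (\<lambda>p. indicator (slab a) p * g p)"
proof -
  have "bounded (g ` slab a)"
    by (intro compact_imp_bounded compact_continuous_image continuous_on_subset[OF assms]) (auto simp: slab_def)
  then obtain B where B: "\<forall>p\<in>slab a. norm (g p) \<le> B" unfolding bounded_iff by auto
  have sm: "slab a \<in> sets borel" by (simp add: slab_def)
  show ?thesis
  proof (rule sqi_bounded_support[OF _ slab_lmeasurable])
    show "(\<lambda>p. indicator (slab a) p * g p) \<in> borel_measurable lebesgue"
      by (intro measurable_completion) (use borel_measurable_times[OF borel_measurable_indicator[OF sm] borel_measurable_continuous_onI[OF assms]] in simp)
    show "norm (indicator (slab a) p * g p) \<le> B * indicator (slab a) p" for p using B by (cases "p \<in> slab a") auto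
  qed
qed

text \<open>The radial projection onto the disc of radius M. Being continuous and bounded, it makes
  continuous approximants uniformly bounded without leaving the continuous functions.\<close>

definition clamp_norm :: "real \<Rightarrow> complex \<Rightarrow> complex" where "clamp_norm M z = z / of_real (max 1 (norm z / M))"

lemma clamp_norm:
  assumes "M > 0"
  shows "norm (clamp_norm M z) \<le> M" "norm (z - clamp_norm M z) \<le> norm z" "norm z \<le> M \<Longrightarrow> clamp_norm M z = z" 
    "continuous_on UNIV (clamp_norm M)"
proof -
  let ?m = "max 1 (norm z / M)"
  have m: "?m \<ge> 1" "norm z / M \<le> ?m" by auto
  have n: "norm (clamp_norm M z) = norm z / ?m" unfolding clamp_norm_def norm_divide norm_of_real by simp
  have "norm z \<le> M * ?m" using mult_left_mono[OF m(2), of M] assms by simp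
  then show "norm (clamp_norm M z) \<le> M" unfolding n using m(1) by (simp add: divide_le_eq)
  have "z - z / of_real m = z * of_real (1 - 1 / m)" for m :: real by (simp add: right_diff_distrib)
  then have "z - clamp_norm M z = z * of_real (1 - 1 / ?m)" unfolding clamp_norm_def .
  then have "norm (z - clamp_norm M z) = norm z * \<bar>1 - 1 / ?m\<bar>" by (simp only: norm_mult norm_of_real)
  also have "\<dots> \<le> norm z * 1" 
  proof (rule mult_left_mono)
    have "0 < 1 / ?m" "1 / ?m \<le> 1" using m(1) by auto
    then show "\<bar>1 - 1 / ?m\<bar> \<le> 1" by linarith
  qed simp
  finally show "norm (z - clamp_norm M z) \<le> norm z" by simp
  show "norm z \<le> M \<Longrightarrow> clamp_norm M z = z" using assms by (simp add: clamp_norm_def max_def)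
  have "max 1 (norm z / M) \<noteq> 0" for z :: complex by (metis max.cobounded1 not_one_le_zero)
  then show "continuous_on UNIV (clamp_norm M)"
    unfolding clamp_norm_def[abs_def] using assms by (intro continuous_intros) auto
qed

text \<open>A measurable function is an almost everywhere limit of continuous functions, but with no
  domination. Therefore f is first truncated, with small L2 error, and the approximants are
  truncated in the same way; dominated convergence on the bounded slab finishes.\<close>

lemma continuous_dense_L2:
  assumes f: "sqi f" and e: "e > 0"
  obtains g where "continuous_on UNIV g" "nrm (\<lambda>p. indicator (slab a) p * (f p - g p)) < e"
proof -
  have fm: "f \<in> borel_measurable lebesgue" using f by (simp add: sqi_def)
  have sm: "slab a \<in> sets borel" by (simp add: slab_def)
  have im: "indicator (slab a) \<in> borel_measurable (lebesgue :: (real \<times> real) measure)" 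
    using sm by (intro borel_measurable_indicator) simp
  have cm: "(\<lambda>p. clamp_norm M (h p)) \<in> borel_measurable lebesgue" if "M > 0" "h \<in> borel_measurable lebesgue" for M h
    using borel_measurable_continuous_onI[OF clamp_norm(4)[OF that(1)]] that(2) by measurable
  have "(\<lambda>n. nrm (\<lambda>p. f p - clamp_norm (real (Suc n)) (f p))) \<longlonglongrightarrow> 0"
  proof (rule nrm_dominated_tendsto_0[OF f])
    show "(\<lambda>p. f p - clamp_norm (real (Suc n)) (f p)) \<in> borel_measurable lebesgue" for n
      by (intro borel_measurable_diff fm cm) simp
    show "AE p in lebesgue. norm (f p - clamp_norm (real (Suc n)) (f p)) \<le> norm (f p)" for n
      by (intro AE_I2 clamp_norm) simp
    show "AE p in lebesgue. (\<lambda>n. f p - clamp_norm (real (Suc n)) (f p)) \<longlonglongrightarrow> 0"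
    proof (rule AE_I2, rule tendsto_eventually)
      fix p
      obtain n0 where "norm (f p) \<le> real n0" using real_arch_simple by blast
      then show "\<forall>\<^sub>F n in sequentially. f p - clamp_norm (real (Suc n)) (f p) = 0"
        by (intro eventually_sequentiallyI[of n0]) (auto simp: clamp_norm(3))
    qed
  qed
  then have "\<forall>\<^sub>F n in sequentially. nrm (\<lambda>p. f p - clamp_norm (real (Suc n)) (f p)) < e / 2"
    using e by (intro order_tendstoD(2)) auto
  then obtain n where n: "nrm (\<lambda>p. f p - clamp_norm (real (Suc n)) (f p)) < e / 2"
    using eventually_happens by fastforce
  define M where "M = real (Suc n)"
  have M: "M > 0" by (simp add: M_def)
  have "f measurable_on UNIV" using fm by (intro lebesgue_measurable_imp_measurable_on) (auto simp: lebesgue_on_UNIV_eq)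
  then obtain N g where N: "negligible N" and g: "\<And>n. continuous_on UNIV (g n)" "\<And>p. p \<notin> N \<Longrightarrow> (\<lambda>n. g n p) \<longlonglongrightarrow> f p"
    unfolding measurable_on_def by auto
  have gm: "g n \<in> borel_measurable lebesgue" for n
    using borel_measurable_continuous_onI[OF g(1)] by (intro measurable_completion) simp
  have "(\<lambda>n. nrm (\<lambda>p. indicator (slab a) p * (clamp_norm M (f p) - clamp_norm M (g n p)))) \<longlonglongrightarrow> 0"
  proof (rule nrm_dominated_tendsto_0)
    show "sqi (\<lambda>p. indicator (slab a) p * of_real (2 * M))" by (rule sqi_slab_continuous) (intro continuous_intros)
    show "(\<lambda>p. indicator (slab a) p * (clamp_norm M (f p) - clamp_norm M (g n p))) \<in> borel_measurable lebesgue" for n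
      using cm[OF M fm] cm[OF M gm] im by (intro borel_measurable_times borel_measurable_diff) auto
    have b: "norm (clamp_norm M z - clamp_norm M w) \<le> 2 * M" for z w
      using norm_triangle_ineq4[of "clamp_norm M z" "clamp_norm M w"] clamp_norm(1)[OF M, of z] clamp_norm(1)[OF M, of w] by linarith
    show "AE p in lebesgue. norm (indicator (slab a) p * (clamp_norm M (f p) - clamp_norm M (g n p))) \<le> norm (indicator (slab a) p * complex_of_real (2 * M))" for n
      using b M by (intro AE_I2) (auto simp: norm_mult indicator_def)
    have "AE p in lebesgue. p \<notin> N" using N by (simp add: negligible_iff_null_sets AE_not_in)
    then show "AE p in lebesgue. (\<lambda>n. indicator (slab a) p * (clamp_norm M (f p) - clamp_norm M (g n p))) \<longlonglongrightarrow> 0"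
    proof eventually_elim
      case (elim p)
      have "(\<lambda>n. clamp_norm M (g n p)) \<longlonglongrightarrow> clamp_norm M (f p)"
        by (rule continuous_on_tendsto_compose[OF clamp_norm(4)[OF M] g(2)[OF elim]]) auto
      then have "(\<lambda>n. indicator (slab a) p * (clamp_norm M (f p) - clamp_norm M (g n p))) \<longlonglongrightarrow> indicator (slab a) p * (clamp_norm M (f p) - clamp_norm M (f p))"
        by (intro tendsto_intros)
      then show ?case by simp
    qed
  qed
  then have "\<forall>\<^sub>F n in sequentially. nrm (\<lambda>p. indicator (slab a) p * (clamp_norm M (f p) - clamp_norm M (g n p))) < e / 2"
    using e by (intro order_tendstoD(2)) auto
  then obtain k where k: "nrm (\<lambda>p. indicator (slab a) p * (clamp_norm M (f p) - clamp_norm M (g k p))) < e / 2"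
    using eventually_happens by fastforce
  have gc: "continuous_on UNIV (\<lambda>p. clamp_norm M (g k p))"
    by (rule continuous_on_compose2[OF clamp_norm(4)[OF M] g(1)]) auto
  have s0: "sqi (\<lambda>p. f p - clamp_norm M (f p))"
    by (rule sqi_dominated[OF f, of _ 1]) (use fm cm[OF M fm] clamp_norm(2)[OF M] in auto)
  have s1: "sqi (\<lambda>p. indicator (slab a) p * (f p - clamp_norm M (f p)))"
    by (rule sqi_mult_bounded[OF s0 im, of 1]) (auto simp: indicator_def)
  have s2: "sqi (\<lambda>p. indicator (slab a) p * (clamp_norm M (f p) - clamp_norm M (g k p)))"
  proof -
    have "sqi (\<lambda>p. indicator (slab a) p * f p)" by (rule sqi_mult_bounded[OF f im, of 1]) (auto simp: indicator_def)
    from sqi_diff[OF sqi_diff[OF this s1] sqi_slab_continuous[OF gc, of a]] show ?thesis by (simp add: algebra_simps)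
  qed
  have "nrm (\<lambda>p. indicator (slab a) p * (f p - clamp_norm M (g k p))) = 
     nrm (\<lambda>p. indicator (slab a) p * (f p - clamp_norm M (f p)) + indicator (slab a) p * (clamp_norm M (f p) - clamp_norm M (g k p)))"
    by (simp add: algebra_simps)
  also have "\<dots> \<le> nrm (\<lambda>p. indicator (slab a) p * (f p - clamp_norm M (f p))) + nrm (\<lambda>p. indicator (slab a) p * (clamp_norm M (f p) - clamp_norm M (g k p)))"
    by (rule nrm_triangle[OF s1 s2])
  also have "nrm (\<lambda>p. indicator (slab a) p * (f p - clamp_norm M (f p))) \<le> 1 * nrm (\<lambda>p. f p - clamp_norm M (f p))"
    by (rule nrm_mult_bounded[OF s0 im]) (auto simp: indicator_def)
  finally have "nrm (\<lambda>p. indicator (slab a) p * (f p - clamp_norm M (g k p))) < e"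
    using n k by (simp add: M_def)
  then show ?thesis using that gc by blast
qed

text \<open>The generators are multipliers that keep the span of the modes invariant: the cosine
  moves n by one in both directions and sin (y/2) moves k by one in both directions. They form a
  real algebra to which Stone-Weierstrass applies, but one of functions even in x.\<close>

inductive_set mult_alg :: "real \<Rightarrow> (real \<times> real \<Rightarrow> real) set" for a where
  ma_const: "(\<lambda>p. c) \<in> mult_alg a"
| ma_x: "(\<lambda>p. cos (pi / (a + 1) * fst p)) \<in> mult_alg a"
| ma_y: "(\<lambda>p. sin (snd p / 2)) \<in> mult_alg a"
| ma_add: "f \<in> mult_alg a \<Longrightarrow> g \<in> mult_alg a \<Longrightarrow> (\<lambda>p. f p + g p) \<in> mult_alg a"
| ma_mult: "f \<in> mult_alg a \<Longrightarrow> g \<in> mult_alg a \<Longrightarrow> (\<lambda>p. f p * g p) \<in> mult_alg a"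

lemma mult_alg_continuous: "f \<in> mult_alg a \<Longrightarrow> continuous_on S f"
proof (induction rule: mult_alg.induct)
  case ma_x
  have "continuous_on S (\<lambda>p::real \<times> real. cos (c * fst p))" for c by (intro continuous_intros)
  then show ?case .
qed (auto intro!: continuous_intros)

lemma mult_alg_even: "f \<in> mult_alg a \<Longrightarrow> f (- x, y) = f (x, y)"
  by (induction rule: mult_alg.induct) auto

text \<open>Stone-Weierstrass is used on the half of the slab with x \<ge> 0, where cos (pi x / (a +
  1)) is injective, so that the generators separate points. Evenness in x transfers the
  approximation to the other half.\<close>

lemma mult_alg_dense:
  assumes a: "a > 0" and g: "continuous_on UNIV g" and ev: "\<And>x y. g (- x, y) = g (x, y)" and e: "e > 0"
  obtains h where "h \<in> mult_alg a" "\<And>p. p \<in> slab a \<Longrightarrow> \<bar>g p - h p\<bar> < e"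
proof -
  let ?S = "cbox (0, - pi) (a + 1, pi)"
  have "\<exists>h. h \<in> mult_alg a \<and> (\<forall>p\<in>?S. \<bar>g p - h p\<bar> < e)"
  proof (rule Stone_Weierstrass_HOL)
    show "(\<lambda>x. c) \<in> mult_alg a" for c by (rule ma_const)
    show "continuous_on ?S f" if "f \<in> mult_alg a" for f using mult_alg_continuous[OF that] .
    show "(\<lambda>x. f x + h x) \<in> mult_alg a" "(\<lambda>x. f x * h x) \<in> mult_alg a" if "f \<in> mult_alg a \<and> h \<in> mult_alg a" for f h
      using that by (auto intro: ma_add ma_mult)
    show "\<exists>f. f \<in> mult_alg a \<and> f p \<noteq> f q" if pq: "p \<in> ?S \<and> q \<in> ?S \<and> p \<noteq> q" for p q
    proof (cases "fst p = fst q")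
      case False
      have r: "0 \<le> pi / (a + 1) * fst r" "pi / (a + 1) * fst r \<le> pi" if "r \<in> ?S" for r
      proof -
        have x: "0 \<le> fst r" "fst r \<le> a + 1" using that by (cases r; simp add: cbox_Pair_eq)+
        show "0 \<le> pi / (a + 1) * fst r" using x(1) a by simp
        have "pi / (a + 1) * fst r \<le> pi / (a + 1) * (a + 1)" using x(2) a by (intro mult_left_mono) auto
        then show "pi / (a + 1) * fst r \<le> pi" using a by simp
      qed
      have "pi / (a + 1) * fst p \<noteq> pi / (a + 1) * fst q" using False a by simp
      then have "cos (pi / (a + 1) * fst p) \<noteq> cos (pi / (a + 1) * fst q)" using r[of p] r[of q] pq cos_inj_pi by blast
      then show ?thesis using ma_x by (intro exI[of _ "\<lambda>p. cos (pi / (a + 1) * fst p)"]) auto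
    next
      case True
      then have "snd p \<noteq> snd q" using pq prod_eqI by blast
      moreover have "- (pi/2) \<le> snd r / 2" "snd r / 2 \<le> pi / 2" if "r \<in> ?S" for r
        using that by (cases r; auto simp: cbox_Pair_eq)+
      ultimately have "sin (snd p / 2) \<noteq> sin (snd q / 2)" using pq sin_inj_pi[of "snd p / 2" "snd q / 2"] by auto
      then show ?thesis using ma_y by (intro exI[of _ "\<lambda>p. sin (snd p / 2)"]) auto
    qed
    show "continuous_on ?S g" using g continuous_on_subset by blast
  qed (use e in auto)
  then obtain h where h: "h \<in> mult_alg a" "\<And>p. p \<in> ?S \<Longrightarrow> \<bar>g p - h p\<bar> < e" by blast
  have "\<bar>g p - h p\<bar> < e" if "p \<in> slab a" for p
  proof (cases p)
    case (Pair x y)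
    show ?thesis
    proof (cases "x \<ge> 0")
      case True
      then show ?thesis using h(2)[of p] that Pair by (auto simp: slab_iff cbox_Pair_eq abs_le_iff)
    next
      case False
      then show ?thesis using h(2)[of "(-x, y)"] that Pair ev[of x y] mult_alg_even[OF h(1), of x y] 
        by (auto simp: slab_iff cbox_Pair_eq abs_le_iff)
    qed
  qed
  then show ?thesis using that h(1) by blast
qed

text \<open>Since \<open>g - g w\<^sup>2 / (w\<^sup>2 + \<eta>)\<close> tends to \<open>0\<close> in \<open>L\<^sup>2\<close> as \<open>\<eta> \<rightarrow> 0\<close>, multiples of a fixed weight \<open>w\<close>
  by continuous functions remain dense even though \<open>w\<close> may vanish on a null set.\<close>

lemma weighted_mult_alg_dense:
  fixes g w :: "real \<times> real \<Rightarrow> real"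
  assumes a: "a > 0" and g: "continuous_on UNIV g" and w: "continuous_on UNIV w"
    and ev: "\<And>x y. g (- x, y) * w (- x, y) = g (x, y) * w (x, y)" "\<And>x y. \<bar>w (- x, y)\<bar> = \<bar>w (x, y)\<bar>"
    and nz: "AE p in lebesgue. p \<in> slab a \<longrightarrow> w p \<noteq> 0" and e: "e > 0"
  obtains h where "h \<in> mult_alg a" "nrm (\<lambda>p. indicator (slab a) p * of_real (g p - w p * h p)) < e"
proof -
  define \<eta> where "\<eta> n = inverse (real (Suc n))" for n
  have \<eta>: "\<eta> n > 0" for n by (simp add: \<eta>_def)
  have pos: "(w p)\<^sup>2 + \<eta> n > 0" for n p using \<eta>[of n] by (intro add_nonneg_pos) auto
  \<comment> \<open>The remainder of g after subtracting w times the regularised quotient g w / (w^2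
    + \<eta>). It is bounded by \<bar>g\<bar> and tends to 0 wherever w is not 0.\<close>
  define r where "r n p = g p * \<eta> n / ((w p)\<^sup>2 + \<eta> n)" for n p
  have rc: "continuous_on UNIV (r n)" for n
    unfolding r_def[abs_def] using g w pos[of _ n] by (intro continuous_intros) (auto simp: less_le)
  have rle: "\<bar>r n p\<bar> \<le> \<bar>g p\<bar>" for n p
  proof -
    have "\<bar>r n p\<bar> = \<bar>g p\<bar> * (\<eta> n / ((w p)\<^sup>2 + \<eta> n))" using \<eta>[of n] pos[of p n] by (simp add: r_def abs_mult)
    also have "\<dots> \<le> \<bar>g p\<bar> * 1" using \<eta>[of n] pos[of p n] by (intro mult_left_mono) auto
    finally show ?thesis by simp
  qed
  have "(\<lambda>n. nrm (\<lambda>p. indicator (slab a) p * of_real (r n p))) \<longlonglongrightarrow> 0"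
  proof (rule nrm_dominated_tendsto_0)
    show "sqi (\<lambda>p. indicator (slab a) p * of_real (g p))" by (intro sqi_slab_continuous continuous_on_of_real g)
    show "(\<lambda>p. indicator (slab a) p * complex_of_real (r n p)) \<in> borel_measurable lebesgue" for n
      by (rule sqiD(1)[OF sqi_slab_continuous]) (intro continuous_on_of_real rc)
    show "AE p in lebesgue. norm (indicator (slab a) p * complex_of_real (r n p)) \<le> norm (indicator (slab a) p * complex_of_real (g p))" for n
      using rle by (intro AE_I2) (auto simp: norm_mult intro!: mult_left_mono)
    show "AE p in lebesgue. (\<lambda>n. indicator (slab a) p * complex_of_real (r n p)) \<longlonglongrightarrow> 0"
      using nz
    proof eventually_elim
      case (elim p)
      show ?case
      proof (cases "p \<in> slab a")
        case True
        then have "w p \<noteq> 0" using elim by simp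
        then have "(\<lambda>n. g p * \<eta> n / ((w p)\<^sup>2 + \<eta> n)) \<longlonglongrightarrow> g p * 0 / ((w p)\<^sup>2 + 0)"
          unfolding \<eta>_def by (intro tendsto_intros LIMSEQ_inverse_real_of_nat) auto
        then have "(\<lambda>n. r n p) \<longlonglongrightarrow> 0" by (simp only: r_def mult_zero_right div_0)
        then have "(\<lambda>n. complex_of_real (r n p)) \<longlonglongrightarrow> of_real 0" by (rule tendsto_of_real)
        then show ?thesis using True by simp
      qed simp
    qed
  qed
  then have "\<forall>\<^sub>F n in sequentially. nrm (\<lambda>p. indicator (slab a) p * of_real (r n p)) < e / 2"
    using e by (intro order_tendstoD(2)) auto
  then obtain n where n: "nrm (\<lambda>p. indicator (slab a) p * of_real (r n p)) < e / 2"
    using eventually_happens by fastforce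
  let ?k = "\<lambda>p. g p * w p / ((w p)\<^sup>2 + \<eta> n)"
  let ?W = "nrm (\<lambda>p. indicator (slab a) p * of_real (w p))"
  have kc: "continuous_on UNIV ?k" using g w pos[of _ n] by (intro continuous_intros) (auto simp: less_le)
  \<comment> \<open>Evenness is asked of g w and of \<bar>w\<bar>, not of g and w, so that the case
    where both are odd in x is covered as well.\<close>
  have kev: "?k (- x, y) = ?k (x, y)" for x y
    using ev(1)[of x y] ev(2)[of x y] by (metis power2_abs)
  define e' where "e' = e / (2 * (?W + 1))"
  have W: "?W + 1 > 0" using nrm_nonneg add_nonneg_pos zero_less_one by blast
  have e': "e' > 0" using e W by (simp add: e'_def)
  obtain h where h: "h \<in> mult_alg a" "\<And>p. p \<in> slab a \<Longrightarrow> \<bar>?k p - h p\<bar> < e'"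
    using mult_alg_dense[OF a kc kev e'] by metis
  have hc: "continuous_on UNIV h" using mult_alg_continuous[OF h(1)] .
  have s: "sqi (\<lambda>p. indicator (slab a) p * of_real (r n p))" "sqi (\<lambda>p. indicator (slab a) p * of_real (w p * (?k p - h p)))"
    "sqi (\<lambda>p. indicator (slab a) p * of_real (w p))"
    by (intro sqi_slab_continuous continuous_on_of_real continuous_on_mult continuous_on_diff rc w kc hc)+
  have eq: "g p - w p * h p = r n p + w p * (?k p - h p)" for p
  proof -
    have "r n p + w p * ?k p = g p * ((w p)\<^sup>2 + \<eta> n) / ((w p)\<^sup>2 + \<eta> n)"
      by (simp add: r_def add_divide_distrib[symmetric] power2_eq_square algebra_simps)
    also have "\<dots> = g p" using pos[of p n] by simp
    finally show ?thesis by (simp add: algebra_simps)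
  qed
  have "nrm (\<lambda>p. indicator (slab a) p * of_real (g p - w p * h p)) = 
    nrm (\<lambda>p. indicator (slab a) p * of_real (r n p) + indicator (slab a) p * of_real (w p * (?k p - h p)))"
    unfolding eq by (simp only: of_real_add distrib_left)
  also have "\<dots> \<le> nrm (\<lambda>p. indicator (slab a) p * of_real (r n p)) + nrm (\<lambda>p. indicator (slab a) p * of_real (w p * (?k p - h p)))"
    by (rule nrm_triangle[OF s(1,2)])
  also have "nrm (\<lambda>p. indicator (slab a) p * of_real (w p * (?k p - h p))) \<le> e' * ?W"
  proof (rule nrm_le[OF s(3) sqiD(1)[OF s(2)]])
    have "norm (indicator (slab a) p * complex_of_real (w p * (?k p - h p))) \<le> e' * norm (indicator (slab a) p * complex_of_real (w p))" for p
    proof (cases "p \<in> slab a")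
      case True
      have "\<bar>w p\<bar> * \<bar>?k p - h p\<bar> \<le> \<bar>w p\<bar> * e'" using h(2)[OF True] by (intro mult_left_mono) auto
      then show ?thesis using True by (simp only: norm_mult norm_of_real abs_mult) (simp add: mult.commute)
    qed simp
    then show "AE p in lebesgue. norm (indicator (slab a) p * complex_of_real (w p * (?k p - h p))) \<le> e' * norm (indicator (slab a) p * complex_of_real (w p))"
      by (intro AE_I2)
  qed (use e' in simp)
  also have "e' * ?W \<le> e / 2"
  proof -
    have "e' * ?W \<le> e' * (?W + 1)" using e' by (intro mult_left_mono) auto
    also have "\<dots> = e / 2"
    proof -
      have "e / (2 * t) * t = e / 2" if "t > 0" for t :: real using that by simp
      from this[OF W] show ?thesis unfolding e'_def .
    qed
    finally show ?thesis .
  qed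
  finally show ?thesis using that[OF h(1)] n by simp
qed

definition emode :: "real \<Rightarrow> int \<Rightarrow> nat \<Rightarrow> real \<times> real \<Rightarrow> complex" where
  "emode a n k p = cis (freq a n * fst p) * of_real (sn k (snd p))"

inductive_set tspan :: "real \<Rightarrow> (real \<times> real \<Rightarrow> complex) set" for a where
  ts_base: "k \<ge> 1 \<Longrightarrow> emode a n k \<in> tspan a"
| ts_add: "f \<in> tspan a \<Longrightarrow> g \<in> tspan a \<Longrightarrow> (\<lambda>p. f p + g p) \<in> tspan a"
| ts_scale: "f \<in> tspan a \<Longrightarrow> (\<lambda>p. c * f p) \<in> tspan a"

text \<open>The mode with k = 0 is identically 0. It turns up when multiplication by sin (y/2)
  lowers k from 1.\<close>

lemma emode_in_tspan: "emode a n k \<in> tspan a"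
proof (cases "k \<ge> 1")
  case False
  have "(\<lambda>p. 0 * emode a n 1 p) \<in> tspan a" by (intro ts_scale ts_base) simp
  moreover have "k = 0" using False by simp
  then have "emode a n k = (\<lambda>p. 0 * emode a n 1 p)" by (simp add: emode_def[abs_def] sn_def)
  ultimately show ?thesis by (simp only:)
qed (rule ts_base)

lemma flat_trig_extend:
  assumes "finite B" "A \<subseteq> B"
  shows "flat_trig A c = flat_trig B (\<lambda>j. if j \<in> A then c j else 0)"
  unfolding flat_trig_def using assms by (intro ext sum.mono_neutral_cong_left) auto

lemma tspan_flat_trig:
  assumes "f \<in> tspan a"
  shows "\<exists>N L c. finite N \<and> finite L \<and> 0 \<notin> L \<and> f = flat_trig (modes a N L) c"
  using assms
proof induction
  case (ts_base k n)
  have "emode a n k = flat_trig (modes a {n} {k}) (\<lambda>_. 1)"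
    by (rule ext) (simp add: emode_def flat_trig_def modes_def)
  then show ?case using ts_base by (intro exI[of _ "{n}"] exI[of _ "{k}"] exI[of _ "\<lambda>_. 1"]) auto
next
  case (ts_add f g)
  then obtain N L c N' L' c' where *: "finite N" "finite L" "0 \<notin> L" "f = flat_trig (modes a N L) c"
     "finite N'" "finite L'" "0 \<notin> L'" "g = flat_trig (modes a N' L') c'" by blast
  \<comment> \<open>The union of two products of index sets is not a product in general, so both
    sums are extended by zero coefficients to the product of the unions.\<close>
  let ?A = "modes a (N \<union> N') (L \<union> L')"
  have A: "finite ?A" "modes a N L \<subseteq> ?A" "modes a N' L' \<subseteq> ?A" using * by (auto simp: modes_def)
  have "(\<lambda>p. f p + g p) = flat_trig ?A (\<lambda>j. (if j \<in> modes a N L then c j else 0) + (if j \<in> modes a N' L' then c' j else 0))"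
    unfolding *(4,8) flat_trig_extend[OF A(1,2)] flat_trig_extend[OF A(1,3)]
    unfolding flat_trig_def distrib_right sum.distrib ..
  then show ?case using * by (intro exI[of _ "N \<union> N'"] exI[of _ "L \<union> L'"] exI conjI) auto
next
  case (ts_scale f d)
  then obtain N L c where *: "finite N" "finite L" "0 \<notin> L" "f = flat_trig (modes a N L) c" by blast
  have "(\<lambda>p. d * f p) = flat_trig (modes a N L) (\<lambda>j. d * c j)"
    unfolding *(4) flat_trig_def by (simp add: sum_distrib_left mult.assoc)
  then show ?case using * by (intro exI[of _ N] exI[of _ L] exI conjI) auto
qed

lemma freq_shift: "freq a (n + 1) = freq a n + pi / (a + 1)" "freq a (n - 1) = freq a n - pi / (a + 1)"
proof -
  have "m * (x + 1 + 1/2) = m * (x + 1/2) + m" "m * (x - 1 + 1/2) = m * (x + 1/2) - m" for m x :: real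
    by (simp_all add: algebra_simps)
  then show "freq a (n + 1) = freq a n + pi / (a + 1)" "freq a (n - 1) = freq a n - pi / (a + 1)"
    unfolding freq_def of_int_add of_int_diff of_int_1 by blast+
qed

lemma emode_times_cos: "of_real (cos (pi / (a + 1) * fst p)) * emode a n k p = (1/2) * emode a (n + 1) k p + (1/2) * emode a (n - 1) k p"
proof -
  let ?m = "pi / (a + 1) * fst p" and ?f = "freq a n * fst p"
  have "cis (freq a (n + 1) * fst p) = cis ?f * cis ?m" "cis (freq a (n - 1) * fst p) = cis ?f * cis (- ?m)"
    unfolding cis_mult freq_shift by (simp_all add: algebra_simps)
  moreover have "cis ?m + cis (- ?m) = 2 * of_real (cos ?m)" by (simp add: complex_eq_iff)
  then have "of_real (cos ?m) = (1/2) * cis ?m + (1/2) * cis (- ?m)" by (simp add: field_simps)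
  ultimately show ?thesis by (simp add: emode_def algebra_simps)
qed

lemma emode_times_sin: "of_real (sin (pi / (a + 1) * fst p)) * emode a n k p = (1 / (2 * \<i>)) * emode a (n + 1) k p + (- (1 / (2 * \<i>))) * emode a (n - 1) k p"
proof -
  let ?m = "pi / (a + 1) * fst p" and ?f = "freq a n * fst p"
  have s12: "cis (freq a (n + 1) * fst p) = cis ?f * cis ?m" "cis (freq a (n - 1) * fst p) = cis ?f * cis (- ?m)"
    unfolding cis_mult freq_shift by (simp_all add: algebra_simps)
  have "cis ?m - cis (- ?m) = 2 * \<i> * of_real (sin ?m)" by (simp add: complex_eq_iff)
  then have s3: "of_real (sin ?m) = (1 / (2 * \<i>)) * cis ?m + (- (1 / (2 * \<i>))) * cis (- ?m)" by (simp add: field_simps)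
  have "(b * P + (- b) * Q) * (X * t) = b * ((X * P) * t) + (- b) * ((X * Q) * t)" for b P Q X t :: complex
    by (simp add: algebra_simps)
  then show ?thesis unfolding emode_def s12 s3 .
qed

text \<open>The multiplier equals -cos t with t = (y + pi) / 2, the angle occurring in the sines,
  and 2 cos t sin (k t) = sin ((k+1) t) + sin ((k-1) t).\<close>

lemma emode_times_sin_half:
  assumes "k \<ge> 1" 
  shows "of_real (sin (snd p / 2)) * emode a n k p = (- (1/2)) * emode a n (k + 1) p + (- (1/2)) * emode a n (k - 1) p"
proof -
  let ?t = "(snd p + pi) / 2"
  have "sin (snd p / 2) = - cos ?t" by (simp add: add_divide_distrib cos_add)
  moreover have "sn (k + 1) (snd p) + sn (k - 1) (snd p) = 2 * cos ?t * sn k (snd p)"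
  proof -
    have "real (k + 1) * ?t = real k * ?t + ?t" "real (k - 1) * ?t = real k * ?t - ?t"
      using assms by (simp_all only: of_nat_diff of_nat_add of_nat_1 distrib_right left_diff_distrib mult_1_left)
    then show ?thesis unfolding sn_def by (simp only: sin_add sin_diff) simp
  qed
  then have "cos ?t * sn k (snd p) = (sn (k + 1) (snd p) + sn (k - 1) (snd p)) / 2" by simp
  ultimately have "sin (snd p / 2) * sn k (snd p) = (- (1/2)) * sn (k + 1) (snd p) + (- (1/2)) * sn (k - 1) (snd p)" by simp
  then have "complex_of_real (sin (snd p / 2) * sn k (snd p)) = of_real ((- (1/2)) * sn (k + 1) (snd p) + (- (1/2)) * sn (k - 1) (snd p))" by simp
  then have *: "of_real (sin (snd p / 2)) * complex_of_real (sn k (snd p)) = (- (1/2)) * of_real (sn (k + 1) (snd p)) + (- (1/2)) * of_real (sn (k - 1) (snd p))"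
    by simp
  show ?thesis unfolding emode_def using arg_cong[OF *, of "\<lambda>z. cis (freq a n * fst p) * z"] by (simp add: algebra_simps)
qed

lemma tspan_times:
  assumes "\<And>n k. k \<ge> 1 \<Longrightarrow> (\<lambda>p. m p * emode a n k p) \<in> tspan a" "f \<in> tspan a"
  shows "(\<lambda>p. m p * f p) \<in> tspan a"
  using assms(2)
proof induction
  case (ts_add f g)
  then show ?case using tspan.ts_add by (simp add: distrib_left)
next
  case (ts_scale f c)
  then show ?case using tspan.ts_scale[of "\<lambda>p. m p * f p" a c] by (simp add: mult.left_commute)
qed (use assms(1) in auto)

lemma mult_alg_tspan: "h \<in> mult_alg a \<Longrightarrow> f \<in> tspan a \<Longrightarrow> (\<lambda>p. of_real (h p) * f p) \<in> tspan a"
proof (induction arbitrary: f rule: mult_alg.induct)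
  case (ma_const c)
  then show ?case using ts_scale by blast
next
  case ma_x
  show ?case by (rule tspan_times[OF _ ma_x]) (unfold emode_times_cos, intro ts_add ts_scale emode_in_tspan)
next
  case ma_y
  show ?case by (rule tspan_times[OF _ ma_y]) (simp only: emode_times_sin_half, intro ts_add ts_scale emode_in_tspan)
next
  case (ma_add g h)
  then show ?case using ts_add[OF ma_add.IH(1) ma_add.IH(2)] by (simp add: distrib_right)
next
  case (ma_mult g h)
  then show ?case using ma_mult.IH(1)[OF ma_mult.IH(2)] by (simp add: mult.assoc)
qed

lemma AE_fst_neq: "AE p in (lebesgue :: (real \<times> real) measure). fst p \<noteq> c"
  and AE_snd_neq: "AE p in (lebesgue :: (real \<times> real) measure). snd p \<noteq> c"
proof -
  have "negligible {p :: real \<times> real. p \<bullet> (1, 0) = c}" "negligible {p :: real \<times> real. p \<bullet> (0, 1) = c}"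
    by (rule negligible_standard_hyperplane, simp add: Basis_prod_def)+
  moreover have "{p :: real \<times> real. p \<bullet> (1, 0) = c} = {p. fst p = c}" "{p :: real \<times> real. p \<bullet> (0, 1) = c} = {p. snd p = c}" by auto
  ultimately have "{p :: real \<times> real. fst p = c} \<in> null_sets lebesgue" "{p :: real \<times> real. snd p = c} \<in> null_sets lebesgue"
    by (simp_all add: negligible_iff_null_sets)
  from AE_not_in[OF this(1)] AE_not_in[OF this(2)]
  show "AE p in (lebesgue :: (real \<times> real) measure). fst p \<noteq> c" "AE p in (lebesgue :: (real \<times> real) measure). snd p \<noteq> c" by simp_all
qed

text \<open>The part of \<open>g\<close> that is even in \<open>x\<close> is approximated with the weight \<open>cos (y/2)\<close>,
  the odd part with the weight \<open>sin (\<pi>x/(a+1)) cos (y/2)\<close>.\<close>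

lemma real_parity_approx:
  fixes g :: "real \<times> real \<Rightarrow> real"
  assumes a: "a > 0" and g: "continuous_on UNIV g" and e: "e > 0"
  obtains G where "continuous_on UNIV G" "nrm (\<lambda>p. indicator (slab a) p * of_real (g p - G p)) < e"
     "(\<lambda>p. of_real (G p) * cis (pi / (a + 1) * fst p / 2)) \<in> tspan a"
proof -
  let ?m = "pi / (a + 1)"
  define ge where "ge p = (g p + g (- fst p, snd p)) / 2" for p
  define go where "go p = (g p - g (- fst p, snd p)) / 2" for p
  define C where "C p = cos (snd p / 2)" for p :: "real \<times> real"
  define S where "S p = sin (?m * fst p) * cos (snd p / 2)" for p :: "real \<times> real"
  have refl: "continuous_on UNIV (\<lambda>p. g (- fst p, snd p))"
    by (rule continuous_on_compose2[OF g]) (auto intro!: continuous_intros)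
  have c: "continuous_on UNIV ge" "continuous_on UNIV go" 
    unfolding ge_def[abs_def] go_def[abs_def] using g refl by (auto intro!: continuous_intros)
  have Sd: "continuous_on UNIV (\<lambda>p::real \<times> real. sin (d * fst p) * cos (snd p / 2))" for d by (intro continuous_intros) auto
  have w: "continuous_on UNIV C" "continuous_on UNIV S"
    unfolding C_def[abs_def] S_def[abs_def] by (intro continuous_intros, simp) (rule Sd)
  have Cnz: "C p \<noteq> 0" if "p \<in> slab a" "snd p \<noteq> pi" "snd p \<noteq> - pi" for p
    using cos_half_pos[of "snd p"] that by (auto simp: C_def slab_iff abs_less_iff abs_le_iff)
  have Snz: "S p \<noteq> 0" if "p \<in> slab a" "snd p \<noteq> pi" "snd p \<noteq> - pi" "fst p \<noteq> 0" "fst p \<noteq> a + 1" "fst p \<noteq> - (a + 1)" for p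
  proof -
    have "\<bar>fst p\<bar> < a + 1" using that by (auto simp: slab_iff abs_less_iff abs_le_iff)
    then have "?m * \<bar>fst p\<bar> < ?m * (a + 1)" using a by (intro mult_strict_left_mono) auto
    then have "?m * \<bar>fst p\<bar> < pi" using a by simp
    then have "sin (?m * \<bar>fst p\<bar>) > 0" using a that by (intro sin_gt_zero) auto
    then have "sin (?m * fst p) \<noteq> 0" by (cases "fst p \<ge> 0") auto
    then show ?thesis using Cnz that by (simp add: S_def C_def)
  qed
  have nzC: "AE p in lebesgue. p \<in> slab a \<longrightarrow> C p \<noteq> 0"
    using AE_snd_neq[of pi] AE_snd_neq[of "-pi"] by eventually_elim (use Cnz in blast)
  have nzS: "AE p in lebesgue. p \<in> slab a \<longrightarrow> S p \<noteq> 0"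
    using AE_snd_neq[of pi] AE_snd_neq[of "-pi"] AE_fst_neq[of 0] AE_fst_neq[of "a+1"] AE_fst_neq[of "-(a+1)"] 
    by eventually_elim (use Snz in blast)
  have e2: "e / 2 > 0" using e by simp
  obtain h1 where h1: "h1 \<in> mult_alg a" "nrm (\<lambda>p. indicator (slab a) p * of_real (ge p - C p * h1 p)) < e / 2"
    by (rule weighted_mult_alg_dense[OF a c(1) w(1) _ _ nzC e2]) (auto simp: ge_def C_def add.commute)
  obtain h2 where h2: "h2 \<in> mult_alg a" "nrm (\<lambda>p. indicator (slab a) p * of_real (go p - S p * h2 p)) < e / 2"
    by (rule weighted_mult_alg_dense[OF a c(2) w(2) _ _ nzS e2]) (auto simp: go_def S_def abs_mult algebra_simps diff_divide_distrib)
  have hc: "continuous_on UNIV h1" "continuous_on UNIV h2" using mult_alg_continuous h1 h2 by auto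
  define G where "G p = C p * h1 p + S p * h2 p" for p
  have "nrm (\<lambda>p. indicator (slab a) p * of_real (g p - G p)) = 
    nrm (\<lambda>p. indicator (slab a) p * of_real (ge p - C p * h1 p) + indicator (slab a) p * of_real (go p - S p * h2 p))"
  proof -
    have "g p - G p = (ge p - C p * h1 p) + (go p - S p * h2 p)" for p by (simp add: G_def ge_def go_def field_simps)
    then show ?thesis by (simp only: of_real_add distrib_left)
  qed
  also have "\<dots> \<le> nrm (\<lambda>p. indicator (slab a) p * of_real (ge p - C p * h1 p)) + nrm (\<lambda>p. indicator (slab a) p * of_real (go p - S p * h2 p))"
    by (intro nrm_triangle sqi_slab_continuous continuous_on_of_real continuous_on_diff continuous_on_mult c w hc)
  also have "\<dots> < e" using h1 h2 by simp
  finally have "nrm (\<lambda>p. indicator (slab a) p * of_real (g p - G p)) < e" .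
  moreover have "continuous_on UNIV G" unfolding G_def[abs_def] by (intro continuous_on_add continuous_on_mult c w hc)
  moreover have "(\<lambda>p. of_real (G p) * cis (?m * fst p / 2)) \<in> tspan a"
  proof -
    \<comment> \<open>The lowest mode: its sine is cos (y/2), and its frequency pi / (2 (a + 1)) is
      the phase in the statement. The multipliers, applied to this mode and to its product with sin
      (pi x / (a + 1)), give the two weighted families.\<close>
    have b: "emode a 0 1 p = of_real (C p) * cis (?m * fst p / 2)" for p
      by (simp add: emode_def freq_def C_def sn_def add_divide_distrib sin_add mult.commute)
    have "(\<lambda>p. of_real (sin (?m * fst p)) * emode a 0 1 p) \<in> tspan a"
      unfolding emode_times_sin by (intro ts_add ts_scale emode_in_tspan)
    moreover have "(\<lambda>p. of_real (sin (?m * fst p)) * emode a 0 1 p) = (\<lambda>p. of_real (S p) * cis (?m * fst p / 2))"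
      unfolding b by (simp add: S_def C_def mult.assoc)
    ultimately have "(\<lambda>p. of_real (h1 p) * emode a 0 1 p + of_real (h2 p) * (of_real (S p) * cis (?m * fst p / 2))) \<in> tspan a"
      using mult_alg_tspan[OF h1(1) emode_in_tspan[of a 0 1]] mult_alg_tspan[OF h2(1)] by (intro ts_add) auto
    then show ?thesis unfolding b by (simp add: G_def algebra_simps)
  qed
  ultimately show ?thesis using that by blast
qed

text \<open>Because of the half-integral shift the approximants for real functions carry the fixed
  phase cis (pi x / (2 (a + 1))). So f is divided by this phase, its continuous approximant is split
  into real and imaginary parts, and the phase, of modulus 1, is restored without changing the
  norm.\<close>

lemma trig_dense:
  assumes a: "a > 0" and f: "sqi f" and e: "e > 0"
  obtains N L c where "finite N" "finite L" "0 \<notin> L" 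
    "nrm (\<lambda>p. indicator (slab a) p * (f p - flat_trig (modes a N L) c p)) < e"
proof -
  let ?m = "pi / (a + 1)"
  let ?c = "\<lambda>p :: real \<times> real. cis (?m * fst p / 2)"
  have cc: "continuous_on UNIV (\<lambda>p :: real \<times> real. cis (d * fst p / 2))" for d by (intro continuous_intros) auto
  have c1: "continuous_on UNIV ?c" by (rule cc)
  have c2: "continuous_on UNIV (\<lambda>p. cnj (?c p))" by (intro continuous_on_cnj c1)
  have c1m: "?c \<in> borel_measurable lebesgue" "(\<lambda>p. cnj (?c p)) \<in> borel_measurable lebesgue"
    using borel_measurable_continuous_onI[OF c1] borel_measurable_continuous_onI[OF c2] by (auto intro: measurable_completion)
  have cn: "?c p * cnj (?c p) = 1" for p by (simp add: cis_cnj cis_mult)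
  have f': "sqi (\<lambda>p. cnj (?c p) * f p)" by (rule sqi_mult_bounded[OF f c1m(2), of 1]) simp
  have e3: "e / 3 > 0" using e by simp
  obtain g where g: "continuous_on UNIV g" "nrm (\<lambda>p. indicator (slab a) p * (cnj (?c p) * f p - g p)) < e / 3"
    using continuous_dense_L2[OF f' e3] by blast
  have gR: "continuous_on UNIV (\<lambda>p. Re (g p))" "continuous_on UNIV (\<lambda>p. Im (g p))" by (intro continuous_intros g)+
  obtain G where G: "continuous_on UNIV G" "nrm (\<lambda>p. indicator (slab a) p * of_real (Re (g p) - G p)) < e / 3"
     "(\<lambda>p. of_real (G p) * ?c p) \<in> tspan a" using real_parity_approx[OF a gR(1) e3] by blast
  obtain H where H: "continuous_on UNIV H" "nrm (\<lambda>p. indicator (slab a) p * of_real (Im (g p) - H p)) < e / 3"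
     "(\<lambda>p. of_real (H p) * ?c p) \<in> tspan a" using real_parity_approx[OF a gR(2) e3] by blast
  have T: "(\<lambda>p. of_real (G p) * ?c p + \<i> * (of_real (H p) * ?c p)) \<in> tspan a" by (intro ts_add ts_scale G H)
  obtain N L d where d: "finite N" "finite L" "0 \<notin> L" "(\<lambda>p. of_real (G p) * ?c p + \<i> * (of_real (H p) * ?c p)) = flat_trig (modes a N L) d"
    using tspan_flat_trig[OF T] by (elim exE conjE) (rule that)
  let ?A = "\<lambda>p. indicator (slab a) p * (cnj (?c p) * f p - g p)"
  let ?B = "\<lambda>p. indicator (slab a) p * complex_of_real (Re (g p) - G p)" and ?D = "\<lambda>p. indicator (slab a) p * complex_of_real (Im (g p) - H p)"
  have im: "indicator (slab a) \<in> borel_measurable (lebesgue :: (real \<times> real) measure)" 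
    by (intro borel_measurable_indicator) (simp add: slab_def)
  have s: "sqi ?B" "sqi ?D" 
    by (intro sqi_slab_continuous continuous_on_of_real continuous_on_diff gR G H)+
  have sA: "sqi ?A"
  proof -
    have "sqi (\<lambda>p. indicator (slab a) p * (cnj (?c p) * f p))" 
      by (rule sqi_mult_bounded[OF f' im, of 1]) (auto simp: indicator_def)
    from sqi_diff[OF this sqi_slab_continuous[OF g(1)]] show ?thesis by (simp only: right_diff_distrib)
  qed
  have eq: "indicator (slab a) p * (f p - flat_trig (modes a N L) d p) = ?c p * (?A p + (?B p + \<i> * ?D p))" for p
  proof -
    have "f p = ?c p * (cnj (?c p) * f p)" using cn[of p] by (simp only: mult.assoc[symmetric] mult_1)
    moreover have "flat_trig (modes a N L) d p = ?c p * (of_real (G p) + \<i> * of_real (H p))"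
      unfolding d(4)[symmetric] by (simp add: algebra_simps)
    ultimately have "f p - flat_trig (modes a N L) d p = ?c p * (cnj (?c p) * f p - (of_real (G p) + \<i> * of_real (H p)))"
      by (simp only: right_diff_distrib)
    moreover have "cnj (?c p) * f p - (of_real (G p) + \<i> * of_real (H p)) = 
      (cnj (?c p) * f p - g p) + (complex_of_real (Re (g p) - G p) + \<i> * complex_of_real (Im (g p) - H p))"
      using complex_eq[of "g p"] by (simp add: algebra_simps)
    ultimately show ?thesis by (simp only: distrib_left mult_ac)
  qed
  have sBD: "sqi (\<lambda>p. ?B p + \<i> * ?D p)" by (intro sqi_add sqi_cmult s)
  have n1: "nrm (\<lambda>p. indicator (slab a) p * (f p - flat_trig (modes a N L) d p)) \<le> 1 * nrm (\<lambda>p. ?A p + (?B p + \<i> * ?D p))"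
    unfolding eq by (rule nrm_mult_bounded[OF sqi_add[OF sA sBD] c1m(1)]) simp
  have n2: "nrm (\<lambda>p. ?A p + (?B p + \<i> * ?D p)) \<le> nrm ?A + nrm (\<lambda>p. ?B p + \<i> * ?D p)" by (rule nrm_triangle[OF sA sBD])
  have n3: "nrm (\<lambda>p. ?B p + \<i> * ?D p) \<le> nrm ?B + nrm (\<lambda>p. \<i> * ?D p)" by (rule nrm_triangle[OF s(1) sqi_cmult[OF s(2)]])
  have n4: "nrm (\<lambda>p. \<i> * ?D p) = nrm ?D" using nrm_cmult[of \<i> ?D] by simp
  have "nrm (\<lambda>p. indicator (slab a) p * (f p - flat_trig (modes a N L) d p)) < e"
    using n1 n2 n3 n4 g(2) G(2) H(2) by linarith
  then show ?thesis using that d by blast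
qed

section \<open>The main estimate\<close>

definition symbol :: "real \<Rightarrow> real \<times> nat \<Rightarrow> complex" where
  "symbol l j = (1 + \<i> * of_real (fst j))\<^sup>2 + of_real (l\<^sup>2 - (real (snd j))\<^sup>2 / 4)"

text \<open>The imaginary part 2 \<xi>, produced by the weight exp x, gives the first bound without
  any condition on l and k, in particular when l^2 is close to k^2/4. For the second bound, if k^2
  \<le> 16 l^2 the first one is enough; for larger k the real part is comparable to k^2.\<close>

lemma symbol_bounds:
  assumes a: "a > 0" and l: "l \<ge> 1" and j: "j \<in> modes a N L"
  shows "norm (symbol l j) \<ge> pi / (a + 1)"
    and "(real (snd j))\<^sup>2 \<le> (16 * (a + 1) / pi + 8) * l\<^sup>2 * norm (symbol l j)"
proof -
  define \<mu> where "\<mu> = pi / (a + 1)"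
  have \<mu>: "\<mu> > 0" using a by (simp add: \<mu>_def)
  obtain \<xi> k where jk: "j = (\<xi>, k)" by (cases j)
  obtain n where "\<xi> = \<mu> * (of_int n + 1/2)" using j jk by (auto simp: modes_def freq_def \<mu>_def)
  moreover have "\<bar>of_int n + 1/2 :: real\<bar> \<ge> 1/2"
  proof (cases "n \<ge> 0")
    case False
    then have "n \<le> -1" by simp
    then have "real_of_int n \<le> -1" by (metis of_int_le_iff of_int_minus of_int_1)
    then show ?thesis by linarith
  qed simp
  ultimately have \<xi>: "\<bar>\<xi>\<bar> \<ge> \<mu> / 2" using \<mu> by (simp add: abs_mult)
  have s: "symbol l j = Complex (1 - \<xi>\<^sup>2 + l\<^sup>2 - (real k)\<^sup>2 / 4) (2 * \<xi>)"
    by (simp add: symbol_def jk complex_eq_iff power2_eq_square)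
  have im: "norm (symbol l j) \<ge> 2 * \<bar>\<xi>\<bar>" using abs_Im_le_cmod[of "symbol l j"] by (simp add: s abs_mult)
  have "norm (symbol l j) \<ge> \<mu>" using im \<xi> by linarith
  then show 1: "norm (symbol l j) \<ge> pi / (a + 1)" unfolding \<mu>_def .
  have l2: "l\<^sup>2 \<ge> 1" using l by (simp add: one_le_power)
  show "(real (snd j))\<^sup>2 \<le> (16 * (a + 1) / pi + 8) * l\<^sup>2 * norm (symbol l j)"
  proof (cases "(real k)\<^sup>2 \<le> 16 * l\<^sup>2")
    case True
    have rearrange: "16 * s = 16 * t / pi * s * (pi / t)" if "t > 0" for s t :: real using that by simp
    have "16 * l\<^sup>2 = 16 * (a + 1) / pi * l\<^sup>2 * (pi / (a + 1))" by (rule rearrange) (use a in simp)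
    also have "\<dots> \<le> 16 * (a + 1) / pi * l\<^sup>2 * norm (symbol l j)" using 1 a by (intro mult_left_mono) auto
    also have "\<dots> \<le> (16 * (a + 1) / pi + 8) * l\<^sup>2 * norm (symbol l j)" using l2 by (intro mult_right_mono) auto
    finally show ?thesis using True jk by simp
  next
    case False
    have "norm (symbol l j) \<ge> (real k)\<^sup>2 / 4 - l\<^sup>2 - 1 + \<xi>\<^sup>2"
      using abs_Re_le_cmod[of "symbol l j"] by (simp add: s)
    moreover have "\<xi>\<^sup>2 \<ge> 0" by simp
    \<comment> \<open>From k^2 > 16 l^2 and l \<ge> 1, l^2 + 1 \<le> 2 l^2 < k^2/8, which leaves at
      least k^2/8 of k^2/4.\<close>
    ultimately have "(real k)\<^sup>2 \<le> 8 * norm (symbol l j)" using False l2 by linarith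
    also have "\<dots> \<le> (16 * (a + 1) / pi + 8) * norm (symbol l j)" using a by (intro mult_right_mono) auto
    also have "\<dots> \<le> (16 * (a + 1) / pi + 8) * l\<^sup>2 * norm (symbol l j)"
    proof (rule mult_right_mono)
      show "16 * (a + 1) / pi + 8 \<le> (16 * (a + 1) / pi + 8) * l\<^sup>2"
        using mult_left_mono[OF l2, of "16 * (a + 1) / pi + 8"] a by simp
    qed simp
    finally show ?thesis using jk by simp
  qed
qed

lemma coeff_comparison:
  assumes "finite A" "\<And>j. j \<in> A \<Longrightarrow> w j * norm (b j) \<le> C * norm (c j)" "\<And>j. j \<in> A \<Longrightarrow> w j \<ge> 0"
  shows "(\<Sum>j\<in>A. (w j)\<^sup>2 * (norm (b j))\<^sup>2) \<le> C\<^sup>2 * (\<Sum>j\<in>A. (norm (c j))\<^sup>2)"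
proof -
  have "(w j)\<^sup>2 * (norm (b j))\<^sup>2 \<le> C\<^sup>2 * (norm (c j))\<^sup>2" if "j \<in> A" for j
    using power_mono[OF assms(2)[OF that], of 2] assms(3)[OF that] by (simp add: power_mult_distrib)
  then show ?thesis by (simp add: sum_distrib_left sum_mono)
qed

context rect_weak
begin

definition outer :: "(real \<times> real \<Rightarrow> complex) \<Rightarrow> real \<times> real \<Rightarrow> complex" where
  "outer V p = of_real (1 - rect_ind a p) * V p"

lemma rect_ind_lebesgue: "(\<lambda>p. complex_of_real (rect_ind a p)) \<in> borel_measurable lebesgue" 
    "(\<lambda>p. complex_of_real (1 - rect_ind a p)) \<in> borel_measurable lebesgue"
proof -
  have "(\<lambda>p. complex_of_real (rect_ind a p)) \<in> borel_measurable borel" "(\<lambda>p. complex_of_real (1 - rect_ind a p)) \<in> borel_measurable borel"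
    by measurable
  then show "(\<lambda>p. complex_of_real (rect_ind a p)) \<in> borel_measurable lebesgue" 
    "(\<lambda>p. complex_of_real (1 - rect_ind a p)) \<in> borel_measurable lebesgue" by (auto intro: measurable_completion)
qed

lemma sqi_outer: "sqi V \<Longrightarrow> sqi (outer V)"
  unfolding outer_def[abs_def] by (rule sqi_mult_bounded[OF _ rect_ind_lebesgue(2), of _ 1]) (auto simp: rect_ind_def)

lemma sqi_inner: "sqi V \<Longrightarrow> sqi (\<lambda>p. of_real (rect_ind a p) * V p)"
  by (rule sqi_mult_bounded[OF _ rect_ind_lebesgue(1), of _ 1]) (auto simp: rect_ind_def)

text \<open>The weight vanishes on the rectangle, so inserting the factor 1 -
  \<open>rect_ind a\<close> changes nothing; this is how only the norm of V over the wings enters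
  the estimate.\<close>

lemma pairing_outer_bound:
  assumes V: "sqi V" and Q: "sqi (\<lambda>p. complex_of_real (c p) * Q p)" and c: "\<And>p. c p * rect_ind a p = 0"
  shows "norm (pairing V c Q) \<le> nrm (outer V) * nrm (\<lambda>p. complex_of_real (c p) * Q p)"
proof -
  have eq: "V p * (complex_of_real (c p) * Q p) = outer V p * (complex_of_real (c p) * Q p)" for p
  proof -
    have "complex_of_real (1 - rect_ind a p) * of_real (c p) = of_real (c p)"
      using c[of p] by (simp only: of_real_mult[symmetric]) (simp add: algebra_simps)
    then show ?thesis unfolding outer_def by (metis mult.assoc mult.commute)
  qed
  have "pairing V c Q = pairing (outer V) c Q" by (simp only: eq)
  also have "norm \<dots> \<le> nrm (outer V) * nrm (\<lambda>p. complex_of_real (c p) * Q p)"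
    by (rule norm_integral_mult_le[OF sqi_outer[OF V] Q])
  finally show ?thesis .
qed

lemma rect_ind_disjoint: "wing p * rect_ind a p = 0" "chi_x K a p * rect_ind a p = 0" "chi_xx K a p * rect_ind a p = 0"
proof -
  show "wing p * rect_ind a p = 0" using chi_rect[of p] by (auto simp: wing_def rect_ind_def)
  show "chi_x K a p * rect_ind a p = 0" "chi_xx K a p * rect_ind a p = 0"
    using chi_middle(2,3)[OF K(1), of "fst p" a "snd p"] by (auto simp: rect_ind_def)
qed

lemma slab_facts: "rect_ind a p \<noteq> 0 \<Longrightarrow> p \<in> slab a" "chi K a p \<noteq> 0 \<Longrightarrow> p \<in> slab a" "\<bar>wing p\<bar> \<le> 1"
proof -
  show 1: "rect_ind a p \<noteq> 0 \<Longrightarrow> p \<in> slab a" by (auto simp: rect_ind_def slab_iff split: if_splits)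
  show 2: "chi K a p \<noteq> 0 \<Longrightarrow> p \<in> slab a" using chi_support[OF K a, of p] by (auto simp: slab_iff)
  show "\<bar>wing p\<bar> \<le> 1" using chi_bounds[OF K(1) a, of p] by (auto simp: wing_def rect_ind_def)
qed

lemma exp_slab: "p \<in> slab a \<Longrightarrow> exp (fst p) \<le> exp (a + 1)"
  by (simp add: slab_iff abs_le_iff)

lemma nrm_weight_trig:
  assumes A: "finite N" "finite L" "0 \<notin> L" and c: "c \<in> {rect_ind a, wing}"
  shows "nrm (\<lambda>p. of_real (c p) * trig (modes a N L) b p) \<le> exp (a + 1) * nrm (\<lambda>p. indicator (slab a) p * flat_trig (modes a N L) b p)"
proof (rule nrm_le)
  have fA: "finite (modes a N L)" using A by (simp add: modes_def)
  show "sqi (\<lambda>p. indicator (slab a) p * flat_trig (modes a N L) b p)" by (rule sqi_slab_continuous[OF continuous_flat_trig])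
  show "(\<lambda>p. of_real (c p) * trig (modes a N L) b p) \<in> borel_measurable lebesgue"
    by (rule sqiD(1)[OF sqi_weight_trig[OF fA]]) (use c in auto)
  show "AE p in lebesgue. norm (of_real (c p) * trig (modes a N L) b p) \<le> exp (a + 1) * norm (indicator (slab a) p * flat_trig (modes a N L) b p)"
  proof (rule AE_I2)
    fix p
    show "norm (of_real (c p) * trig (modes a N L) b p) \<le> exp (a + 1) * norm (indicator (slab a) p * flat_trig (modes a N L) b p)"
    proof (cases "c p = 0")
      case False
      then have p: "p \<in> slab a" "\<bar>c p\<bar> \<le> 1" using c slab_facts[of p] by (auto simp: wing_def rect_ind_def split: if_splits)
      have "\<bar>c p\<bar> * (exp (fst p) * norm (flat_trig (modes a N L) b p)) \<le> 1 * (exp (a + 1) * norm (flat_trig (modes a N L) b p))"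
        using p exp_slab[OF p(1)] by (intro mult_mono mult_right_mono) auto
      then show ?thesis using p(1) by (simp add: trig_eq_flat_trig norm_mult)
    qed simp
  qed
qed simp

text \<open>The singularity wt^2 is cancelled by the cosine in \<open>flat_trig_le_majorant\<close>,
  leaving the constant 9 / K^2; the price is the majorant, whose norm is controlled by the
  coefficients weighted with k^2.\<close>

lemma nrm_chi_xx_trig:
  assumes A: "finite N" "finite L" "0 \<notin> L" 
    and M: "M \<ge> 0" "\<And>p. \<bar>snd p\<bar> < pi \<Longrightarrow> \<bar>chi_xx K a p\<bar> \<le> M * (wt K (snd p))\<^sup>2"
  shows "nrm (\<lambda>p. of_real (chi_xx K a p) * trig (modes a N L) b p) \<le> (M * (9 / K\<^sup>2) * exp (a + 1)) * nrm (\<lambda>p. of_real (majorant a N L b p))"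
proof (rule nrm_le[OF nrm_majorant(2)[OF a A]])
  have fA: "finite (modes a N L)" using A by (simp add: modes_def)
  show "(\<lambda>p. of_real (chi_xx K a p) * trig (modes a N L) b p) \<in> borel_measurable lebesgue"
    by (rule sqiD(1)[OF sqi_weight_trig[OF fA]]) auto
  show "AE p in lebesgue. norm (of_real (chi_xx K a p) * trig (modes a N L) b p) \<le> (M * (9 / K\<^sup>2) * exp (a + 1)) * norm (complex_of_real (majorant a N L b p))"
  proof (rule AE_I2)
    fix p
    let ?q = "norm (flat_trig (modes a N L) b p)" and ?m = "majorant a N L b p"
    have m0: "?m \<ge> 0" by (simp add: majorant_def sum_nonneg)
    show "norm (of_real (chi_xx K a p) * trig (modes a N L) b p) \<le> (M * (9 / K\<^sup>2) * exp (a + 1)) * norm (complex_of_real ?m)"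
    proof (cases "chi_xx K a p = 0")
      case False
      then have y: "\<bar>snd p\<bar> < pi" and p: "p \<in> slab a" using chi_support[OF K a, of p] by (auto simp: slab_iff)
      have "\<bar>chi_xx K a p\<bar> * (exp (fst p) * ?q) \<le> (M * (wt K (snd p))\<^sup>2) * (exp (a + 1) * (cos (snd p / 2) * ?m))"
        using M(2)[OF y] exp_slab[OF p] flat_trig_le_majorant[OF a p y, of N L b] M(1) by (intro mult_mono) auto
      also have "\<dots> = M * ((wt K (snd p))\<^sup>2 * cos (snd p / 2)) * exp (a + 1) * ?m" by simp
      also have "\<dots> = M * (9 / K\<^sup>2) * exp (a + 1) * ?m" by (simp only: wt_ge_1(2)[OF K y])
      finally show ?thesis using m0 by (simp add: trig_eq_flat_trig norm_mult)
    qed (use M in simp)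
  qed
qed (use M in simp)

text \<open>In the square of the left side the singularity is wt^2, of order 1 / cos (y/2), against
  two factors of the trigonometric sum. Only one of them is replaced by the cosine times the
  majorant. The result is a geometric mean of the plain and the weighted norm, and so costs l where
  \<open>nrm_chi_xx_trig\<close> costs l^2.\<close>

lemma nrm_chi_x_trig:
  assumes A: "finite N" "finite L" "0 \<notin> L" 
    and M: "M \<ge> 0" "\<And>p. \<bar>snd p\<bar> < pi \<Longrightarrow> \<bar>chi_x K a p\<bar> \<le> M * wt K (snd p)"
  shows "(nrm (\<lambda>p. of_real (chi_x K a p) * trig (modes a N L) b p))\<^sup>2 \<le> (M * (3 / K) * exp (a + 1))\<^sup>2 * 
     (nrm (\<lambda>p. indicator (slab a) p * flat_trig (modes a N L) b p) * nrm (\<lambda>p. of_real (majorant a N L b p)))"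
proof -
  let ?C = "(M * (3 / K) * exp (a + 1))\<^sup>2"
  let ?F = "\<lambda>p. indicator (slab a) p * flat_trig (modes a N L) b p" and ?G = "\<lambda>p. complex_of_real (majorant a N L b p)"
  let ?H = "\<lambda>p. of_real (chi_x K a p) * trig (modes a N L) b p"
  have fA: "finite (modes a N L)" using A by (simp add: modes_def)
  have F: "sqi ?F" by (rule sqi_slab_continuous[OF continuous_flat_trig])
  have G: "sqi ?G" by (rule nrm_majorant(2)[OF a A])
  have H: "sqi ?H" by (rule sqi_weight_trig[OF fA]) auto
  have pw: "(norm (?H p))\<^sup>2 \<le> ?C * (norm (?F p) * norm (?G p))" for p
  proof (cases "chi_x K a p = 0")
    case False
    then have y: "\<bar>snd p\<bar> < pi" and p: "p \<in> slab a" using chi_support[OF K a, of p] by (auto simp: slab_iff)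
    let ?q = "norm (flat_trig (modes a N L) b p)" and ?m = "majorant a N L b p"
    have m0: "?m \<ge> 0" by (simp add: majorant_def sum_nonneg)
    have w0: "wt K (snd p) > 0" using wt_pos[OF K(1) y] .
    have "norm (?H p) = \<bar>chi_x K a p\<bar> * (exp (fst p) * ?q)" by (simp add: trig_eq_flat_trig norm_mult)
    also have "\<dots> \<le> (M * wt K (snd p)) * (exp (a + 1) * ?q)"
      using M(2)[OF y] exp_slab[OF p] M(1) w0 by (intro mult_mono) auto
    finally have "(norm (?H p))\<^sup>2 \<le> ((M * wt K (snd p)) * (exp (a + 1) * ?q))\<^sup>2" by (rule power_mono) simp
    also have "\<dots> = (M * exp (a + 1))\<^sup>2 * (wt K (snd p))\<^sup>2 * (?q * ?q)" by (simp add: power_mult_distrib power2_eq_square mult_ac)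
    also have "\<dots> \<le> (M * exp (a + 1))\<^sup>2 * (wt K (snd p))\<^sup>2 * (?q * (cos (snd p / 2) * ?m))"
      using flat_trig_le_majorant[OF a p y, of N L b] by (intro mult_left_mono) auto
    also have "\<dots> = (M * exp (a + 1))\<^sup>2 * ((wt K (snd p))\<^sup>2 * cos (snd p / 2)) * (?q * ?m)" by simp
    also have "\<dots> = ?C * (?q * ?m)" by (simp only: wt_ge_1(2)[OF K y]) (simp add: power_mult_distrib power_divide)
    finally show ?thesis using p m0 by simp
  qed simp
  have "(nrm ?H)\<^sup>2 \<le> (\<integral>p. ?C * (norm (?F p) * norm (?G p)) \<partial>lebesgue)"
    unfolding nrm_sq by (rule integral_mono[OF sqiD(2)[OF H] integrable_mult_right[OF sqi_integrable_norm_mult[OF F G]] pw])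
  also have "\<dots> = ?C * (\<integral>p. norm (?F p) * norm (?G p) \<partial>lebesgue)" by (rule integral_mult_right_zero)
  also have "\<dots> \<le> ?C * (nrm ?F * nrm ?G)" by (rule mult_left_mono[OF Cauchy_Schwarz_nrm[OF F G]]) simp
  finally show ?thesis .
qed

text \<open>Each of the six terms of \<open>trig_identity\<close> is a pairing, bounded by
  Cauchy-Schwarz; the coefficients there are b = c / s. The first involves the equation and the full
  norm of F; in the other five the weight vanishes on the rectangle. The bound depends on c only
  through the norm of its sum on the slab, with a constant free of l, N and L.\<close>

lemma pairing_trig_bound:
  fixes l :: real
  defines "F \<equiv> \<lambda>p. - (Uxx p + Uyy p) - of_real (l\<^sup>2) * U p"
    and "C0 \<equiv> 16 * (a + 1) / pi + 8"
  assumes l: "l \<ge> 1" and A: "finite N" "finite L" "0 \<notin> L" 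
    and M: "M \<ge> 0" "\<And>p. \<bar>snd p\<bar> < pi \<Longrightarrow> \<bar>chi_x K a p\<bar> \<le> M * wt K (snd p)" 
       "\<And>p. \<bar>snd p\<bar> < pi \<Longrightarrow> \<bar>chi_xx K a p\<bar> \<le> M * (wt K (snd p))\<^sup>2"
  shows "norm (pairing U (chi K a) (trig (modes a N L) c)) \<le> 
    (exp (a + 1) * (C0 + 12 * M * C0 / K + 18 * M * C0 / K\<^sup>2 + C0)) * 
    nrm (\<lambda>p. indicator (slab a) p * flat_trig (modes a N L) c p) *
    (nrm F + nrm (outer Uxx) + l * nrm (outer Ux) + l\<^sup>2 * nrm (outer U))"
proof -
  let ?A = "modes a N L"
  let ?e = "exp (a + 1)"
  \<comment> \<open>The symbol is nonzero on all modes, so c is recovered as s b and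
    \<open>trig_identity\<close> can be read from right to left as a bound for the pairing with
    c.\<close>
  define b where "b j = c j / symbol l j" for j
  define b' where "b' j = of_real ((real (snd j))\<^sup>2 / 4) * b j" for j
  have fA: "finite ?A" using A by (simp add: modes_def)
  have "(a + 1) / pi \<ge> 0" "C0 = 16 * ((a + 1) / pi) + 8" using a by (simp_all add: C0_def)
  then have C0: "C0 \<ge> 8" "C0 > 0" "(a + 1) / pi \<le> C0" by linarith+
  have sb: "norm (symbol l j) \<ge> pi / (a + 1)" "(real (snd j))\<^sup>2 \<le> C0 * l\<^sup>2 * norm (symbol l j)" if "j \<in> ?A" for j
    using symbol_bounds[OF a l that] by (simp_all add: C0_def)
  have pos: "norm (symbol l j) > 0" if "j \<in> ?A" for j
  proof -
    have "pi / (a + 1) > 0" using a by simp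
    then show ?thesis using sb(1)[OF that] by linarith
  qed
  have bc: "symbol l j * b j = c j" if "j \<in> ?A" for j using pos[OF that] by (simp add: b_def)
  define P where "P = nrm (\<lambda>p. indicator (slab a) p * flat_trig ?A c p)"
  have P0: "P \<ge> 0" by (simp add: P_def)
  have P2: "P\<^sup>2 = 2 * pi * (a + 1) * (\<Sum>j\<in>?A. (norm (c j))\<^sup>2)" unfolding P_def by (rule nrm_flat_trig[OF a A])
  have le1: "1 * norm (b j) \<le> C0 * norm (c j)" if "j \<in> ?A" for j
  proof -
    have "norm (b j) = norm (c j) * (1 / norm (symbol l j))" by (simp add: b_def norm_divide)
    also have "\<dots> \<le> norm (c j) * (1 / (pi / (a + 1)))" using sb(1)[OF that] a by (intro mult_left_mono divide_left_mono mult_pos_pos pos that) auto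
    also have "\<dots> \<le> norm (c j) * C0" using C0(3) by (intro mult_left_mono) auto
    finally show ?thesis by (simp add: mult.commute)
  qed
  have le2: "(real (snd j))\<^sup>2 * norm (b j) \<le> (C0 * l\<^sup>2) * norm (c j)" if "j \<in> ?A" for j
  proof -
    have "(real (snd j))\<^sup>2 * norm (b j) \<le> (C0 * l\<^sup>2 * norm (symbol l j)) * norm (b j)" using sb(2)[OF that] by (intro mult_right_mono) auto
    also have "\<dots> = (C0 * l\<^sup>2) * norm (symbol l j * b j)" by (simp add: norm_mult)
    finally show ?thesis by (simp only: bc[OF that])
  qed
  define Q where "Q = nrm (\<lambda>p. indicator (slab a) p * flat_trig ?A b p)"
  define R where "R = nrm (\<lambda>p. indicator (slab a) p * flat_trig ?A b' p)"
  define J where "J = nrm (\<lambda>p. of_real (majorant a N L b p))"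
  have QRJ0: "Q \<ge> 0" "R \<ge> 0" "J \<ge> 0" by (simp_all add: Q_def R_def J_def)
  have Q: "Q \<le> C0 * P"
  proof -
    have "Q\<^sup>2 = 2 * pi * (a + 1) * (\<Sum>j\<in>?A. 1\<^sup>2 * (norm (b j))\<^sup>2)" unfolding Q_def using nrm_flat_trig[OF a A] by simp
    also have "\<dots> \<le> 2 * pi * (a + 1) * (C0\<^sup>2 * (\<Sum>j\<in>?A. (norm (c j))\<^sup>2))"
      using a by (intro mult_left_mono coeff_comparison[OF fA le1]) auto
    also have "\<dots> = (C0 * P)\<^sup>2" by (simp add: P2 power_mult_distrib)
    finally show ?thesis by (rule power2_le_imp_le) (use C0 P0 in simp)
  qed
  have J: "J \<le> 2 * C0 * l\<^sup>2 * P"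
  proof -
    have "J\<^sup>2 \<le> 8 * pi * (a + 1) * (\<Sum>j\<in>?A. real (snd j) ^ 4 * (norm (b j))\<^sup>2)" unfolding J_def by (rule nrm_majorant(1)[OF a A])
    also have "(\<Sum>j\<in>?A. real (snd j) ^ 4 * (norm (b j))\<^sup>2) = (\<Sum>j\<in>?A. ((real (snd j))\<^sup>2)\<^sup>2 * (norm (b j))\<^sup>2)" by (simp flip: power_mult)
    also have "8 * pi * (a + 1) * \<dots> \<le> 8 * pi * (a + 1) * ((C0 * l\<^sup>2)\<^sup>2 * (\<Sum>j\<in>?A. (norm (c j))\<^sup>2))"
      using a by (intro mult_left_mono coeff_comparison[OF fA le2]) auto
    \<comment> \<open>The factor 8 pi (a + 1) is four times the one in Parseval for P, which becomes
      the factor 2 after taking the root.\<close>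
    also have "\<dots> = 4 * (C0 * l\<^sup>2)\<^sup>2 * P\<^sup>2" by (simp add: P2)
    also have "\<dots> = (2 * C0 * l\<^sup>2 * P)\<^sup>2" by (simp only: power_mult_distrib) simp
    finally show ?thesis by (rule power2_le_imp_le) (use C0 P0 in simp)
  qed
  have R: "R \<le> C0 * l\<^sup>2 * P"
  proof -
    have "(norm (b' j))\<^sup>2 = ((real (snd j))\<^sup>2 / 4)\<^sup>2 * (norm (b j))\<^sup>2" for j
      by (simp only: b'_def norm_mult power_mult_distrib norm_of_real power2_abs)
    then have "R\<^sup>2 = 2 * pi * (a + 1) * (\<Sum>j\<in>?A. ((real (snd j))\<^sup>2 / 4)\<^sup>2 * (norm (b j))\<^sup>2)" 
      by (simp only: R_def nrm_flat_trig[OF a A])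
    also have "\<dots> \<le> 2 * pi * (a + 1) * ((C0 * l\<^sup>2)\<^sup>2 * (\<Sum>j\<in>?A. (norm (c j))\<^sup>2))"
    proof (intro mult_left_mono coeff_comparison[OF fA])
      fix j assume j: "j \<in> ?A"
      have "(real (snd j))\<^sup>2 / 4 * norm (b j) \<le> (real (snd j))\<^sup>2 * norm (b j)" by (intro mult_right_mono) auto
      then show "(real (snd j))\<^sup>2 / 4 * norm (b j) \<le> (C0 * l\<^sup>2) * norm (c j)" using le2[OF j] by linarith
    qed (use a in auto)
    also have "\<dots> = (C0 * l\<^sup>2 * P)\<^sup>2" by (simp only: power_mult_distrib[of "C0 * l\<^sup>2"] P2) simp
    finally show ?thesis by (rule power2_le_imp_le) (use C0 P0 in simp)
  qed
  define X where "X = nrm (\<lambda>p. of_real (chi_x K a p) * trig ?A b p)"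
  have X: "X \<le> M * (3 / K) * ?e * (2 * C0 * l * P)"
  proof -
    have "X\<^sup>2 \<le> (M * (3 / K) * ?e)\<^sup>2 * (Q * J)"
      unfolding X_def Q_def J_def by (rule nrm_chi_x_trig[OF A M(1,2)])
    also have "\<dots> \<le> (M * (3 / K) * ?e)\<^sup>2 * ((C0 * P) * (2 * C0 * l\<^sup>2 * P))"
      using Q J QRJ0 C0 P0 by (intro mult_left_mono mult_mono) auto
    \<comment> \<open>The geometric mean of C0 P and 2 C0 l^2 P is sqrt 2 C0 l P; the root is
      rounded up to 2.\<close>
    also have "\<dots> \<le> (M * (3 / K) * ?e)\<^sup>2 * (2 * C0 * l * P)\<^sup>2"
    proof (rule mult_left_mono)
      have "(C0 * P) * (2 * C0 * l\<^sup>2 * P) = 2 * (C0 * l * P)\<^sup>2" "(2 * C0 * l * P)\<^sup>2 = 4 * (C0 * l * P)\<^sup>2"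
        by (simp_all add: power2_eq_square)
      moreover have "(C0 * l * P)\<^sup>2 \<ge> 0" by simp
      ultimately show "(C0 * P) * (2 * C0 * l\<^sup>2 * P) \<le> (2 * C0 * l * P)\<^sup>2" by linarith
    qed simp
    also have "\<dots> = (M * (3 / K) * ?e * (2 * C0 * l * P))\<^sup>2" by (simp only: power_mult_distrib)
    finally show ?thesis by (rule power2_le_imp_le) (use C0 P0 l K M in simp)
  qed
  have F: "sqi F" unfolding F_def 
    using sqi_diff[OF sqi_cmult[OF sqi_add[OF sqi(3,5)], of "-1"] sqi_cmult[OF sqi(1)]] by simp
  have sw: "sqi (\<lambda>p. complex_of_real (w p) * trig ?A d p)" if "w \<in> {chi K a, chi_x K a, chi_xx K a, rect_ind a, wing}" for w d
    by (rule sqi_weight_trig[OF fA that])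
  let ?nF = "nrm F" and ?nxx = "nrm (outer Uxx)" and ?nx = "nrm (outer Ux)" and ?n = "nrm (outer U)"
  have eQ: "?e * Q \<le> ?e * (C0 * P)" and eR: "?e * R \<le> ?e * (C0 * l\<^sup>2 * P)" using Q R by (auto intro: mult_left_mono)
  have t1: "norm (pairing F (rect_ind a) (trig ?A b)) \<le> ?nF * (?e * (C0 * P))"
  proof -
    have "norm (pairing F (rect_ind a) (trig ?A b)) \<le> ?nF * nrm (\<lambda>p. of_real (rect_ind a p) * trig ?A b p)"
      by (rule norm_integral_mult_le[OF F sw]) simp
    also have "\<dots> \<le> ?nF * (?e * (C0 * P))"
    proof (rule mult_left_mono)
      have "nrm (\<lambda>p. of_real (rect_ind a p) * trig ?A b p) \<le> ?e * Q" unfolding Q_def by (rule nrm_weight_trig[OF A]) simp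
      then show "nrm (\<lambda>p. of_real (rect_ind a p) * trig ?A b p) \<le> ?e * (C0 * P)" using eQ by linarith
    qed simp
    finally show ?thesis .
  qed
  have wb: "nrm (\<lambda>p. of_real (wing p) * trig ?A d p) \<le> ?e * nrm (\<lambda>p. indicator (slab a) p * flat_trig ?A d p)" for d
    by (rule nrm_weight_trig[OF A]) simp
  have po: "norm (pairing V w (trig ?A d)) \<le> nrm (outer V) * B" if "sqi V" "w \<in> {chi_x K a, chi_xx K a, wing}" "nrm (\<lambda>p. of_real (w p) * trig ?A d p) \<le> B" for V w d B
  proof -
    have "norm (pairing V w (trig ?A d)) \<le> nrm (outer V) * nrm (\<lambda>p. of_real (w p) * trig ?A d p)"
    proof (rule pairing_outer_bound[OF that(1) sw])
      show "w \<in> {chi K a, chi_x K a, chi_xx K a, rect_ind a, wing}" using that(2) by auto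
      show "w p * rect_ind a p = 0" for p
        using that(2) rect_ind_disjoint[of p] by (elim insertE) simp_all
    qed
    also have "\<dots> \<le> nrm (outer V) * B" using that(3) by (intro mult_left_mono) auto
    finally show ?thesis .
  qed
  have t2: "norm (pairing Uxx wing (trig ?A b)) \<le> ?nxx * (?e * (C0 * P))"
    by (rule po[OF sqi(3)]) (use order_trans[OF wb[of b] eQ[unfolded Q_def]] in auto)
  have t3: "norm (pairing Ux (chi_x K a) (trig ?A b)) \<le> ?nx * (M * (3 / K) * ?e * (2 * C0 * l * P))"
    by (rule po[OF sqi(2)]) (use X[unfolded X_def] in auto)
  have t4: "norm (pairing U (chi_xx K a) (trig ?A b)) \<le> ?n * (M * (9 / K\<^sup>2) * ?e * (2 * C0 * l\<^sup>2 * P))"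
  proof (rule po[OF sqi(1)])
    have "nrm (\<lambda>p. of_real (chi_xx K a p) * trig ?A b p) \<le> (M * (9 / K\<^sup>2) * ?e) * J"
      unfolding J_def by (rule nrm_chi_xx_trig[OF A M(1,3)])
    also have "\<dots> \<le> (M * (9 / K\<^sup>2) * ?e) * (2 * C0 * l\<^sup>2 * P)" using J M(1) by (intro mult_left_mono) auto
    finally show "nrm (\<lambda>p. of_real (chi_xx K a p) * trig ?A b p) \<le> M * (9 / K\<^sup>2) * ?e * (2 * C0 * l\<^sup>2 * P)" .
  qed simp
  have t5: "norm (pairing U wing (trig ?A b)) \<le> ?n * (?e * (C0 * P))"
    by (rule po[OF sqi(1)]) (use order_trans[OF wb[of b] eQ[unfolded Q_def]] in auto)
  have t6: "norm (pairing U wing (trig ?A b')) \<le> ?n * (?e * (C0 * l\<^sup>2 * P))"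
    by (rule po[OF sqi(1)]) (use order_trans[OF wb[of b'] eR[unfolded R_def]] in auto)
  have tc: "trig ?A c = trig ?A (\<lambda>j. symbol l j * b j)"
    unfolding trig_def using bc by (intro ext sum.cong) auto
  have id: "pairing U (chi K a) (trig ?A c) = 
    - pairing F (rect_ind a) (trig ?A b) + pairing Uxx wing (trig ?A b) + 2 * pairing Ux (chi_x K a) (trig ?A b) +
      pairing U (chi_xx K a) (trig ?A b) + of_real (l\<^sup>2) * pairing U wing (trig ?A b) - pairing U wing (trig ?A b')"
    unfolding tc F_def b'_def[abs_def] symbol_def by (rule trig_identity[OF fA])
  have tri: "norm (- z1 + z2 + 2 * z3 + z4 + of_real (l\<^sup>2) * z5 - z6) \<le> norm z1 + norm z2 + 2 * norm z3 + norm z4 + l\<^sup>2 * norm z5 + norm z6"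
    for z1 z2 z3 z4 z5 z6 :: complex
  proof -
    have "norm (- z1 + z2 + 2 * z3 + z4 + of_real (l\<^sup>2) * z5 - z6) \<le> norm (- z1) + norm z2 + norm (2 * z3) + norm z4 + norm (of_real (l\<^sup>2) * z5) + norm z6"
      by (intro order_trans[OF norm_triangle_ineq4] order_trans[OF norm_triangle_ineq] add_mono order_refl)
    then show ?thesis by (simp add: norm_mult norm_power)
  qed
  have "norm (pairing U (chi K a) (trig ?A c)) \<le> ?nF * (?e * (C0 * P)) + ?nxx * (?e * (C0 * P)) + 2 * (?nx * (M * (3 / K) * ?e * (2 * C0 * l * P)))
     + ?n * (M * (9 / K\<^sup>2) * ?e * (2 * C0 * l\<^sup>2 * P)) + l\<^sup>2 * (?n * (?e * (C0 * P))) + ?n * (?e * (C0 * l\<^sup>2 * P))"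
    unfolding id by (rule order_trans[OF tri]) (intro add_mono mult_left_mono t1 t2 t3 t4 t5 t6; simp)
  \<comment> \<open>The constants collect as 12 = 2 * 3 * 2 from \<open>chi_x\<close>, 18 = 9 * 2
    from \<open>chi_xx\<close>, and 2 C0 from the two pairings of u with \<open>wing\<close>, both
    of order l^2.\<close>
  also have "\<dots> = (?e * P) * (C0 * ?nF + C0 * ?nxx + (12 * M * C0 / K) * (l * ?nx) + (18 * M * C0 / K\<^sup>2 + 2 * C0) * (l\<^sup>2 * ?n))"
    by (simp add: algebra_simps)
  also have "\<dots> \<le> (?e * P) * ((C0 + 12 * M * C0 / K + 18 * M * C0 / K\<^sup>2 + C0) * (?nF + ?nxx + l * ?nx + l\<^sup>2 * ?n))"
  proof (rule mult_left_mono)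
    let ?T = "C0 + 12 * M * C0 / K + 18 * M * C0 / K\<^sup>2 + C0"
    have nn: "12 * M * C0 / K \<ge> 0" "18 * M * C0 / K\<^sup>2 \<ge> 0" using M(1) C0 K by auto
    have "C0 * ?nF \<le> ?T * ?nF" "C0 * ?nxx \<le> ?T * ?nxx" "(12 * M * C0 / K) * (l * ?nx) \<le> ?T * (l * ?nx)" 
      "(18 * M * C0 / K\<^sup>2 + 2 * C0) * (l\<^sup>2 * ?n) \<le> ?T * (l\<^sup>2 * ?n)"
    proof -
      have T: "C0 \<le> ?T" "12 * M * C0 / K \<le> ?T" "18 * M * C0 / K\<^sup>2 + 2 * C0 \<le> ?T" using nn C0 by linarith+
      have nn': "l * ?nx \<ge> 0" "l\<^sup>2 * ?n \<ge> 0" using l by simp_all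
      show "C0 * ?nF \<le> ?T * ?nF" "C0 * ?nxx \<le> ?T * ?nxx" by (rule mult_right_mono[OF T(1) nrm_nonneg])+
      show "(12 * M * C0 / K) * (l * ?nx) \<le> ?T * (l * ?nx)" by (rule mult_right_mono[OF T(2) nn'(1)])
      show "(18 * M * C0 / K\<^sup>2 + 2 * C0) * (l\<^sup>2 * ?n) \<le> ?T * (l\<^sup>2 * ?n)" by (rule mult_right_mono[OF T(3) nn'(2)])
    qed
    then show "C0 * ?nF + C0 * ?nxx + (12 * M * C0 / K) * (l * ?nx) + (18 * M * C0 / K\<^sup>2 + 2 * C0) * (l\<^sup>2 * ?n) \<le> ?T * (?nF + ?nxx + l * ?nx + l\<^sup>2 * ?n)"
      by (simp only: distrib_left)
  qed (use P0 in simp)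
  finally show ?thesis unfolding P_def by (simp only: mult_ac)
qed


text \<open>Duality: inserting a trigonometric sum close to f = exp (-x) conj(u) on the rectangle
  and 0 elsewhere, the pairing with \<open>chi\<close> becomes almost the square of the norm of u on
  the rectangle, while \<open>pairing_trig_bound\<close> is linear in the norm of the sum, hence in
  the same norm of u. One factor cancels.\<close>

lemma inner_estimate:
  fixes l :: real
  defines "F \<equiv> \<lambda>p. - (Uxx p + Uyy p) - of_real (l\<^sup>2) * U p"
    and "C0 \<equiv> 16 * (a + 1) / pi + 8"
  assumes l: "l \<ge> 1" 
    and M: "M \<ge> 0" "\<And>p. \<bar>snd p\<bar> < pi \<Longrightarrow> \<bar>chi_x K a p\<bar> \<le> M * wt K (snd p)" 
       "\<And>p. \<bar>snd p\<bar> < pi \<Longrightarrow> \<bar>chi_xx K a p\<bar> \<le> M * (wt K (snd p))\<^sup>2"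
  shows "nrm (\<lambda>p. of_real (rect_ind a p) * U p) \<le> 
    (exp (a + 1) * (C0 + 12 * M * C0 / K + 18 * M * C0 / K\<^sup>2 + C0)) * exp (a + 1) *
    (nrm F + nrm (outer Uxx) + l * nrm (outer Ux) + l\<^sup>2 * nrm (outer U))"
proof -
  let ?e = "exp (a + 1)"
  define B where "B = ?e * (C0 + 12 * M * C0 / K + 18 * M * C0 / K\<^sup>2 + C0)"
  define D where "D = nrm F + nrm (outer Uxx) + l * nrm (outer Ux) + l\<^sup>2 * nrm (outer U)"
  have C0: "C0 > 0" unfolding C0_def using a by (intro add_nonneg_pos) auto
  have B0: "B \<ge> 0" using C0 M(1) K by (simp add: B_def)
  have D0: "D \<ge> 0" using l by (simp add: D_def)
  define V where "V p = of_real (rect_ind a p) * U p" for p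
  have V: "sqi V" unfolding V_def[abs_def] by (rule sqi_inner[OF sqi(1)])
  \<comment> \<open>The factor exp (-x) compensates the weight of the modes. The function jumps
    across the vertical sides, so the approximation can only be in L2; this is enough.\<close>
  define f where "f p = of_real (rect_ind a p * exp (- fst p)) * cnj (U p)" for p
  have em: "(\<lambda>p. complex_of_real (rect_ind a p * exp (- fst p))) \<in> borel_measurable lebesgue"
    by (intro measurable_completion) (use rect_ind_measurable in measurable)
  have cU: "(\<lambda>p. cnj (U p)) \<in> borel_measurable lebesgue"
    using measurable_compose[OF sqiD(1)[OF sqi(1)] borel_measurable_continuous_onI[OF continuous_on_cnj[OF continuous_on_id]]] by simp
  have ebd: "rect_ind a p * exp (- fst p) \<le> ?e" "rect_ind a p * exp (- fst p) \<ge> 0" for p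
    by (auto simp: rect_ind_def)
  have fm: "f \<in> borel_measurable lebesgue" unfolding f_def[abs_def] by (intro borel_measurable_times em cU)
  have fle: "norm (f p) \<le> ?e * norm (V p)" for p
  proof -
    have "norm (f p) = (rect_ind a p * exp (- fst p)) * norm (V p)"
      using ebd(2)[of p] by (simp add: f_def V_def norm_mult rect_ind_def)
    also have "\<dots> \<le> ?e * norm (V p)" using ebd(1) by (intro mult_right_mono) auto
    finally show ?thesis .
  qed
  have f: "sqi f" by (rule sqi_dominated[OF V fm AE_I2[OF fle]])
  have nf: "nrm f \<le> ?e * nrm V" by (rule nrm_le[OF V fm AE_I2[OF fle]]) simp
  have main: "(nrm V)\<^sup>2 \<le> B * (?e * nrm V + \<epsilon>) * D + nrm U * (?e * \<epsilon>)" if \<epsilon>: "\<epsilon> > 0" for \<epsilon>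
  proof -
    obtain N L c where A: "finite N" "finite L" "0 \<notin> L" and 
       ap: "nrm (\<lambda>p. indicator (slab a) p * (f p - flat_trig (modes a N L) c p)) < \<epsilon>"
      using trig_dense[OF a f \<epsilon>] by metis
    let ?A = "modes a N L"
    let ?P = "\<lambda>p. indicator (slab a) p * flat_trig ?A c p" and ?R = "\<lambda>p. indicator (slab a) p * (f p - flat_trig ?A c p)"
    have sf: "indicator (slab a) p * f p = f p" for p
      using slab_facts(1)[of p] by (cases "p \<in> slab a") (auto simp: f_def)
    have sP: "sqi ?P" by (rule sqi_slab_continuous[OF continuous_flat_trig])
    have sR: "sqi ?R" using sqi_diff[OF f sP] by (simp add: right_diff_distrib sf)
    have nP: "nrm ?P \<le> ?e * nrm V + \<epsilon>"
    proof -
      have "?P = (\<lambda>p. f p + (-1) * ?R p)" by (rule ext) (simp add: right_diff_distrib sf)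
      then have "nrm ?P \<le> nrm f + nrm (\<lambda>p. (-1) * ?R p)" using nrm_triangle[OF f sqi_cmult[OF sR, of "-1"]] by simp
      moreover have "nrm (\<lambda>p. (-1) * ?R p) = nrm ?R" using nrm_cmult[of "-1" ?R] by simp
      ultimately show ?thesis using nf ap by linarith
    qed
    have p1: "norm (pairing U (chi K a) (trig ?A c)) \<le> B * nrm ?P * D"
      unfolding B_def D_def F_def C0_def by (rule pairing_trig_bound[OF l A M]) auto
    define g where "g p = complex_of_real (chi K a p * exp (fst p))" for p
    have gm: "g \<in> borel_measurable lebesgue" unfolding g_def[abs_def]
      by (intro measurable_completion) (use borel_measurable_chi(1) in measurable)
    have gb: "norm (g p * ?R p) \<le> ?e * norm (?R p)" for p
    proof (cases "p \<in> slab a")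
      case True
      have "\<bar>chi K a p\<bar> * exp (fst p) \<le> 1 * ?e" 
        using chi_bounds[OF K(1) a, of p] exp_slab[OF True] by (intro mult_mono) auto
      then have "norm (g p) \<le> ?e" by (simp add: g_def abs_mult norm_mult)
      then show ?thesis by (simp only: norm_mult) (intro mult_right_mono; simp)
    qed simp
    have gRm: "(\<lambda>p. g p * ?R p) \<in> borel_measurable lebesgue" using gm sqiD(1)[OF sR] by (rule borel_measurable_times)
    have gR: "sqi (\<lambda>p. g p * ?R p)" "nrm (\<lambda>p. g p * ?R p) \<le> ?e * \<epsilon>"
    proof -
      show "sqi (\<lambda>p. g p * ?R p)" by (rule sqi_dominated[OF sR gRm AE_I2[OF gb]])
      have "nrm (\<lambda>p. g p * ?R p) \<le> ?e * nrm ?R" by (rule nrm_le[OF sR gRm AE_I2[OF gb]]) simp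
      also have "\<dots> \<le> ?e * \<epsilon>" using ap by (intro mult_left_mono) auto
      finally show "nrm (\<lambda>p. g p * ?R p) \<le> ?e * \<epsilon>" .
    qed
    \<comment> \<open>With g = \<open>chi\<close> exp x, the product g f is conj(u) on the rectangle
      and 0 elsewhere, because \<open>chi\<close> is 1 there. Replacing f by the sum plus the
      remainder \<open>?R\<close> gives the two terms.\<close>
    have pw: "of_real ((norm (V p))\<^sup>2) = U p * (complex_of_real (chi K a p) * trig ?A c p) + U p * (g p * ?R p)" for p
    proof -
      have gf: "g p * f p = of_real (rect_ind a p) * cnj (U p)"
      proof -
        have "chi K a p * exp (fst p) * (rect_ind a p * exp (- fst p)) = rect_ind a p"
        proof -
          have "exp (fst p) * exp (- fst p) = 1" by (simp add: exp_minus)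
          moreover have "chi K a p * exp (fst p) * (rect_ind a p * exp (- fst p)) = (rect_ind a p * chi K a p) * (exp (fst p) * exp (- fst p))"
            by (simp only: mult_ac)
          ultimately show ?thesis using chi_rect[of p] by simp
        qed
        then show ?thesis by (simp only: g_def f_def of_real_mult[symmetric] mult.assoc[symmetric])
      qed
      have "g p * (indicator (slab a) p * flat_trig ?A c p) = complex_of_real (chi K a p) * trig ?A c p"
        using slab_facts(2)[of p] by (cases "p \<in> slab a") (auto simp: g_def trig_eq_flat_trig)
      then have "complex_of_real (chi K a p) * trig ?A c p + g p * ?R p = g p * f p"
        by (metis (no_types, lifting) add_diff_cancel_left' add_diff_eq distrib_left right_diff_distrib sf)
      then have "U p * (complex_of_real (chi K a p) * trig ?A c p) + U p * (g p * ?R p) = U p * (of_real (rect_ind a p) * cnj (U p))"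
        by (simp only: distrib_left[symmetric] gf)
      also have "\<dots> = of_real ((norm (V p))\<^sup>2)"
        by (auto simp: V_def rect_ind_def complex_norm_square simp del: of_real_power)
      finally show ?thesis by simp
    qed
    have i1: "integrable lebesgue (\<lambda>p. U p * (complex_of_real (chi K a p) * trig ?A c p))"
      by (rule sqi_integrable_mult[OF sqi(1) sqi_weight_trig]) (use A in \<open>auto simp: modes_def\<close>)
    have "complex_of_real ((nrm V)\<^sup>2) = (\<integral>p. complex_of_real ((norm (V p))\<^sup>2) \<partial>lebesgue)"
      by (simp only: nrm_sq integral_complex_of_real)
    also have "\<dots> = pairing U (chi K a) (trig ?A c) + (\<integral>p. U p * (g p * ?R p) \<partial>lebesgue)"
      unfolding pw by (rule Bochner_Integration.integral_add[OF i1 sqi_integrable_mult[OF sqi(1) gR(1)]])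
    finally have eq: "complex_of_real ((nrm V)\<^sup>2) = pairing U (chi K a) (trig ?A c) + (\<integral>p. U p * (g p * ?R p) \<partial>lebesgue)" .
    have "norm (complex_of_real ((nrm V)\<^sup>2)) \<le> norm (pairing U (chi K a) (trig ?A c)) + norm (\<integral>p. U p * (g p * ?R p) \<partial>lebesgue)"
      unfolding eq by (rule norm_triangle_ineq)
    moreover have "norm (complex_of_real ((nrm V)\<^sup>2)) = (nrm V)\<^sup>2" by (simp only: norm_of_real) simp
    moreover have "norm (\<integral>p. U p * (g p * ?R p) \<partial>lebesgue) \<le> nrm U * (?e * \<epsilon>)"
      using norm_integral_mult_le[OF sqi(1) gR(1)] mult_left_mono[OF gR(2), of "nrm U"] by simp
    moreover have "B * nrm ?P * D \<le> B * (?e * nrm V + \<epsilon>) * D"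
      using nP B0 D0 by (intro mult_right_mono mult_left_mono) auto
    ultimately show ?thesis using p1 by linarith
  qed
  \<comment> \<open>The full norm of u enters only with the factor \<epsilon>, and B and D do not
    depend on the sum chosen for \<epsilon>; so the approximation error disappears.\<close>
  have "((\<lambda>\<epsilon>. B * (?e * nrm V + \<epsilon>) * D + nrm U * (?e * \<epsilon>)) \<longlongrightarrow> B * (?e * nrm V + 0) * D + nrm U * (?e * 0)) (at_right 0)"
    by (intro tendsto_intros)
  then have "(nrm V)\<^sup>2 \<le> B * (?e * nrm V + 0) * D + nrm U * (?e * 0)"
    by (rule tendsto_lowerbound) (auto simp: eventually_at_filter main)
  then have "nrm V * nrm V \<le> (B * ?e * D) * nrm V" by (simp add: power2_eq_square mult_ac)
  then have "nrm V \<le> B * ?e * D" 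
    using B0 D0 nrm_nonneg[of V] by (cases "nrm V = 0") (auto simp: mult_le_cancel_right)
  then show ?thesis unfolding V_def[abs_def] B_def D_def .
qed

end

section \<open>Passage from norms on the domain to norms on the plane, and conclusion\<close>

lemma L2_iff_sqi: "S \<in> sets lebesgue \<Longrightarrow> L2 S f \<longleftrightarrow> sqi (\<lambda>p. indicator S p * f p)"
proof -
  assume S: "S \<in> sets lebesgue"
  have i: "indicator S p * f p = indicator S p *\<^sub>R f p" for p by (simp add: indicator_def)
  have n: "(norm (indicator S p *\<^sub>R f p))\<^sup>2 = indicator S p *\<^sub>R (norm (f p))\<^sup>2" for p by (simp add: indicator_def)
  show ?thesis unfolding L2_def sqi_def i n
    using S by (simp add: integrable_restrict_space borel_measurable_restrict_space_iff)
qed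

lemma L2norm_eq_nrm: "S \<in> sets lebesgue \<Longrightarrow> L2norm S f = nrm (\<lambda>p. indicator S p * f p)"
proof -
  assume S: "S \<in> sets lebesgue"
  have n: "(norm (indicator S p * f p))\<^sup>2 = indicator S p *\<^sub>R (norm (f p))\<^sup>2" for p by (simp add: indicator_def)
  show ?thesis unfolding L2norm_def nrm_def n using S by (simp add: integral_restrict_space)
qed

lemma integral_on_eq: "S \<in> sets lebesgue \<Longrightarrow> (\<integral>p. f p * g p \<partial>lebesgue_on S) = (\<integral>p. (indicator S p * f p) * g p \<partial>(lebesgue :: (real \<times> real) measure))"
  for f g :: "real \<times> real \<Rightarrow> complex"
  by (simp add: integral_restrict_space) (intro Bochner_Integration.integral_cong refl, simp add: indicator_def)

lemma rect_weak_instance: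
  assumes pr: "partially_rectangular \<Omega> a" and K: "0 < K" "K \<le> 1"
    and cusp: "\<And>x y. \<bar>y\<bar> < pi \<Longrightarrow> \<bar>x\<bar> < a + K * sqrt (cos (y/2)) \<Longrightarrow> (x, y) \<in> \<Omega>"
    and h2: "H2 \<Omega> u" and h10: "H10 \<Omega> u"
  shows "rect_weak \<Omega> a K (\<lambda>p. indicator \<Omega> p * u p) (\<lambda>p. indicator \<Omega> p * wd \<Omega> [True] u p)
     (\<lambda>p. indicator \<Omega> p * wd \<Omega> [True, True] u p) (\<lambda>p. indicator \<Omega> p * wd \<Omega> [False] u p) (\<lambda>p. indicator \<Omega> p * wd \<Omega> [False, False] u p)"
proof
  have op: "open \<Omega>" and fr: "{-a..a} \<times> {pi, -pi} \<subseteq> frontier \<Omega>" using pr unfolding partially_rectangular_def by auto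
  show "a > 0" using pr unfolding partially_rectangular_def by auto
  have S: "\<Omega> \<in> sets lebesgue" using op by simp
  show "(x, pi) \<notin> \<Omega> \<and> (x, - pi) \<notin> \<Omega>" if "\<bar>x\<bar> \<le> a" for x
  proof -
    have "(x, pi) \<in> frontier \<Omega>" "(x, -pi) \<in> frontier \<Omega>" using fr that by (auto simp: abs_le_iff)
    then show ?thesis using op by (simp add: frontier_def interior_open)
  qed
  \<comment> \<open>The function \<open>wd\<close> is a choice among weak derivatives; its
    properties hold because H^2 provides one for every word of length at most 2.\<close>
  have wd: "L2 \<Omega> (wd \<Omega> ws u)" "weak_deriv \<Omega> ws u (wd \<Omega> ws u)" if "length ws \<le> 2" for ws
    using someI_ex[of "\<lambda>v. L2 \<Omega> v \<and> weak_deriv \<Omega> ws u v"] h2 that unfolding wd_def H2_def by auto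
  show "sqi (\<lambda>p. indicator \<Omega> p * u p)" using h2 L2_iff_sqi[OF S] unfolding H2_def by blast
  have sq: "sqi (\<lambda>p. indicator \<Omega> p * wd \<Omega> ws u p)" if "length ws \<le> 2" for ws
    using wd(1)[OF that] L2_iff_sqi[OF S] by blast
  show "sqi (\<lambda>p. indicator \<Omega> p * wd \<Omega> [True] u p)" "sqi (\<lambda>p. indicator \<Omega> p * wd \<Omega> [True, True] u p)"
    "sqi (\<lambda>p. indicator \<Omega> p * wd \<Omega> [False] u p)" "sqi (\<lambda>p. indicator \<Omega> p * wd \<Omega> [False, False] u p)"
    by (rule sq; simp)+
  have wk: "(\<integral>p. (indicator \<Omega> p * u p) * complex_of_real (dpart ws \<phi> p) \<partial>lebesgue) = 
    (-1) ^ length ws * (\<integral>p. (indicator \<Omega> p * wd \<Omega> ws u p) * complex_of_real (\<phi> p) \<partial>lebesgue)" 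
    if "length ws \<le> 2" "test_fun \<Omega> \<phi>" for ws and \<phi> :: "real \<times> real \<Rightarrow> real"
    using wd(2)[OF that(1)] that(2) unfolding weak_deriv_def integral_on_eq[OF S] by blast
  show "(\<integral>p. (indicator \<Omega> p * u p) * complex_of_real (px \<phi> p) \<partial>lebesgue) = - (\<integral>p. (indicator \<Omega> p * wd \<Omega> [True] u p) * complex_of_real (\<phi> p) \<partial>lebesgue)"
    if "test_fun \<Omega> \<phi>" for \<phi> using wk[of "[True]" \<phi>] that by simp
  show "(\<integral>p. (indicator \<Omega> p * u p) * complex_of_real (px (px \<phi>) p) \<partial>lebesgue) = (\<integral>p. (indicator \<Omega> p * wd \<Omega> [True, True] u p) * complex_of_real (\<phi> p) \<partial>lebesgue)"
    if "test_fun \<Omega> \<phi>" for \<phi> using wk[of "[True, True]" \<phi>] that by simp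
  show "(\<integral>p. (indicator \<Omega> p * u p) * complex_of_real (py (py \<phi>) p) \<partial>lebesgue) = (\<integral>p. (indicator \<Omega> p * wd \<Omega> [False, False] u p) * complex_of_real (\<phi> p) \<partial>lebesgue)"
    if "test_fun \<Omega> \<phi>" for \<phi> using wk[of "[False, False]" \<phi>] that by simp
  obtain \<phi>s :: "nat \<Rightarrow> real \<times> real \<Rightarrow> complex" where \<phi>: "\<And>n. test_fun \<Omega> (\<phi>s n)" and
    lim: "(\<lambda>n. L2norm \<Omega> (\<lambda>p. \<phi>s n p - u p) + L2norm \<Omega> (\<lambda>p. px (\<phi>s n) p - wd \<Omega> [True] u p)
             + L2norm \<Omega> (\<lambda>p. py (\<phi>s n) p - wd \<Omega> [False] u p)) \<longlonglongrightarrow> 0"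
    using h10 unfolding H10_def by blast
  have n0: "L2norm \<Omega> v \<ge> 0" for v by (simp add: L2norm_def)
  have l1: "(\<lambda>n. L2norm \<Omega> (\<lambda>p. \<phi>s n p - u p)) \<longlonglongrightarrow> 0"
    by (rule tendsto_sandwich[OF _ _ tendsto_const lim]) (use n0 in \<open>auto intro!: always_eventually add_nonneg_nonneg simp: add.assoc\<close>)
  have l2: "(\<lambda>n. L2norm \<Omega> (\<lambda>p. py (\<phi>s n) p - wd \<Omega> [False] u p)) \<longlonglongrightarrow> 0"
    by (rule tendsto_sandwich[OF _ _ tendsto_const lim]) (use n0 in \<open>auto intro!: always_eventually add_nonneg_nonneg\<close>)
  have z: "indicator \<Omega> p * \<phi>s n p = \<phi>s n p" "indicator \<Omega> p * py (\<phi>s n) p = py (\<phi>s n) p" for n p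
    using test_fun_facts(5)[OF \<phi>[of n], of p] test_fun_facts(7)[OF \<phi>[of n], of p] by (auto simp: indicator_def)
  show "\<exists>\<phi>s :: nat \<Rightarrow> real \<times> real \<Rightarrow> complex. (\<forall>n. test_fun \<Omega> (\<phi>s n)) \<and>
        (\<lambda>n. nrm (\<lambda>p. \<phi>s n p - indicator \<Omega> p * u p)) \<longlonglongrightarrow> 0 \<and> (\<lambda>n. nrm (\<lambda>p. py (\<phi>s n) p - indicator \<Omega> p * wd \<Omega> [False] u p)) \<longlonglongrightarrow> 0"
    using \<phi> l1 l2 unfolding L2norm_eq_nrm[OF S] right_diff_distrib z by blast
qed (use K cusp in auto)

text \<open>The total relative size of what remains after all three inequalities fail: C1 K0
  l^(-\<epsilon>0) from the right side of the equation, three times C1 l^(-\<delta>) from the wing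
  terms of the estimate, and once more l^(-\<delta>) from the norm of u on the wings itself.\<close>

lemma powr_contradiction:
  fixes C1 K0 \<epsilon>0 \<delta> :: real
  assumes "\<epsilon>0 > 0" "\<delta> > 0"
  shows "\<forall>\<^sub>F l in at_top. C1 * K0 * l powr (-\<epsilon>0) + (3 * C1 + 1) * l powr (-\<delta>) < 1"
proof -
  have "((\<lambda>l. C1 * K0 * l powr (-\<epsilon>0) + (3 * C1 + 1) * l powr (-\<delta>)) \<longlongrightarrow> C1 * K0 * 0 + (3 * C1 + 1) * 0) at_top"
    using assms by (intro tendsto_intros tendsto_neg_powr filterlim_ident) auto
  then show ?thesis by (rule order_tendstoD(2)) simp
qed

theorem theorem1:
  fixes \<Omega> :: "(real \<times> real) set" and a \<epsilon>0 :: real and E :: "real \<Rightarrow> real"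
    and u :: "real \<Rightarrow> real \<times> real \<Rightarrow> complex"
  assumes "partially_rectangular \<Omega> a"
    and "\<epsilon>0 > 0"
    and "E \<in> O[at_top](\<lambda>l. l powr (-\<epsilon>0))"
    and "\<forall>\<^sub>F l in at_top. H2 \<Omega> (u l) \<and> H10 \<Omega> (u l) \<and>
           L2norm \<Omega> (\<lambda>p. - lap \<Omega> (u l) p - complex_of_real (l\<^sup>2) * u l p) \<le> E l * L2norm \<Omega> (u l)"
  shows "\<forall>\<delta>>0. \<exists>c>0. \<forall>\<^sub>F l in at_top.
           L2norm (\<Omega> - Rect a) (u l) \<ge> c * l powr (-2-\<delta>) * L2norm \<Omega> (u l) \<or>
           L2norm (\<Omega> - Rect a) (\<lambda>p. complex_of_real (1/l) * (- \<i> * wd \<Omega> [True] (u l) p))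
              \<ge> c * l powr (-2-\<delta>) * L2norm \<Omega> (u l) \<or>
           L2norm (\<Omega> - Rect a) (\<lambda>p. (complex_of_real (1/l) * (- \<i>))\<^sup>2 * wd \<Omega> [True, True] (u l) p)
              \<ge> c * l powr (-2-\<delta>) * L2norm \<Omega> (u l)"
proof (intro allI impI exI[of _ 1] conjI)
  \<comment> \<open>The constant 1 is possible for every \<delta>: the factor l^(-\<delta>) beats
    any fixed constant once l is large.\<close>
  fix \<delta> :: real assume \<delta>: "\<delta> > 0"
  have op: "open \<Omega>" and a: "a > 0" using assms(1) unfolding partially_rectangular_def by auto
  obtain K where K: "0 < K" "K \<le> 1" and cusp: "\<And>x y. \<bar>y\<bar> < pi \<Longrightarrow> \<bar>x\<bar> < a + K * sqrt (cos (y/2)) \<Longrightarrow> (x, y) \<in> \<Omega>"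
    using partially_rectangular_cusp[OF assms(1)] by metis
  obtain M where M: "M > 0"
    "\<And>K a p. K > 0 \<Longrightarrow> \<bar>snd p\<bar> < pi \<Longrightarrow> \<bar>chi_x K a p\<bar> \<le> M * wt K (snd p)"
    "\<And>K a p. K > 0 \<Longrightarrow> \<bar>snd p\<bar> < pi \<Longrightarrow> \<bar>chi_xx K a p\<bar> \<le> M * (wt K (snd p))\<^sup>2"
    using chi_deriv_bounds by metis
  define C0 where "C0 = 16 * (a + 1) / pi + 8"
  define C1 where "C1 = (exp (a + 1) * (C0 + 12 * M * C0 / K + 18 * M * C0 / K\<^sup>2 + C0)) * exp (a + 1)"
  have C0: "C0 > 0" unfolding C0_def using a by (intro add_nonneg_pos) auto
  have C1: "C1 \<ge> 0" using C0 M(1) K by (simp add: C1_def)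
  obtain K0 where K0: "K0 > 0" "\<forall>\<^sub>F l in at_top. norm (E l) \<le> K0 * norm (l powr (-\<epsilon>0))"
    using landau_o.bigE[OF assms(3)] by metis
  have S: "\<Omega> \<in> sets lebesgue" and SW: "\<Omega> - Rect a \<in> sets lebesgue" 
  proof -
    have "closed (Rect a)" by (simp add: Rect_def closed_Times)
    then have "Rect a \<in> sets lebesgue" by (intro sets_completionI_sets) (simp add: borel_closed)
    moreover show "\<Omega> \<in> sets lebesgue" using op by simp
    ultimately show "\<Omega> - Rect a \<in> sets lebesgue" by (rule sets.Diff[rotated])
  qed
  show "\<forall>\<^sub>F l in at_top.
           L2norm (\<Omega> - Rect a) (u l) \<ge> 1 * l powr (-2-\<delta>) * L2norm \<Omega> (u l) \<or>
           L2norm (\<Omega> - Rect a) (\<lambda>p. complex_of_real (1/l) * (- \<i> * wd \<Omega> [True] (u l) p))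
              \<ge> 1 * l powr (-2-\<delta>) * L2norm \<Omega> (u l) \<or>
           L2norm (\<Omega> - Rect a) (\<lambda>p. (complex_of_real (1/l) * (- \<i>))\<^sup>2 * wd \<Omega> [True, True] (u l) p)
              \<ge> 1 * l powr (-2-\<delta>) * L2norm \<Omega> (u l)"
    using assms(4) K0(2) eventually_ge_at_top[of 1] powr_contradiction[OF assms(2) \<delta>, of C1 K0]
  proof eventually_elim
    case (elim l)
    define v where "v = u l"
    define n where "n = L2norm \<Omega> v"
    define w0 where "w0 = L2norm (\<Omega> - Rect a) v"
    define w1 where "w1 = L2norm (\<Omega> - Rect a) (wd \<Omega> [True] v)"
    define w2 where "w2 = L2norm (\<Omega> - Rect a) (wd \<Omega> [True, True] v)"
    have l: "l \<ge> 1" using elim by simp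
    interpret rect_weak \<Omega> a K "\<lambda>p. indicator \<Omega> p * v p" "\<lambda>p. indicator \<Omega> p * wd \<Omega> [True] v p"
      "\<lambda>p. indicator \<Omega> p * wd \<Omega> [True, True] v p" "\<lambda>p. indicator \<Omega> p * wd \<Omega> [False] v p" "\<lambda>p. indicator \<Omega> p * wd \<Omega> [False, False] v p"
      using rect_weak_instance[OF assms(1) K cusp] elim unfolding v_def by blast
    have out: "nrm (outer (\<lambda>p. indicator \<Omega> p * g p)) = L2norm (\<Omega> - Rect a) g" if g: "sqi (\<lambda>p. indicator \<Omega> p * g p)" for g
      unfolding L2norm_eq_nrm[OF SW]
    proof (rule nrm_cong_AE)
      \<comment> \<open>\<open>Rect a\<close> is closed and \<open>rect_ind a\<close> belongs to the
        open rectangle; they differ on four lines, a null set.\<close>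
      have ae: "AE p in lebesgue. outer (\<lambda>p. indicator \<Omega> p * g p) p = indicator (\<Omega> - Rect a) p * g p"
        using AE_fst_neq[of a] AE_fst_neq[of "-a"] AE_snd_neq[of pi] AE_snd_neq[of "-pi"]
      proof eventually_elim
        case (elim p)
        have "p \<in> Rect a \<longleftrightarrow> rect_ind a p = 1" using elim
          by (cases p) (auto simp: Rect_def rect_ind_def abs_less_iff abs_le_iff)
        then show ?case by (cases "p \<in> \<Omega>") (auto simp: outer_def rect_ind_def indicator_def split: if_splits)
      qed
      then show "AE p in lebesgue. norm (outer (\<lambda>p. indicator \<Omega> p * g p) p) = norm (indicator (\<Omega> - Rect a) p * g p)"
        by eventually_elim simp
      show om: "outer (\<lambda>p. indicator \<Omega> p * g p) \<in> borel_measurable lebesgue" using sqiD(1)[OF sqi_outer[OF g]] .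
      have "(\<lambda>p. indicator (\<Omega> - Rect a) p * (indicator \<Omega> p * g p)) \<in> borel_measurable lebesgue"
        by (intro borel_measurable_times borel_measurable_indicator SW sqiD(1)[OF g])
      moreover have "indicator (\<Omega> - Rect a) p * (indicator \<Omega> p * g p) = indicator (\<Omega> - Rect a) p * g p" for p
        by (simp add: indicator_def)
      ultimately show "(\<lambda>p. indicator (\<Omega> - Rect a) p * g p) \<in> borel_measurable lebesgue" by simp
    qed
    let ?F = "\<lambda>p. - (indicator \<Omega> p * wd \<Omega> [True, True] v p + indicator \<Omega> p * wd \<Omega> [False, False] v p) - of_real (l\<^sup>2) * (indicator \<Omega> p * v p)"
    have nF: "nrm ?F \<le> K0 * l powr (-\<epsilon>0) * n"
    proof -
      have "nrm ?F = L2norm \<Omega> (\<lambda>p. - lap \<Omega> v p - complex_of_real (l\<^sup>2) * v p)"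
        unfolding L2norm_eq_nrm[OF S] lap_def by (intro arg_cong[of _ _ nrm] ext) (simp add: indicator_def)
      also have "\<dots> \<le> E l * n" using elim unfolding v_def n_def by blast
      also have "\<dots> \<le> (K0 * l powr (-\<epsilon>0)) * n"
        using elim by (intro mult_right_mono) (auto simp: n_def L2norm_def)
      finally show ?thesis .
    qed
    have inner: "nrm (\<lambda>p. of_real (rect_ind a p) * (indicator \<Omega> p * v p)) \<le> C1 * (nrm ?F + w2 + l * w1 + l\<^sup>2 * w0)"
      using inner_estimate[OF l less_imp_le[OF M(1)] M(2)[OF K(1)] M(3)[OF K(1)]]
      unfolding out[OF sqi(1)] out[OF sqi(2)] out[OF sqi(3)] w0_def w1_def w2_def C1_def C0_def by simp
    have nle: "n \<le> nrm (\<lambda>p. of_real (rect_ind a p) * (indicator \<Omega> p * v p)) + w0"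
    proof -
      have "n = nrm (\<lambda>p. of_real (rect_ind a p) * (indicator \<Omega> p * v p) + outer (\<lambda>p. indicator \<Omega> p * v p) p)"
        unfolding n_def L2norm_eq_nrm[OF S] by (intro arg_cong[of _ _ nrm] ext) (simp add: outer_def algebra_simps)
      also have "\<dots> \<le> nrm (\<lambda>p. of_real (rect_ind a p) * (indicator \<Omega> p * v p)) + nrm (outer (\<lambda>p. indicator \<Omega> p * v p))"
        by (rule nrm_triangle[OF sqi_inner[OF sqi(1)] sqi_outer[OF sqi(1)]])
      finally show ?thesis unfolding out[OF sqi(1)] w0_def .
    qed
    have scale: "L2norm (\<Omega> - Rect a) (\<lambda>p. c * g p) = norm c * L2norm (\<Omega> - Rect a) g" for c g
    proof -
      have "(\<lambda>p. indicator (\<Omega> - Rect a) p * (c * g p)) = (\<lambda>p. c * (indicator (\<Omega> - Rect a) p * g p))" by (simp add: mult_ac)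
      then show ?thesis unfolding L2norm_eq_nrm[OF SW] by (simp only: nrm_cmult)
    qed
    have s1: "L2norm (\<Omega> - Rect a) (\<lambda>p. complex_of_real (1/l) * (- \<i> * wd \<Omega> [True] v p)) = w1 / l"
      using l scale[of "complex_of_real (1/l) * (- \<i>)" "wd \<Omega> [True] v"] by (simp add: w1_def norm_mult norm_divide mult.assoc)
    have s2: "L2norm (\<Omega> - Rect a) (\<lambda>p. (complex_of_real (1/l) * (- \<i>))\<^sup>2 * wd \<Omega> [True, True] v p) = w2 / l\<^sup>2"
      using l scale[of "(complex_of_real (1/l) * (- \<i>))\<^sup>2" "wd \<Omega> [True, True] v"] by (simp add: w2_def norm_mult norm_divide norm_power power_mult_distrib power_divide)
    show ?case
    proof (rule ccontr)
      assume "\<not> ?thesis"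
      then have lt: "w0 < l powr (-2-\<delta>) * n" "w1 / l < l powr (-2-\<delta>) * n" "w2 / l\<^sup>2 < l powr (-2-\<delta>) * n"
        unfolding v_def[symmetric] s1 s2 n_def[symmetric] w0_def[symmetric] by auto
      have w0: "w0 \<ge> 0" by (simp add: w0_def L2norm_def)
      have pr: "l powr (-2-\<delta>) * l\<^sup>2 = l powr (-\<delta>)"
      proof -
        have "l\<^sup>2 = l powr 2" using l by simp
        then show ?thesis by (simp add: powr_add[symmetric])
      qed
      \<comment> \<open>For the zero function all three inequalities hold with equality, so their
        failure forces a positive norm; this makes the last inequality strict.\<close>
      have n: "n > 0" using lt(1) w0 l by (metis less_le_trans not_le powr_ge_zero zero_less_mult_pos linorder_not_le mult_nonneg_nonpos order_less_le_trans)
      have l2: "l\<^sup>2 > 0" using l by simp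
      \<comment> \<open>The exponent -2 is exactly what the estimate consumes: the weight of the
        norm of u is l^2, that of u_x is l with another l from the semiclassical scaling, and that
        of u_xx is 1 with l^2 from the scaling. Each term is left with l^(-\<delta>).\<close>
      have b0: "l\<^sup>2 * w0 \<le> l powr (-\<delta>) * n"
        using mult_left_mono[OF less_imp_le[OF lt(1)], of "l\<^sup>2"] pr by (simp add: mult_ac)
      have b1: "l * w1 \<le> l powr (-\<delta>) * n"
      proof -
        have "w1 \<le> l powr (-2-\<delta>) * n * l" using lt(2) l by (simp add: divide_less_eq)
        then have "l * w1 \<le> l * (l powr (-2-\<delta>) * n * l)" using l by (intro mult_left_mono) auto
        also have "\<dots> = (l powr (-2-\<delta>) * l\<^sup>2) * n" by (simp only: power2_eq_square mult_ac)
        finally show ?thesis unfolding pr .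
      qed
      have b2: "w2 \<le> l powr (-\<delta>) * n"
        using mult_left_mono[OF less_imp_le[OF lt(3)], of "l\<^sup>2"] pr l by (simp add: mult_ac)
      have b3: "w0 \<le> l powr (-\<delta>) * n"
      proof -
        have "1 * w0 \<le> l\<^sup>2 * w0" using l w0 by (intro mult_right_mono) (auto simp: one_le_power)
        then show ?thesis using b0 by simp
      qed
      have "nrm ?F + w2 + l * w1 + l\<^sup>2 * w0 \<le> (K0 * l powr (-\<epsilon>0) + 3 * l powr (-\<delta>)) * n"
        using nF b0 b1 b2 by (simp add: distrib_right)
      then have "n \<le> C1 * ((K0 * l powr (-\<epsilon>0) + 3 * l powr (-\<delta>)) * n) + l powr (-\<delta>) * n"
        using nle inner b3 mult_left_mono[OF _ C1] by (meson add_mono order_trans)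
      also have "\<dots> = (C1 * K0 * l powr (-\<epsilon>0) + (3 * C1 + 1) * l powr (-\<delta>)) * n" by (simp add: algebra_simps)
      also have "\<dots> < 1 * n" using elim n by (intro mult_strict_right_mono) auto
      finally show False by simp
    qed
  qed
qed simp

end
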